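(* Minimality of the centralizer is typical in $(\mathbf{Mix}_\infty,r)$: there is a dense $G_\delta$-subset $G$ of $\mathbf{Mix}_\infty$ (with respect to the topology of the metric $r$) such that every $T\in G$ commutes only with its powers, i.e. if $U\in\mathbf{Aut}(\mu)$ and $UT=TU$, then $U=T^n$ for some $n\in\mathbf Z$ (equality almost everywhere).
   Context: Let $(X,\mathcal B,\mu)$ be a measure space isomorphic to the real line $\mathbf R$ with Lebesgue measure. $\mathbf{Aut}_\infty=\mathbf{Aut}(\mu)$ is the group of all invertible measure-preserving transformations (automorphisms) of $(X,\mathcal B,\mu)$, with transformations equal almost everywhere identified. Fix a sequence $\{A_i\}_{i\ge 1}$ of sets of finite measure, dense in the family of all measurable sets of finite measure (with respect to the pseudometric $\mu(A\Delta B)$), and such that $\sum_i 2^{-i}\mu(A_i)<\infty$, so that the sums below converge. Define $$\rho(S,T)=\sum_i 2^{-i}\left(\mu(SA_i\Delta TA_i)+\mu(S^{-1}A_i\Delta T^{-1}A_i)\right),$$ $$d_w(S,T)=\sum_{i,j=1}^\infty 2^{-i-j}\left|\mu(SA_i\cap A_j)-\mu(TA_i\cap A_j)\right|,$$ $$r(S,T)=\rho(S,T)+\sup_{n>0}d_w(S^n,T^n).$$ An automorphism $T$ is called mixing if $T^n\to_w 0$, that is, $\mu(T^nA\cap B)\to 0$ as $n\to\infty$ for all measurable $A,B$ of finite measure. Set $\mathbf{Mix}_\infty=\{T\in\mathbf{Aut}(\mu): T^n\to_w 0\}$, equipped with the metric $r$. A property is called typical if a dense $G_\delta$-set of transformations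 has this property. *)

theory Defs
  imports "HOL-Analysis.Analysis" "HOL-Algebra.Group"
begin

definition measure_iso :: "'a measure \<Rightarrow> 'b measure \<Rightarrow> ('a \<Rightarrow> 'b) \<Rightarrow> bool" where
  "measure_iso M N f \<longleftrightarrow>
     bij_betw f (space M) (space N) \<and> f \<in> measurable M N \<and>
     inv_into (space M) f \<in> measurable N M \<and> distr M N f = N"

text \<open>Isomorphism of measure spaces in the sense of ergodic theory, that is, after removing
  a null set on each side.\<close>

definition isomorphic_mod0 :: "'a measure \<Rightarrow> 'b measure \<Rightarrow> bool" where
  "isomorphic_mod0 M N \<longleftrightarrow>
     (\<exists>X Y f. X \<in> sets M \<and> space M - X \<in> null_sets M \<and>
        Y \<in> sets N \<and> space N - Y \<in> null_sets N \<and>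
        measure_iso (restrict_space M X) (restrict_space N Y) f)"

text \<open>Representatives of automorphisms are honest bijections of the space. An invertible map
  defined modulo null sets restricts to a bijection of an invariant set of full measure and can be
  extended by the identity, so every automorphism modulo null sets has such a representative.\<close>

definition aut_maps :: "'a measure \<Rightarrow> ('a \<Rightarrow> 'a) set" where
  "aut_maps M = {f. measure_iso M M f}"

definition ae_rel :: "'a measure \<Rightarrow> (('a \<Rightarrow> 'a) \<times> ('a \<Rightarrow> 'a)) set" where
  "ae_rel M = {(f, g). f \<in> aut_maps M \<and> g \<in> aut_maps M \<and> (AE x in M. f x = g x)}"

definition rep :: "('a \<Rightarrow> 'a) set \<Rightarrow> 'a \<Rightarrow> 'a" where
  "rep T = (SOME f. f \<in> T)"

definition Aut :: "'a measure \<Rightarrow> ('a \<Rightarrow> 'a) set monoid" where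
  "Aut M = \<lparr>carrier = aut_maps M // ae_rel M,
            mult = (\<lambda>S T. ae_rel M `` {rep S \<circ> rep T}),
            one = ae_rel M `` {id}\<rparr>"

text \<open>The set \<open>T A\<close>; it depends on the representative only up to a null set.\<close>

definition act :: "('a \<Rightarrow> 'a) set \<Rightarrow> 'a set \<Rightarrow> 'a set" where
  "act T A = rep T ` A"

definition mixing :: "'a measure \<Rightarrow> ('a \<Rightarrow> 'a) set \<Rightarrow> bool" where
  "mixing M T \<longleftrightarrow>
     (\<forall>A \<in> fmeasurable M. \<forall>B \<in> fmeasurable M.
        (\<lambda>n::nat. measure M (act (T [^]\<^bsub>Aut M\<^esub> n) A \<inter> B)) \<longlonglongrightarrow> 0)"

definition Mix :: "'a measure \<Rightarrow> ('a \<Rightarrow> 'a) set set" where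
  "Mix M = {T \<in> carrier (Aut M). mixing M T}"

definition dense_family :: "'a measure \<Rightarrow> (nat \<Rightarrow> 'a set) \<Rightarrow> bool" where
  "dense_family M A \<longleftrightarrow>
     (\<forall>i\<ge>1. A i \<in> fmeasurable M) \<and>
     (\<forall>B \<in> fmeasurable M. \<forall>e>0. \<exists>i\<ge>1. measure M (sym_diff (A i) B) < e) \<and>
     (\<lambda>i. (1/2) ^ i * measure M (A i)) summable_on {1..}"

definition rho ::
  "'a measure \<Rightarrow> (nat \<Rightarrow> 'a set) \<Rightarrow> ('a \<Rightarrow> 'a) set \<Rightarrow> ('a \<Rightarrow> 'a) set \<Rightarrow> real" where
  "rho M A S T =
     (\<Sum>\<^sub>\<infinity>i\<in>{1..}. (1/2) ^ i *
        (measure M (sym_diff (act S (A i)) (act T (A i))) +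
         measure M (sym_diff (act (inv\<^bsub>Aut M\<^esub> S) (A i)) (act (inv\<^bsub>Aut M\<^esub> T) (A i)))))"

definition d_w ::
  "'a measure \<Rightarrow> (nat \<Rightarrow> 'a set) \<Rightarrow> ('a \<Rightarrow> 'a) set \<Rightarrow> ('a \<Rightarrow> 'a) set \<Rightarrow> real" where
  "d_w M A S T =
     (\<Sum>\<^sub>\<infinity>(i, j)\<in>{1..} \<times> {1..}. (1/2) ^ (i + j) *
        \<bar>measure M (act S (A i) \<inter> A j) - measure M (act T (A i) \<inter> A j)\<bar>)"

definition r_metric ::
  "'a measure \<Rightarrow> (nat \<Rightarrow> 'a set) \<Rightarrow> ('a \<Rightarrow> 'a) set \<Rightarrow> ('a \<Rightarrow> 'a) set \<Rightarrow> real" where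
  "r_metric M A S T =
     rho M A S T + (SUP n\<in>{0::nat<..}. d_w M A (S [^]\<^bsub>Aut M\<^esub> n) (T [^]\<^bsub>Aut M\<^esub> n))"

definition Mix_topology :: "'a measure \<Rightarrow> (nat \<Rightarrow> 'a set) \<Rightarrow> ('a \<Rightarrow> 'a) set topology" where
  "Mix_topology M A = Metric_space.mtopology (Mix M) (r_metric M A)"

text \<open>Well-definedness: \<open>Aut M\<close> is a group, the action is independent of representatives,
  and \<open>r_metric\<close> is a metric on it.\<close>

lemma aut_mapsD:
  assumes "f \<in> aut_maps M"
  shows "bij_betw f (space M) (space M)" "f \<in> measurable M M"
    "inv_into (space M) f \<in> measurable M M" "distr M M f = M"
  using assms by (auto simp: aut_maps_def measure_iso_def)

lemma aut_maps_id: "id \<in> aut_maps M"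
proof -
  have "inv_into (space M) id \<in> measurable M M"
    by (rule measurable_cong[THEN iffD2, of _ _ "\<lambda>x. x"]) auto
  then show ?thesis
    by (auto simp: aut_maps_def measure_iso_def id_def bij_betw_def)
qed

lemma aut_maps_comp:
  assumes "f \<in> aut_maps M" "g \<in> aut_maps M"
  shows "f \<circ> g \<in> aut_maps M"
proof -
  note f = aut_mapsD[OF assms(1)] and g = aut_mapsD[OF assms(2)]
  have b: "bij_betw (f \<circ> g) (space M) (space M)" using bij_betw_trans[OF g(1) f(1)] .
  have "inv_into (space M) (f \<circ> g) \<in> measurable M M"
  proof (rule measurable_cong[THEN iffD2])
    show "inv_into (space M) g \<circ> inv_into (space M) f \<in> measurable M M"
      using f g by (auto intro: measurable_comp)
    fix x assume x: "x \<in> space M"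
    show "inv_into (space M) (f \<circ> g) x = (inv_into (space M) g \<circ> inv_into (space M) f) x"
      by (rule inv_into_f_eq)
         (use b f g x in \<open>auto simp: bij_betw_def inj_on_def inv_into_into f_inv_into_f\<close>)
  qed
  moreover have "distr M M (f \<circ> g) = M"
    using distr_distr[OF f(2) g(2)] f g by simp
  ultimately show ?thesis using b f g
    by (auto simp: aut_maps_def measure_iso_def)
qed

lemma aut_maps_inv:
  assumes "f \<in> aut_maps M"
  shows "inv_into (space M) f \<in> aut_maps M"
proof -
  note f = aut_mapsD[OF assms]
  let ?g = "inv_into (space M) f"
  have b: "bij_betw ?g (space M) (space M)" using f(1) by (rule bij_betw_inv_into)
  have 1: "inv_into (space M) ?g \<in> measurable M M"
    by (rule measurable_cong[THEN iffD2, of _ _ f])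
       (use f in \<open>auto simp: inv_into_inv_into_eq\<close>)
  have "distr M M ?g = distr (distr M M f) M ?g" using f by simp
  also have "\<dots> = distr M M (?g \<circ> f)" by (rule distr_distr[OF f(3,2)])
  also have "\<dots> = distr M M (\<lambda>x. x)"
    by (rule distr_cong) (use f in \<open>auto simp: bij_betw_def\<close>)
  finally show ?thesis using b 1 f
    by (auto simp: aut_maps_def measure_iso_def)
qed

lemma AE_aut:
  assumes "f \<in> aut_maps M" "AE x in M. P x"
  shows "AE x in M. P (f x)"
  using AE_distrD[OF aut_mapsD(2)[OF assms(1)], of P] assms(2) by (simp only: aut_mapsD(4)[OF assms(1)])

lemma equiv_ae_rel: "equiv (aut_maps M) (ae_rel M)"
proof (rule equivI)
  show "sym (ae_rel M)" by (auto simp: sym_def ae_rel_def)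
  show "trans (ae_rel M)" by (auto simp: trans_def ae_rel_def)
qed (auto simp: refl_on_def ae_rel_def)

lemma rep_in: "T \<in> carrier (Aut M) \<Longrightarrow> rep T \<in> T"
  unfolding rep_def Aut_def using some_in_eq in_quotient_imp_non_empty[OF equiv_ae_rel] by auto

lemma rep_aut: "T \<in> carrier (Aut M) \<Longrightarrow> rep T \<in> aut_maps M"
  using rep_in in_quotient_imp_subset[OF equiv_ae_rel] by (fastforce simp: Aut_def)

lemma ae_class_rep:
  assumes "T \<in> carrier (Aut M)"
  shows "ae_rel M `` {rep T} = T"
proof -
  have "T \<in> aut_maps M // ae_rel M" using assms by (simp add: Aut_def)
  then obtain f where f: "f \<in> aut_maps M" "T = ae_rel M `` {f}" by (rule quotientE)
  then have "(f, rep T) \<in> ae_rel M" using rep_in[OF assms] by blast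
  then show ?thesis using equiv_class_eq[OF equiv_ae_rel] f(2) by blast
qed

lemma ae_class_carrier: "f \<in> aut_maps M \<Longrightarrow> ae_rel M `` {f} \<in> carrier (Aut M)"
  by (auto simp: Aut_def quotientI)

lemma ae_class_eq: "f \<in> aut_maps M \<Longrightarrow> g \<in> aut_maps M \<Longrightarrow>
  ae_rel M `` {f} = ae_rel M `` {g} \<longleftrightarrow> (AE x in M. f x = g x)"
  by (subst eq_equiv_class_iff[OF equiv_ae_rel]) (auto simp: ae_rel_def)

lemma rep_ae_class: "f \<in> aut_maps M \<Longrightarrow> AE x in M. rep (ae_rel M `` {f}) x = f x"
  using rep_in[OF ae_class_carrier, of f M] by (auto simp: ae_rel_def)

lemma mult_ae_class:
  assumes "f \<in> aut_maps M" "g \<in> aut_maps M"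
  shows "ae_rel M `` {f} \<otimes>\<^bsub>Aut M\<^esub> ae_rel M `` {g} = ae_rel M `` {f \<circ> g}"
proof -
  let ?f = "rep (ae_rel M `` {f})" and ?g = "rep (ae_rel M `` {g})"
  have m: "?f \<in> aut_maps M" "?g \<in> aut_maps M" using assms by (auto intro: rep_aut ae_class_carrier)
  have "AE x in M. ?f (?g x) = f (?g x)" by (rule AE_aut[OF m(2) rep_ae_class[OF assms(1)]])
  then have "AE x in M. (?f \<circ> ?g) x = (f \<circ> g) x"
    using rep_ae_class[OF assms(2)] by eventually_elim simp
  then have "ae_rel M `` {?f \<circ> ?g} = ae_rel M `` {f \<circ> g}"
    by (subst ae_class_eq) (auto intro: aut_maps_comp m assms)
  then show ?thesis by (simp add: Aut_def)
qed

lemma group_Aut: "group (Aut M)"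
proof (rule groupI)
  have one: "\<one>\<^bsub>Aut M\<^esub> = ae_rel M `` {id}" by (simp add: Aut_def)
  show "\<one>\<^bsub>Aut M\<^esub> \<in> carrier (Aut M)" unfolding one by (rule ae_class_carrier[OF aut_maps_id])
  fix x y z assume x: "x \<in> carrier (Aut M)"
  show "\<one>\<^bsub>Aut M\<^esub> \<otimes>\<^bsub>Aut M\<^esub> x = x" unfolding one
    by (metis mult_ae_class[OF aut_maps_id rep_aut[OF x]] ae_class_rep[OF x] id_comp)
  show "\<exists>y\<in>carrier (Aut M). y \<otimes>\<^bsub>Aut M\<^esub> x = \<one>\<^bsub>Aut M\<^esub>"
  proof
    let ?f = "rep x"
    note f = rep_aut[OF x]
    show "ae_rel M `` {inv_into (space M) ?f} \<in> carrier (Aut M)"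
      by (intro ae_class_carrier aut_maps_inv f)
    have "ae_rel M `` {inv_into (space M) ?f} \<otimes>\<^bsub>Aut M\<^esub> ae_rel M `` {?f} =
      ae_rel M `` {inv_into (space M) ?f \<circ> ?f}"
      by (intro mult_ae_class aut_maps_inv f)
    also have "\<dots> = ae_rel M `` {id}"
      by (subst ae_class_eq)
         (use aut_mapsD[OF f] in \<open>auto intro!: aut_maps_comp aut_maps_inv f aut_maps_id simp: bij_betw_def\<close>)
    finally show "ae_rel M `` {inv_into (space M) ?f} \<otimes>\<^bsub>Aut M\<^esub> x = \<one>\<^bsub>Aut M\<^esub>"
      by (simp add: ae_class_rep[OF x] one)
  qed
  assume y: "y \<in> carrier (Aut M)"
  show "x \<otimes>\<^bsub>Aut M\<^esub> y \<in> carrier (Aut M)"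
    by (metis mult_ae_class[OF rep_aut[OF x] rep_aut[OF y]] ae_class_rep x y
        ae_class_carrier aut_maps_comp rep_aut)
  assume z: "z \<in> carrier (Aut M)"
  show "x \<otimes>\<^bsub>Aut M\<^esub> y \<otimes>\<^bsub>Aut M\<^esub> z = x \<otimes>\<^bsub>Aut M\<^esub> (y \<otimes>\<^bsub>Aut M\<^esub> z)"
  proof -
    note f = rep_aut[OF x] rep_aut[OF y] rep_aut[OF z]
    show ?thesis
      using mult_ae_class[OF aut_maps_comp[OF f(1,2)] f(3)] mult_ae_class[OF f(1) aut_maps_comp[OF f(2,3)]]
        mult_ae_class[OF f(1,2)] mult_ae_class[OF f(2,3)]
      by (simp add: ae_class_rep x y z comp_assoc)
  qed
qed

lemma aut_image:
  assumes "f \<in> aut_maps M" "A \<in> sets M"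
  shows "f ` A \<in> sets M" "emeasure M (f ` A) = emeasure M A"
proof -
  note f = aut_mapsD[OF assms(1)]
  have As: "A \<subseteq> space M" using assms sets.sets_into_space by auto
  have "f ` A = inv_into (space M) f -` A \<inter> space M"
    using f(1) As by (auto simp: bij_betw_def inv_into_f_f image_iff subset_iff) (metis f_inv_into_f)+
  then show s: "f ` A \<in> sets M" using f(3) assms by (auto intro: measurable_sets)
  have "f -` (f ` A) \<inter> space M = A" using f(1) As by (auto simp: bij_betw_def inj_on_def)
  then show "emeasure M (f ` A) = emeasure M A"
    using emeasure_distr[OF f(2) s] f(4) by simp
qed

lemma aut_image_ae:
  assumes "f \<in> aut_maps M" "g \<in> aut_maps M" "AE x in M. f x = g x" "A \<in> sets M"
  shows "sym_diff (f ` A) (g ` A) \<in> null_sets M"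
proof -
  obtain N where N: "N \<in> null_sets M" "{x \<in> space M. f x \<noteq> g x} \<subseteq> N"
    using assms(3) by (auto elim!: AE_E simp: null_sets_def)
  have "f ` N \<in> null_sets M" "g ` N \<in> null_sets M"
    using N aut_image[OF assms(1), of N] aut_image[OF assms(2), of N] by (auto simp: null_sets_def)
  then have n: "f ` N \<union> g ` N \<in> null_sets M" by auto
  show ?thesis
  proof (rule null_sets_subset[OF n])
    show "sym_diff (f ` A) (g ` A) \<in> sets M" using aut_image(1)[OF assms(1,4)] aut_image(1)[OF assms(2,4)] by auto
    have As: "A \<subseteq> space M" using assms sets.sets_into_space by auto
    show "sym_diff (f ` A) (g ` A) \<subseteq> f ` N \<union> g ` N"
    proof
      fix y assume "y \<in> sym_diff (f ` A) (g ` A)"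
      then have "\<exists>x\<in>A. f x \<noteq> g x \<and> (y = f x \<or> y = g x)" by (auto simp: image_iff) metis
      then obtain x where "x \<in> A" "f x \<noteq> g x" "y = f x \<or> y = g x" by blast
      with As N show "y \<in> f ` N \<union> g ` N" by blast
    qed
  qed
qed

lemma act_class:
  assumes "f \<in> aut_maps M" "A \<in> sets M"
  shows "sym_diff (act (ae_rel M `` {f}) A) (f ` A) \<in> null_sets M"
  unfolding act_def using assms
  by (intro aut_image_ae rep_ae_class rep_aut ae_class_carrier)

lemma act_fmeasurable:
  assumes "T \<in> carrier (Aut M)" "A \<in> fmeasurable M"
  shows "act T A \<in> fmeasurable M" "measure M (act T A) = measure M A"
proof -
  have "A \<in> sets M" "emeasure M A < \<infinity>" using assms by (auto simp: fmeasurable_def)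
  then show "act T A \<in> fmeasurable M" "measure M (act T A) = measure M A"
    using aut_image[OF rep_aut[OF assms(1)], of A]
    by (auto simp: act_def fmeasurable_def measure_def)
qed

lemma fmeasurable_sym_diff: "A \<in> fmeasurable M \<Longrightarrow> B \<in> fmeasurable M \<Longrightarrow> sym_diff A B \<in> fmeasurable M"
  by auto

lemma measure_sym_diff_triangle:
  assumes "A \<in> fmeasurable M" "B \<in> fmeasurable M" "C \<in> fmeasurable M"
  shows "measure M (sym_diff A C) \<le> measure M (sym_diff A B) + measure M (sym_diff B C)"
proof -
  have "measure M (sym_diff A C) \<le> measure M (sym_diff A B \<union> sym_diff B C)"
    by (rule measure_mono_fmeasurable) (use assms in auto)
  also have "\<dots> \<le> measure M (sym_diff A B) + measure M (sym_diff B C)"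
    by (rule measure_Un_le) (use assms in auto)
  finally show ?thesis .
qed

lemma measure_sym_diff_le:
  assumes "A \<in> fmeasurable M" "B \<in> fmeasurable M"
  shows "measure M (sym_diff A B) \<le> measure M A + measure M B"
  using measure_sym_diff_triangle[of A M "{}" B] assms by auto

lemma sym_diff_commute: "sym_diff A B = sym_diff B A" by auto

lemma Aut_eqI:
  assumes iso: "isomorphic_mod0 M (lebesgue :: real measure)"
    and S: "S \<in> carrier (Aut M)" and T: "T \<in> carrier (Aut M)"
    and eq: "\<And>B. B \<in> fmeasurable M \<Longrightarrow> measure M (sym_diff (act S B) (act T B)) = 0"
  shows "S = T"
proof -
  let ?f = "rep S" and ?g = "rep T"
  note fa = rep_aut[OF S] and ga = rep_aut[OF T]
  note f = aut_mapsD[OF fa] and g = aut_mapsD[OF ga]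
  obtain X Y h where X: "X \<in> sets M" "space M - X \<in> null_sets M"
    and Y: "Y \<in> sets (lebesgue :: real measure)"
    and h: "measure_iso (restrict_space M X) (restrict_space (lebesgue :: real measure) Y) h"
    using iso unfolding isomorphic_mod0_def by blast
  let ?MX = "restrict_space M X" and ?LY = "restrict_space (lebesgue :: real measure) Y"
  have hb: "bij_betw h X Y" and hm: "h \<in> measurable ?MX ?LY" and hd: "distr ?MX ?LY h = ?LY"
    using h X Y by (auto simp: measure_iso_def)
  define D where "D = (\<lambda>(a::rat, b::rat). h -` ({of_rat a<..<of_rat b} \<inter> Y) \<inter> X)"
  have D: "D p \<in> fmeasurable M" for p
  proof -
    obtain a b where p: "p = (a, b)" by (cases p)
    let ?I = "{of_rat a<..<of_rat b} \<inter> Y :: real set"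
    have I: "?I \<in> sets ?LY" using Y by (auto simp: sets_restrict_space_iff)
    have 1: "D p = h -` ?I \<inter> space ?MX" using X by (auto simp: p D_def)
    have m: "D p \<in> sets ?MX" unfolding 1 by (rule measurable_sets[OF hm I])
    have 2: "D p \<subseteq> X" by (auto simp: D_def p)
    have "emeasure M (D p) = emeasure ?MX (D p)"
      using X 2 by (simp add: emeasure_restrict_space)
    also have "\<dots> = emeasure (distr ?MX ?LY h) ?I" by (simp add: emeasure_distr[OF hm I] 1)
    also have "\<dots> = emeasure lebesgue ?I" unfolding hd using Y by (simp add: emeasure_restrict_space)
    also have "\<dots> \<le> emeasure lebesgue {of_rat a<..<of_rat b :: real}" by (rule emeasure_mono) auto
    also have "\<dots> < \<infinity>" by (cases "of_rat a \<le> (of_rat b :: real)") auto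
    finally show ?thesis using m X by (auto simp: fmeasurable_def sets_restrict_space_iff)
  qed
  have ae1: "AE y in M. \<forall>p. y \<in> ?f ` D p \<longleftrightarrow> y \<in> ?g ` D p"
  proof (subst AE_all_countable, rule allI)
    fix p
    have fm: "act S (D p) \<in> fmeasurable M" "act T (D p) \<in> fmeasurable M"
      using act_fmeasurable(1)[OF S D[of p]] act_fmeasurable(1)[OF T D[of p]] by auto
    have "sym_diff (act S (D p)) (act T (D p)) \<in> fmeasurable M" using fm by (rule fmeasurable_sym_diff)
    then have n: "sym_diff (act S (D p)) (act T (D p)) \<in> null_sets M"
      using eq[OF D[of p]] by (intro null_setsI) (simp_all only: emeasure_eq_measure2 ennreal_0 fmeasurableD)
    show "AE y in M. y \<in> ?f ` D p \<longleftrightarrow> y \<in> ?g ` D p"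
      by (rule AE_I'[OF n]) (auto simp: act_def)
  qed
  have aeX: "AE x in M. x \<in> X" by (rule AE_I'[OF X(2)]) auto
  let ?f' = "inv_into (space M) ?f" and ?g' = "inv_into (space M) ?g"
  have X1: "AE y in M. ?f' y \<in> X" "AE y in M. ?g' y \<in> X"
    by (rule AE_aut[OF aut_maps_inv[OF fa] aeX], rule AE_aut[OF aut_maps_inv[OF ga] aeX])
  have Ds: "D p \<subseteq> space M" for p using D[of p] by (meson fmeasurableD sets.sets_into_space)
  have mem: "y \<in> k ` D p \<longleftrightarrow> inv_into (space M) k y \<in> D p"
    if "bij_betw k (space M) (space M)" "y \<in> space M" for k y p
  proof
    have "y \<in> k ` space M" using that by (simp add: bij_betw_def)
    then have "k (inv_into (space M) k y) = y" by (rule f_inv_into_f)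
    then show "inv_into (space M) k y \<in> D p \<Longrightarrow> y \<in> k ` D p" by (metis image_eqI)
    show "y \<in> k ` D p \<Longrightarrow> inv_into (space M) k y \<in> D p"
      using that Ds[of p] by (auto simp: bij_betw_def inv_into_f_f subset_iff)
  qed
  have "AE y in M. ?f' y = ?g' y"
    using ae1 X1 AE_space
  proof eventually_elim
    case (elim y)
    have 1: "?f' y \<in> D p \<longleftrightarrow> ?g' y \<in> D p" for p
      using elim mem[OF f(1)] mem[OF g(1)] by blast
    have hY: "h (?f' y) \<in> Y" "h (?g' y) \<in> Y" using hb elim by (auto simp: bij_betw_def)
    have 2: "h (?f' y) \<in> {of_rat a<..<of_rat b} \<longleftrightarrow> h (?g' y) \<in> {of_rat a<..<of_rat b}" for a b
      using 1[of "(a, b)"] hY elim by (auto simp: D_def)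
    have "h (?f' y) = h (?g' y)"
    proof (rule ccontr)
      assume ne: "h (?f' y) \<noteq> h (?g' y)"
      have key: False if u: "u < v" and "\<And>a b. u \<in> {of_rat a<..<of_rat b} \<longleftrightarrow> v \<in> {of_rat a<..<of_rat b}" for u v :: real
      proof -
        obtain b where "u < of_rat b" "of_rat b < v" using of_rat_dense[OF u] by auto
        moreover obtain a where "of_rat a < u" using of_rat_dense[of "u - 1" u] by auto
        ultimately show False using that(2)[of a b] by auto
      qed
      show False using ne key[of "h (?f' y)" "h (?g' y)"] key[of "h (?g' y)" "h (?f' y)"] 2
        by (meson linorder_neqE_linordered_idom)
    qed
    then show ?case using hb elim by (auto simp: bij_betw_def inj_on_def)
  qed
  then have "AE x in M. ?f' (?f x) = ?g' (?f x)" by (rule AE_aut[OF fa])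
  then have "AE x in M. ?f x = ?g x"
    using AE_space
  proof eventually_elim
    case (elim x)
    then have "?g' (?f x) = x" using f by (auto simp: bij_betw_def)
    moreover have "?f x \<in> space M" using elim f by (auto simp: bij_betw_def)
    ultimately show ?case using g by (metis bij_betw_def f_inv_into_f)
  qed
  then have "ae_rel M `` {?f} = ae_rel M `` {?g}" using ae_class_eq[OF fa ga] by simp
  then show ?thesis by (simp add: ae_class_rep S T)
qed

lemma rho_summable:
  assumes d: "dense_family M A" and S: "S \<in> carrier (Aut M)" and T: "T \<in> carrier (Aut M)"
  shows "(\<lambda>i. (1/2) ^ i *
        (measure M (sym_diff (act S (A i)) (act T (A i))) +
         measure M (sym_diff (act (inv\<^bsub>Aut M\<^esub> S) (A i)) (act (inv\<^bsub>Aut M\<^esub> T) (A i))))) summable_on {1..}"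
proof (rule summable_on_comparison_test)
  show "(\<lambda>i. 4 * ((1/2) ^ i * measure M (A i))) summable_on {1..}"
    using d by (intro summable_on_cmult_right) (auto simp: dense_family_def)
  have S': "inv\<^bsub>Aut M\<^esub> S \<in> carrier (Aut M)" and T': "inv\<^bsub>Aut M\<^esub> T \<in> carrier (Aut M)"
    using S T by (auto intro: group.inv_closed[OF group_Aut])
  fix i :: nat assume "i \<in> {1..}"
  then have A: "A i \<in> fmeasurable M" using d by (auto simp: dense_family_def)
  have "measure M (sym_diff (act S (A i)) (act T (A i))) \<le> 2 * measure M (A i)"
    using measure_sym_diff_le[OF act_fmeasurable(1)[OF S A] act_fmeasurable(1)[OF T A]] by (simp add: act_fmeasurable S T A)
  moreover have "measure M (sym_diff (act (inv\<^bsub>Aut M\<^esub> S) (A i)) (act (inv\<^bsub>Aut M\<^esub> T) (A i))) \<le> 2 * measure M (A i)"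
    using measure_sym_diff_le[OF act_fmeasurable(1)[OF S' A] act_fmeasurable(1)[OF T' A]] by (simp add: act_fmeasurable S' T' A)
  ultimately show "(1/2) ^ i *
        (measure M (sym_diff (act S (A i)) (act T (A i))) +
         measure M (sym_diff (act (inv\<^bsub>Aut M\<^esub> S) (A i)) (act (inv\<^bsub>Aut M\<^esub> T) (A i)))) \<le> 4 * ((1/2) ^ i * measure M (A i))"
    by (subst mult.left_commute, intro mult_left_mono) auto
qed auto

definition d_w_bound :: "'a measure \<Rightarrow> (nat \<Rightarrow> 'a set) \<Rightarrow> real" where
  "d_w_bound M A = (\<Sum>\<^sub>\<infinity>(i, j)\<in>{1..} \<times> {1..}. (1/2) ^ (i + j) * measure M (A j))"

lemma d_w_bound_summable:
  fixes M :: "'a measure"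
  assumes d: "dense_family M A"
  shows "(\<lambda>(i, j). (1/2) ^ (i + j) * measure M (A j)) summable_on {1..} \<times> {1..}"
proof -
  have g: "(\<lambda>j. (1/2::real) ^ j) summable_on {1..}"
    by (rule summable_on_subset_banach[of _ UNIV]) (auto simp: summable_on_UNIV_nonneg_real_iff summable_geometric)
  have "(\<lambda>x. norm ((case x of (i, j) \<Rightarrow> (1/2) ^ i * ((1/2) ^ j * measure M (A j))) :: real)) summable_on {1..} \<times> {1..}"
    using d g unfolding dense_family_def
    by (subst Infinite_Sum.abs_summable_on_Sigma_iff)
       (auto simp: abs_mult infsum_cmult_right intro!: summable_on_cmult_left summable_on_cmult_right)
  then show ?thesis
    by (subst summable_on_iff_abs_summable_on_real) (simp add: power_add case_prod_unfold ac_simps)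
qed

lemma d_w_summable:
  assumes d: "dense_family M A"
  shows "(\<lambda>(i, j). (1/2) ^ (i + j) *
        \<bar>measure M (act S (A i) \<inter> A j) - measure M (act T (A i) \<inter> A j)\<bar>) summable_on {1..} \<times> {1..}"
    and "d_w M A S T \<le> d_w_bound M A"
proof -
  have le: "(1/2) ^ (i + j) * \<bar>measure M (act S (A i) \<inter> A j) - measure M (act T (A i) \<inter> A j)\<bar>
     \<le> (1/2) ^ (i + j) * measure M (A j)" if "i \<ge> 1" "j \<ge> 1" for i j
  proof (rule mult_left_mono)
    have A: "A i \<in> fmeasurable M" "A j \<in> fmeasurable M" using that d by (auto simp: dense_family_def)
    have "measure M (act U (A i) \<inter> A j) \<le> measure M (A j)" for U
      by (cases "act U (A i) \<inter> A j \<in> sets M")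
         (auto intro: measure_mono_fmeasurable A simp: measure_notin_sets)
    from this[of S] this[of T]
    show "\<bar>measure M (act S (A i) \<inter> A j) - measure M (act T (A i) \<inter> A j)\<bar> \<le> measure M (A j)"
      using measure_nonneg[of M "act S (A i) \<inter> A j"] measure_nonneg[of M "act T (A i) \<inter> A j"]
      by linarith
  qed auto
  show s: "(\<lambda>(i, j). (1/2) ^ (i + j) *
        \<bar>measure M (act S (A i) \<inter> A j) - measure M (act T (A i) \<inter> A j)\<bar>) summable_on {1..} \<times> {1..}"
    by (rule summable_on_comparison_test[OF d_w_bound_summable[OF d]]) (use le in auto)
  show "d_w M A S T \<le> d_w_bound M A"
    unfolding d_w_def d_w_bound_def by (rule infsum_mono[OF s d_w_bound_summable[OF d]]) (use le in auto)
qed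

lemma d_w_nonneg: "0 \<le> d_w M A S T"
  unfolding d_w_def by (rule infsum_nonneg) auto

lemma d_w_bdd:
  assumes d: "dense_family M A"
  shows "bdd_above ((\<lambda>n::nat. d_w M A (S [^]\<^bsub>Aut M\<^esub> n) (T [^]\<^bsub>Aut M\<^esub> n)) ` {0<..})"
  using d_w_summable(2)[OF d] by (intro bdd_aboveI[of _ "d_w_bound M A"]) auto

lemma Metric_space_Aut:
  assumes iso: "isomorphic_mod0 M (lebesgue :: real measure)" and d: "dense_family M A"
  shows "Metric_space (carrier (Aut M)) (r_metric M A)"
proof -
  interpret group "Aut M" by (rule group_Aut)
  have rn: "0 \<le> rho M A S T" for S T
    unfolding rho_def by (rule infsum_nonneg) auto
  have sn: "0 \<le> (SUP n\<in>{0::nat<..}. d_w M A (S [^]\<^bsub>Aut M\<^esub> n) (T [^]\<^bsub>Aut M\<^esub> n))" for S T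
    by (rule cSUP_upper2[OF d_w_bdd[OF d], of 1]) (auto simp: d_w_nonneg)
  show ?thesis
  proof
    fix S T show "0 \<le> r_metric M A S T" using rn sn by (simp add: r_metric_def)
  next
    fix S T show "r_metric M A S T = r_metric M A T S"
      by (simp add: r_metric_def rho_def d_w_def abs_minus_commute Un_commute)
  next
    fix S T assume S: "S \<in> carrier (Aut M)" and T: "T \<in> carrier (Aut M)"
    show "r_metric M A S T = 0 \<longleftrightarrow> S = T"
    proof
      assume "S = T" then show "r_metric M A S T = 0" by (simp add: r_metric_def rho_def d_w_def case_prod_unfold)
    next
      assume "r_metric M A S T = 0"
      then have r0: "rho M A S T \<le> 0" using rn[of S T] sn[of S T] by (simp add: r_metric_def)
      have A0: "measure M (sym_diff (act S (A i)) (act T (A i))) = 0" if "i \<ge> 1" for i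
      proof -
        have "(1/2) ^ i *
        (measure M (sym_diff (act S (A i)) (act T (A i))) +
         measure M (sym_diff (act (inv\<^bsub>Aut M\<^esub> S) (A i)) (act (inv\<^bsub>Aut M\<^esub> T) (A i)))) = 0"
          by (rule nonneg_infsum_le_0D[OF r0[unfolded rho_def] rho_summable[OF d S T]])
             (use that in auto)
        then show ?thesis by (simp add: add_nonneg_eq_0_iff)
      qed
      show "S = T"
      proof (rule Aut_eqI[OF iso S T])
        fix B assume B: "B \<in> fmeasurable M"
        show "measure M (sym_diff (act S B) (act T B)) = 0"
        proof (rule ccontr)
          assume "\<not> ?thesis"
          then have "measure M (sym_diff (act S B) (act T B)) / 2 > 0"
            by (simp add: less_le)
          then obtain i where i: "i \<ge> 1" "measure M (sym_diff (A i) B) < measure M (sym_diff (act S B) (act T B)) / 2"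
            using d B unfolding dense_family_def by blast
          have Ai: "A i \<in> fmeasurable M" using i d by (auto simp: dense_family_def)
          have im: "measure M (sym_diff (act U (A i)) (act U B)) = measure M (sym_diff (A i) B)"
            if U: "U \<in> carrier (Aut M)" for U
          proof -
            have "A i \<subseteq> space M" "B \<subseteq> space M" using Ai B by (meson fmeasurableD sets.sets_into_space)+
            moreover have "inj_on (rep U) (space M)" using aut_mapsD(1)[OF rep_aut[OF U]] by (simp add: bij_betw_def)
            ultimately have "rep U ` (A i - B) = rep U ` A i - rep U ` B" "rep U ` (B - A i) = rep U ` B - rep U ` A i"
              by (auto simp: inj_on_def subset_iff)
            then have "sym_diff (act U (A i)) (act U B) = act U (sym_diff (A i) B)"
              by (simp only: act_def image_Un)
            then show ?thesis using act_fmeasurable(2)[OF U fmeasurable_sym_diff[OF Ai B]] by simp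
          qed
          have "measure M (sym_diff (act S B) (act T B)) \<le> measure M (sym_diff (act S B) (act S (A i))) + measure M (sym_diff (act S (A i)) (act T B))"
            by (rule measure_sym_diff_triangle; intro act_fmeasurable S T Ai B)
          also have "measure M (sym_diff (act S (A i)) (act T B)) \<le> measure M (sym_diff (act S (A i)) (act T (A i))) + measure M (sym_diff (act T (A i)) (act T B))"
            by (rule measure_sym_diff_triangle; intro act_fmeasurable S T Ai B)
          finally show False using im[OF S] im[OF T] A0[OF i(1)] i(2)
            by (simp add: sym_diff_commute[of "act S B"])
        qed
      qed
    qed
  next
    fix S T U assume S: "S \<in> carrier (Aut M)" and T: "T \<in> carrier (Aut M)" and U: "U \<in> carrier (Aut M)"
    have "rho M A S U \<le> rho M A S T + rho M A T U"
      unfolding rho_def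
    proof (subst infsum_add[symmetric, OF rho_summable[OF d S T] rho_summable[OF d T U]],
        rule infsum_mono[OF rho_summable[OF d S U] summable_on_add[OF rho_summable[OF d S T] rho_summable[OF d T U]]])
      fix i :: nat assume "i \<in> {1..}"
      then have A: "A i \<in> fmeasurable M" using d by (auto simp: dense_family_def)
      have "measure M (sym_diff (act S' (A i)) (act U' (A i))) \<le> measure M (sym_diff (act S' (A i)) (act T' (A i))) + measure M (sym_diff (act T' (A i)) (act U' (A i)))"
        if "S' \<in> carrier (Aut M)" "T' \<in> carrier (Aut M)" "U' \<in> carrier (Aut M)" for S' T' U'
        by (rule measure_sym_diff_triangle; intro act_fmeasurable that A)
      from this[OF S T U] this[OF inv_closed[OF S] inv_closed[OF T] inv_closed[OF U]]
      show "(1/2) ^ i *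
        (measure M (sym_diff (act S (A i)) (act U (A i))) +
         measure M (sym_diff (act (inv\<^bsub>Aut M\<^esub> S) (A i)) (act (inv\<^bsub>Aut M\<^esub> U) (A i)))) \<le>
        (1/2) ^ i *
        (measure M (sym_diff (act S (A i)) (act T (A i))) +
         measure M (sym_diff (act (inv\<^bsub>Aut M\<^esub> S) (A i)) (act (inv\<^bsub>Aut M\<^esub> T) (A i)))) + (1/2) ^ i *
        (measure M (sym_diff (act T (A i)) (act U (A i))) +
         measure M (sym_diff (act (inv\<^bsub>Aut M\<^esub> T) (A i)) (act (inv\<^bsub>Aut M\<^esub> U) (A i))))"
        unfolding distrib_left[symmetric] by (intro mult_left_mono) (linarith, simp)
    qed
    moreover have dt: "d_w M A S' U' \<le> d_w M A S' T' + d_w M A T' U'"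
      if "S' \<in> carrier (Aut M)" "T' \<in> carrier (Aut M)" "U' \<in> carrier (Aut M)" for S' T' U'
      unfolding d_w_def
      apply (subst infsum_add[symmetric, OF d_w_summable(1)[OF d] d_w_summable(1)[OF d]])
      apply (rule infsum_mono[OF d_w_summable(1)[OF d] summable_on_add[OF d_w_summable(1)[OF d] d_w_summable(1)[OF d]]])
      apply (clarsimp simp: distrib_left[symmetric])
      apply linarith
      done
    have "(SUP n\<in>{0::nat<..}. d_w M A (S [^]\<^bsub>Aut M\<^esub> n) (U [^]\<^bsub>Aut M\<^esub> n)) \<le>
       (SUP n\<in>{0::nat<..}. d_w M A (S [^]\<^bsub>Aut M\<^esub> n) (T [^]\<^bsub>Aut M\<^esub> n)) +
       (SUP n\<in>{0::nat<..}. d_w M A (T [^]\<^bsub>Aut M\<^esub> n) (U [^]\<^bsub>Aut M\<^esub> n))"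
    proof (rule cSUP_least)
      fix n :: nat assume n: "n \<in> {0<..}"
      have "d_w M A (S [^]\<^bsub>Aut M\<^esub> n) (U [^]\<^bsub>Aut M\<^esub> n) \<le> d_w M A (S [^]\<^bsub>Aut M\<^esub> n) (T [^]\<^bsub>Aut M\<^esub> n) + d_w M A (T [^]\<^bsub>Aut M\<^esub> n) (U [^]\<^bsub>Aut M\<^esub> n)"
        using S T U by (intro dt) auto
      also have "\<dots> \<le> (SUP n\<in>{0::nat<..}. d_w M A (S [^]\<^bsub>Aut M\<^esub> n) (T [^]\<^bsub>Aut M\<^esub> n)) +
       (SUP n\<in>{0::nat<..}. d_w M A (T [^]\<^bsub>Aut M\<^esub> n) (U [^]\<^bsub>Aut M\<^esub> n))"
        by (intro add_mono cSUP_upper n d_w_bdd d)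
      finally show "d_w M A (S [^]\<^bsub>Aut M\<^esub> n) (U [^]\<^bsub>Aut M\<^esub> n) \<le> \<dots>" .
    qed auto
    ultimately show "r_metric M A S U \<le> r_metric M A S T + r_metric M A T U"
      by (simp add: r_metric_def)
  qed
qed

lemma Metric_space_Mix:
  assumes "isomorphic_mod0 M (lebesgue :: real measure)" and "dense_family M A"
  shows "Metric_space (Mix M) (r_metric M A)"
  using Metric_space.subspace[OF Metric_space_Aut[OF assms]] by (auto simp: Mix_def)

lemma topspace_Mix_topology:
  assumes "isomorphic_mod0 M (lebesgue :: real measure)" and "dense_family M A"
  shows "topspace (Mix_topology M A) = Mix M"
  unfolding Mix_topology_def by (rule Metric_space.topspace_mtopology[OF Metric_space_Mix[OF assms]])

end

theory Submission
  imports Defs "HOL-Library.Nat_Bijection"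
begin

text \<open>The good set consists of the mixing \<open>T\<close> of rank one: any finitely many sets of finite measure are
  approximated by unions of levels of a single tower \<open>F, T F, \<dots>, T\<^sup>H\<^sup>-\<^sup>1 F\<close> with a base of small measure.

  If \<open>U\<close> commutes with \<open>T\<close>, then \<open>\<mu>(U T\<^sup>m F \<inter> T\<^sup>n F)\<close> depends only on \<open>n - m\<close>. Hence on unions of levels \<open>U\<close> is a
  combination of powers of \<open>T\<close> with nonnegative coefficients of total mass at most 2. Because \<open>T\<close> is
  mixing, high powers contribute little, so some coefficient \<open>\<theta>\<close> at a bounded power \<open>k\<close> survives all
  refinements of the tower: \<open>\<mu>(U A \<inter> B) \<ge> \<theta> \<mu>(T\<^sup>k A \<inter> B)\<close> for all \<open>A, B\<close>. Taking \<open>B\<close> disjoint from \<open>U A\<close>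
  gives \<open>U = T\<^sup>k\<close>.

  The rank-one condition is a countable intersection of open conditions. It is dense because every
  mixing \<open>T\<close> can be followed on a large set of finite measure, along finite orbit segments, by a copy of
  a rank-one map whose towers return to each other rarely (Sidon spacers): all powers of that copy
  are then either close to those of \<open>T\<close> or, like high powers of \<open>T\<close>, have small overlaps.\<close>

section \<open>Isomorphisms between measurable subsets\<close>

text \<open>The metric \<open>r\<close> compares all powers at once, so density is the hard half: an
  approximation of \<open>T\<close> has to stay weakly close to it for every exponent, whereas a
  tower fitted to \<open>T\<close> controls only boundedly many of them. Infinite measure removes
  the obstacle, because empty space between copies of a tower costs nothing and can be made so wide
  that late powers hardly meet anything. One explicit family of maps of the half-line serves for all
  \<open>T\<close>; only the parameters \<open>q\<close> and \<open>w0\<close> and the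
  identification of the space with the half-line depend on \<open>T\<close> and on the precision.
  The total mass 2 of the coefficients is the sum of two bounds 1, one for the nonnegative and one
  for the nonpositive exponents. Automorphisms are represented by honest bijections while
  identifications hold modulo null sets only. Null sets are therefore removed in an invariant form
  before orbits are compared.\<close>

text \<open>Phrased by images and preimages of measurable subsets rather than by subspaces. Since
  \<open>f\<close> is unconstrained outside \<open>P\<close>, restricting, composing and gluing
  never change the ambient measure spaces.\<close>

definition piso :: "'a measure \<Rightarrow> 'b measure \<Rightarrow> 'a set \<Rightarrow> 'b set \<Rightarrow> ('a \<Rightarrow> 'b) \<Rightarrow> bool" where
  "piso M N P Q f \<longleftrightarrow> P \<in> sets M \<and> Q \<in> sets N \<and> bij_betw f P Q \<and>
     (\<forall>E\<in>sets M. E \<subseteq> P \<longrightarrow> f ` E \<in> sets N \<and> emeasure N (f ` E) = emeasure M E) \<and>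
     (\<forall>E\<in>sets N. E \<subseteq> Q \<longrightarrow> f -` E \<inter> P \<in> sets M)"

lemma pisoD:
  assumes "piso M N P Q f"
  shows "P \<in> sets M" "Q \<in> sets N" "bij_betw f P Q" "inj_on f P" "f ` P = Q"
    "\<And>E. E \<in> sets M \<Longrightarrow> E \<subseteq> P \<Longrightarrow> f ` E \<in> sets N"
    "\<And>E. E \<in> sets M \<Longrightarrow> E \<subseteq> P \<Longrightarrow> emeasure N (f ` E) = emeasure M E"
    "\<And>E. E \<in> sets N \<Longrightarrow> E \<subseteq> Q \<Longrightarrow> f -` E \<inter> P \<in> sets M"
  using assms unfolding piso_def bij_betw_def by blast+

lemma piso_emeasure: "piso M N P Q f \<Longrightarrow> emeasure N Q = emeasure M P"
  using pisoD(1,5)[of M N P Q f] pisoD(7)[of M N P Q f P] by simp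

lemma piso_emeasure_vimage:
  assumes "piso M N P Q f" "E \<in> sets N" "E \<subseteq> Q"
  shows "emeasure M (f -` E \<inter> P) = emeasure N E"
proof -
  note p = pisoD[OF assms(1)]
  have "f ` (f -` E \<inter> P) = E" using p(5) assms(3) by auto
  then show ?thesis using p(7)[OF p(8)[OF assms(2,3)]] by simp
qed

lemma piso_null: "piso M N P Q f \<Longrightarrow> E \<in> null_sets M \<Longrightarrow> E \<subseteq> P \<Longrightarrow> f ` E \<in> null_sets N"
  using pisoD(6,7)[of M N P Q f E] by (auto simp: null_sets_def)

lemma piso_subset:
  assumes "piso M N P Q f" "E \<in> sets M" "E \<subseteq> P"
  shows "piso M N E (f ` E) f"
proof -
  note p = pisoD[OF assms(1)]
  have "f -` D \<inter> E \<in> sets M" if "D \<in> sets N" "D \<subseteq> f ` E" for D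
  proof -
    have "f -` D \<inter> E = (f -` D \<inter> P) \<inter> E" using assms by auto
    moreover have "D \<subseteq> Q" using that p(5) assms(3) by auto
    ultimately show ?thesis using p(8)[OF that(1)] assms(2) by auto
  qed
  moreover have "f ` D \<in> sets N \<and> emeasure N (f ` D) = emeasure M D" if "D \<in> sets M" "D \<subseteq> E" for D
    using p(6,7)[OF that(1)] that(2) assms(3) by auto
  ultimately show ?thesis using p(6)[OF assms(2,3)] assms(2) inj_on_subset[OF p(4) assms(3)]
    unfolding piso_def bij_betw_def by blast
qed

lemma piso_vimage:
  assumes "piso M N P Q f" "E \<in> sets N" "E \<subseteq> Q"
  shows "piso M N (f -` E \<inter> P) E f"
proof -
  have "f ` (f -` E \<inter> P) = E" using pisoD(5)[OF assms(1)] assms(3) by auto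
  then show ?thesis using piso_subset[OF assms(1) pisoD(8)[OF assms(1,2,3)]] by auto
qed

lemma piso_inv:
  assumes "piso M N P Q f"
  shows "piso N M Q P (inv_into P f)"
proof -
  note p = pisoD[OF assms]
  have im: "inv_into P f ` E = f -` E \<inter> P" if "E \<subseteq> Q" for E
  proof
    show "inv_into P f ` E \<subseteq> f -` E \<inter> P"
      using that p(5) by (auto simp: f_inv_into_f inv_into_into subset_iff)
    show "f -` E \<inter> P \<subseteq> inv_into P f ` E"
    proof
      fix x assume "x \<in> f -` E \<inter> P"
      then show "x \<in> inv_into P f ` E" using inv_into_f_f[OF p(4), of x] by (intro image_eqI[of _ _ "f x"]) auto
    qed
  qed
  have vim: "inv_into P f -` E \<inter> Q = f ` E" if "E \<subseteq> P" for E
  proof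
    show "inv_into P f -` E \<inter> Q \<subseteq> f ` E" 
    proof
      fix y assume y: "y \<in> inv_into P f -` E \<inter> Q"
      then have "f (inv_into P f y) = y" using p(5) by (auto intro: f_inv_into_f)
      then show "y \<in> f ` E" using y by (intro image_eqI[of _ _ "inv_into P f y"]) auto
    qed
    show "f ` E \<subseteq> inv_into P f -` E \<inter> Q" using that p(5) inv_into_f_f[OF p(4)] by auto
  qed
  show ?thesis unfolding piso_def
  proof (intro conjI ballI impI)
    show "inv_into P f ` E \<in> sets M" "emeasure M (inv_into P f ` E) = emeasure N E" if "E \<in> sets N" "E \<subseteq> Q" for E
      using p(8) piso_emeasure_vimage[OF assms] that im[OF that(2)] by auto
    show "inv_into P f -` E \<inter> Q \<in> sets N" if "E \<in> sets M" "E \<subseteq> P" for E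
      using p(6)[OF that] vim[OF that(2)] by simp
  qed (use p bij_betw_inv_into[OF p(3)] in auto)
qed

lemma piso_comp:
  assumes "piso M N P Q f" "piso N K Q R g"
  shows "piso M K P R (g \<circ> f)"
proof -
  note p = pisoD[OF assms(1)] and q = pisoD[OF assms(2)]
  have "(g \<circ> f) ` E \<in> sets K \<and> emeasure K ((g \<circ> f) ` E) = emeasure M E" if "E \<in> sets M" "E \<subseteq> P" for E
  proof -
    have "f ` E \<subseteq> Q" using that p(5) by auto
    then show ?thesis using p(6,7)[OF that] q(6,7)[of "f ` E"] by (simp add: image_comp)
  qed
  moreover have "(g \<circ> f) -` E \<inter> P \<in> sets M" if "E \<in> sets K" "E \<subseteq> R" for E
  proof -
    have "(g \<circ> f) -` E \<inter> P = f -` (g -` E \<inter> Q) \<inter> P" using p(5) by auto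
    then show ?thesis using p(8)[OF q(8)[OF that]] by auto
  qed
  ultimately show ?thesis unfolding piso_def using p(1) q(2) bij_betw_trans[OF p(3) q(3)] by blast
qed

lemma piso_cong:
  assumes "piso M N P Q f" "\<And>x. x \<in> P \<Longrightarrow> f x = g x"
  shows "piso M N P Q g"
proof -
  have "g ` E = f ` E" if "E \<subseteq> P" for E using assms(2) that by (intro image_cong) auto
  moreover have "g -` E \<inter> P = f -` E \<inter> P" for E using assms(2) by auto
  moreover have "bij_betw g P Q" using bij_betw_cong[of P f g Q] assms(2) pisoD(3)[OF assms(1)] by simp
  ultimately show ?thesis using assms(1) by (simp add: piso_def)
qed

text \<open>The pieces may overlap: they are made disjoint in the domain, and injectivity on the
  union keeps their images disjoint, so countable additivity applies on both sides.\<close>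

lemma piso_UN:
  fixes P :: "nat \<Rightarrow> 'a set"
  assumes p: "\<And>i. piso M N (P i) (Q i) f" and inj: "inj_on f (\<Union>i. P i)"
  shows "piso M N (\<Union>i. P i) (\<Union>i. Q i) f"
proof -
  note pp = pisoD[OF p]
  have im: "f ` (\<Union>i. P i) = (\<Union>i. Q i)" unfolding image_UN pp(5) ..
  have 1: "f ` E \<in> sets N \<and> emeasure N (f ` E) = emeasure M E" if E: "E \<in> sets M" "E \<subseteq> (\<Union>i. P i)" for E
  proof -
    define D where "D i = E \<inter> disjointed P i" for i
    have Dm: "D i \<in> sets M" for i 
    proof -
      have "range (disjointed P) \<subseteq> sets M" by (rule sets.range_disjointed_sets, rule image_subsetI, rule pp(1))
      then show ?thesis unfolding D_def using E(1) by blast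
    qed
    have DP: "D i \<subseteq> P i" for i using disjointed_subset[of P i] unfolding D_def by blast
    have "(\<Union>i. D i) = E \<inter> (\<Union>i. disjointed P i)" unfolding D_def by (rule Int_UN_distrib[symmetric])
    then have ED: "(\<Union>i. D i) = E" using Int_absorb2[OF E(2)] by (simp only: UN_disjointed_eq)
    have dD: "disjoint_family D" 
      unfolding disjoint_family_on_def
    proof (intro ballI impI)
      fix m n :: nat assume "m \<noteq> n"
      then have "disjointed P m \<inter> disjointed P n = {}"
        using disjoint_family_onD[OF disjoint_family_disjointed[of P]] by simp
      then show "D m \<inter> D n = {}" unfolding D_def by blast
    qed
    have dfD: "disjoint_family (\<lambda>i. f ` D i)"
      unfolding disjoint_family_on_def
    proof (intro ballI impI)
      fix m n :: nat assume "m \<noteq> n"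
      then have "D m \<inter> D n = {}" using disjoint_family_onD[OF dD] by simp
      moreover have "f ` (D m \<inter> D n) = f ` D m \<inter> f ` D n"
        by (rule inj_on_image_Int[OF inj]) (rule order_trans[OF DP], rule UN_upper, rule UNIV_I)+
      ultimately show "f ` D m \<inter> f ` D n = {}" by simp
    qed
    have fE: "f ` E = (\<Union>i. f ` D i)" unfolding ED[symmetric] by (rule image_UN)
    have s: "f ` D i \<in> sets N" for i using pp(6)[OF Dm DP] .
    have "emeasure N (f ` E) = (\<Sum>i. emeasure N (f ` D i))"
      unfolding fE using s dfD by (intro suminf_emeasure[symmetric] image_subsetI)
    also have "\<dots> = (\<Sum>i. emeasure M (D i))" by (rule suminf_cong) (rule pp(7)[OF Dm DP])
    also have "\<dots> = emeasure M E" unfolding ED[symmetric] using Dm dD by (intro suminf_emeasure image_subsetI)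
    finally have "emeasure N (f ` E) = emeasure M E" .
    moreover have "f ` E \<in> sets N" unfolding fE by (intro sets.countable_UN image_subsetI s)
    ultimately show ?thesis by blast
  qed
  have 2: "f -` E \<inter> (\<Union>i. P i) \<in> sets M" if E: "E \<in> sets N" "E \<subseteq> (\<Union>i. Q i)" for E
  proof -
    have e: "f -` E \<inter> P i = f -` (E \<inter> Q i) \<inter> P i" for i
    proof -
      have "P i \<subseteq> f -` Q i" using equalityD1[OF pp(5)[of i]] by (simp only: image_subset_iff_subset_vimage)
      then show ?thesis by blast
    qed
    have "f -` E \<inter> P i \<in> sets M" for i
      unfolding e by (rule pp(8)) (rule sets.Int[OF E(1) pp(2)], rule Int_lower2)
    then have "(\<Union>i. f -` E \<inter> P i) \<in> sets M" by (intro sets.countable_UN image_subsetI)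
    then show ?thesis by (simp only: Int_UN_distrib)
  qed
  have "(\<Union>i. P i) \<in> sets M" by (intro sets.countable_UN image_subsetI pp(1))
  moreover have "(\<Union>i. Q i) \<in> sets N" by (intro sets.countable_UN image_subsetI pp(2))
  moreover have "bij_betw f (\<Union>i. P i) (\<Union>i. Q i)" unfolding bij_betw_def using inj im by (rule conjI)
  ultimately show ?thesis unfolding piso_def using 1 2 by simp
qed

lemma piso_countable_UN:
  fixes P :: "'i::countable \<Rightarrow> 'a set"
  assumes p: "\<And>i. piso M N (P i) (f ` P i) f" and inj: "inj_on f (\<Union>i. P i)"
  shows "piso M N (\<Union>i. P i) (f ` (\<Union>i. P i)) f"
proof -
  have e: "(\<Union>n::nat. P (from_nat n)) = (\<Union>i. P i)"
  proof (intro equalityI subsetI)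
    fix x assume "x \<in> (\<Union>i. P i)"
    then obtain i where "x \<in> P i" by auto
    then show "x \<in> (\<Union>n::nat. P (from_nat n))" by (intro UN_I[of "to_nat i"]) auto
  qed auto
  have "piso M N (\<Union>n::nat. P (from_nat n)) (\<Union>n::nat. f ` P (from_nat n)) f"
    by (rule piso_UN[OF p]) (simp only: e inj)
  then show ?thesis by (simp only: image_UN[symmetric] e)
qed

lemma piso_Un:
  assumes "piso M N P (f ` P) f" "piso M N Q (f ` Q) f" "inj_on f (P \<union> Q)"
  shows "piso M N (P \<union> Q) (f ` (P \<union> Q)) f"
proof -
  have "(\<Union>b. if b then P else Q) = P \<union> Q" by (auto split: if_splits)
  moreover have "piso M N (if b then P else Q) (f ` (if b then P else Q)) f" for b
    using assms(1,2) by simp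
  ultimately show ?thesis
    using piso_countable_UN[of M N "\<lambda>b. if b then P else Q" f] assms(3) by simp
qed

lemma piso_empty: "piso M N {} {} f"
  by (auto simp: piso_def bij_betw_def)

text \<open>Turns gluing of partial isomorphisms into a way of constructing automorphisms.\<close>

lemma aut_maps_iff_piso: "f \<in> aut_maps M \<longleftrightarrow> piso M M (space M) (space M) f"
proof
  assume f: "f \<in> aut_maps M"
  note ff = aut_mapsD[OF f]
  show "piso M M (space M) (space M) f" unfolding piso_def
    using aut_image[OF f] ff(1) measurable_sets[OF ff(2)] by blast
next
  assume p: "piso M M (space M) (space M) f"
  note pp = pisoD[OF p] and qq = pisoD[OF piso_inv[OF p]]
  have m: "f \<in> measurable M M"
    by (rule measurableI) (use pp(5,8) sets.sets_into_space in auto)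
  have m': "inv_into (space M) f \<in> measurable M M"
    by (rule measurableI) (use qq(5,8) sets.sets_into_space in auto)
  have "distr M M f = M"
  proof (rule measure_eqI)
    fix A assume "A \<in> sets (distr M M f)"
    then have A: "A \<in> sets M" by simp
    then show "emeasure (distr M M f) A = emeasure M A"
      using piso_emeasure_vimage[OF p A sets.sets_into_space[OF A]] m by (simp add: emeasure_distr)
  qed simp
  then show "f \<in> aut_maps M" using m m' pp(3) by (auto simp: aut_maps_def measure_iso_def)
qed

section \<open>Reduction of a Lebesgue set to an initial segment of the half-line\<close>

text \<open>\<open>g\<close> is the distribution function of Lebesgue measure on \<open>P\<close>.
  It grows no faster than the identity, hence is continuous, and it pushes the measure on
  \<open>P\<close> to Lebesgue measure on an initial segment of the same total measure. The fourth
  claim is this fact on the sets \<open>{..<t}\<close>; the fifth says that \<open>g\<close>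
  collapses only null parts of \<open>P\<close>.\<close>

lemma emeasure_initial_segment:
  fixes P :: "real set"
  assumes P: "P \<in> sets lebesgue" "P \<subseteq> {0..}"
  defines "g \<equiv> \<lambda>x. measure lebesgue (P \<inter> {0..x})"
  shows "mono g" "continuous_on UNIV g" "\<And>x. x \<le> 0 \<Longrightarrow> g x = 0"
    "\<And>t. emeasure lebesgue {x\<in>P. g x < t} = emeasure lborel ({..<t} \<inter> {x. 0 \<le> x \<and> ennreal x < emeasure lebesgue P})"
    "\<And>x y. x \<le> y \<Longrightarrow> g x = g y \<Longrightarrow> emeasure lebesgue (P \<inter> {x..y}) = 0"
proof -
  have fm: "P \<inter> {a..b} \<in> lmeasurable" for a b :: real
    by (rule fmeasurableI2[of "cbox a b"]) (use P in auto)
  show mono: "mono g" unfolding g_def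
    by (intro monoI measure_mono_fmeasurable) (use fm P in \<open>auto\<close>)
  have inc: "g y \<le> g x + measure lebesgue (P \<inter> {x..y})" if "x \<le> y" for x y
  proof -
    have "g y \<le> measure lebesgue ((P \<inter> {0..x}) \<union> (P \<inter> {x..y}))"
      unfolding g_def by (intro measure_mono_fmeasurable fmeasurable.Un fm) (use fm P in auto)
    also have "\<dots> \<le> g x + measure lebesgue (P \<inter> {x..y})"
      unfolding g_def by (intro measure_Un_le) (use fm in auto)
    finally show ?thesis .
  qed
  have lip: "\<bar>g y - g x\<bar> \<le> \<bar>y - x\<bar>" for x y
  proof -
    have *: "\<bar>g y - g x\<bar> \<le> \<bar>y - x\<bar>" if "x \<le> y" for x y
    proof -
      have "measure lebesgue (P \<inter> {x..y}) \<le> measure lebesgue {x..y}"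
        by (intro measure_mono_fmeasurable) (use fm in auto)
      then show ?thesis using inc[OF that] monoD[OF mono that] that by simp
    qed
    show ?thesis using *[of x y] *[of y x] by linarith
  qed
  show cont: "continuous_on UNIV g"
    by (rule lipschitz_on_continuous_on[of 1], rule lipschitz_onI) (use lip in \<open>auto simp: dist_real_def\<close>)
  show g0: "g x = 0" if "x \<le> 0" for x
  proof -
    have "measure lebesgue (P \<inter> {0..x}) \<le> measure lebesgue (cbox 0 0::real set)"
      by (intro measure_mono_fmeasurable lmeasurable_cbox) (use fm[of 0 x] that in auto)
    then show ?thesis using measure_nonneg[of lebesgue "P \<inter> {0..x}"] by (simp add: g_def)
  qed
  have ge0: "0 \<le> g x" for x by (simp add: g_def)
  have eg: "emeasure lebesgue (P \<inter> {0..x}) = ennreal (g x)" for x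
    using fm unfolding g_def by (simp add: emeasure_eq_measure2)
  show "emeasure lebesgue (P \<inter> {x..y}) = 0" if xy: "x \<le> y" "g x = g y" for x y
  proof -
    have fm2: "P \<inter> {max x 0<..y} \<in> lmeasurable" by (rule fmeasurableI2[OF fm[of "max x 0" y]]) (use P in auto)
    have "measure lebesgue (P \<inter> {max x 0<..y}) = 0"
    proof (cases "0 \<le> y")
      case True
      have "P \<inter> {0..y} = (P \<inter> {0..max x 0}) \<union> (P \<inter> {max x 0<..y})"
        using True xy by auto
      then have "g y = measure lebesgue ((P \<inter> {0..max x 0}) \<union> (P \<inter> {max x 0<..y}))"
        unfolding g_def by simp
      also have "\<dots> = g (max x 0) + measure lebesgue (P \<inter> {max x 0<..y})"
        unfolding g_def
        by (intro measure_Union) (use fmeasurableD2[OF fm[of 0 "max x 0"]] fmeasurableD2[OF fm2] P in auto)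
      also have "g (max x 0) = g x" using g0[of x] g0[of 0] by (auto simp: max_def)
      finally show ?thesis using xy by simp
    qed auto
    then have n: "P \<inter> {max x 0<..y} \<in> null_sets lebesgue" 
      using fm2 measure_eq_0_null_sets by (simp add: emeasure_eq_measure2 null_sets_def fmeasurableD)
    have "P \<inter> {x..y} \<in> null_sets lebesgue"
    proof (rule null_sets_subset[OF null_sets.Un[OF n, of "{max x 0}"]])
      show "P \<inter> {x..y} \<subseteq> P \<inter> {max x 0<..y} \<union> {max x 0}"
      proof
        fix z assume z: "z \<in> P \<inter> {x..y}"
        then have "0 \<le> z" using P by auto
        then show "z \<in> P \<inter> {max x 0<..y} \<union> {max x 0}" using z by (auto simp: max_def split: if_splits)
      qed
    qed (use P in auto)
    then show ?thesis by auto
  qed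
  show "emeasure lebesgue {x\<in>P. g x < t} = emeasure lborel ({..<t} \<inter> {x. 0 \<le> x \<and> ennreal x < emeasure lebesgue P})" for t
  proof (cases "\<exists>x. g x = t")
    case True
    show ?thesis
    proof (cases "t \<le> 0")
      case True
      then have e: "{x\<in>P. g x < t} = {}" "{..<t} \<inter> {x. 0 \<le> x \<and> ennreal x < emeasure lebesgue P} = {}"
        using ge0 by (auto simp: not_less intro: order_trans)
      then show ?thesis by (simp only: e) simp
    next
      case False
      obtain x0 where x0: "g x0 = t" using True by auto
      have "x0 > 0" using g0[of x0] False x0 by force
      \<comment> \<open>The least point \<open>x\<close> with value \<open>t\<close> separates: for
        \<open>y\<close> in \<open>P\<close>, \<open>g y < t\<close> holds exactly when
        \<open>y < x\<close>.\<close>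
      define K where "K = {0..x0} \<inter> g -` {t}"
      have "compact K" unfolding K_def
        by (intro compact_Int_closed compact_Icc closed_vimage cont) auto
      moreover have "x0 \<in> K" using x0 \<open>x0 > 0\<close> by (auto simp: K_def)
      ultimately obtain x where x: "x \<in> K" "\<And>y. y \<in> K \<Longrightarrow> x \<le> y"
        using compact_attains_inf[of K] by blast
      have gx: "g x = t" "0 \<le> x" "x \<le> x0" using x by (auto simp: K_def)
      have "g y < t \<longleftrightarrow> y < x" if "y \<in> P" for y
      proof
        assume "g y < t" then show "y < x" using monoD[OF mono, of x y] gx by (meson leD leI)
      next
        assume y: "y < x"
        then have "g y \<le> t" using monoD[OF mono, of y x] gx by simp
        moreover have "g y \<noteq> t" using x(2)[of y] y gx that P by (auto simp: K_def)
        ultimately show "g y < t" by simp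
      qed
      then have "{y\<in>P. g y < t} = P \<inter> {0..<x}" using P by auto
      moreover have "emeasure lebesgue (P \<inter> {0..<x}) = emeasure lebesgue (P \<inter> {0..x})"
      proof (rule emeasure_eq_AE)
        show "AE y in lebesgue. (y \<in> P \<inter> {0..<x}) = (y \<in> P \<inter> {0..x})"
          by (rule AE_I'[of "{x}"]) auto
      qed (use P in auto)
      ultimately have 1: "emeasure lebesgue {y\<in>P. g y < t} = ennreal t" using eg gx by simp
      have "ennreal t \<le> emeasure lebesgue P" unfolding gx(1)[symmetric] eg[symmetric]
        by (intro emeasure_mono) (use P in auto)
      then have "{..<t} \<inter> {x. 0 \<le> x \<and> ennreal x < emeasure lebesgue P} = {0..<t}"
        using False less_le_trans[OF ennreal_lessI[of t]] by auto
      then show ?thesis using 1 False by simp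
    qed
  next
    case False
    have t0: "t \<noteq> 0" using g0[of 0] False by auto
    show ?thesis
    proof (cases "t < 0")
      case True
      then have e: "{x\<in>P. g x < t} = {}" "{..<t} \<inter> {x. 0 \<le> x \<and> ennreal x < emeasure lebesgue P} = {}"
        using ge0 by (auto simp: not_less intro: order_trans[of _ 0])
      then show ?thesis by (simp only: e) simp
    next
      case t: False
      \<comment> \<open>A positive value that is not attained lies above all values of
        \<open>g\<close>, by the intermediate value theorem, and so bounds the measure of
        \<open>P\<close>.\<close>
      have lt: "g y < t" for y
      proof (rule ccontr)
        assume n: "\<not> g y < t"
        have "y \<ge> 0" using n t0 t g0[of y] by force
        then have "\<exists>x\<ge>0. x \<le> y \<and> g x = t"
          using n t t0 g0[of 0] by (intro IVT') (auto intro: continuous_on_subset[OF cont])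
        then show False using False by auto
      qed
      have P_UN: "P = (\<Union>n::nat. P \<inter> {0..real n})" using P real_arch_simple by (auto, blast)
      have lim: "(\<lambda>n. emeasure lebesgue (P \<inter> {0..real n})) \<longlonglongrightarrow> emeasure lebesgue (\<Union>n::nat. P \<inter> {0..real n})"
        by (rule Lim_emeasure_incseq) (use P in \<open>auto simp: incseq_def\<close>)
      have le: "emeasure lebesgue P \<le> ennreal t"
      proof (rule LIMSEQ_le_const2[OF lim[folded P_UN]], intro exI allI impI)
        fix n show "emeasure lebesgue (P \<inter> {0..real n}) \<le> ennreal t"
          unfolding eg using lt[of "real n"] by (intro ennreal_leI) simp
      qed
      then obtain m where m: "emeasure lebesgue P = ennreal m" "0 \<le> m" "m \<le> t"
        using t by (cases "emeasure lebesgue P") (auto simp: top_unique)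
      then have "{..<t} \<inter> {x. 0 \<le> x \<and> ennreal x < emeasure lebesgue P} = {0..<m}"
        by (auto simp: ennreal_less_iff)
      moreover have "{x\<in>P. g x < t} = P" using lt by auto
      ultimately show ?thesis using m by simp
    qed
  qed
qed

lemma fsigma_imp_borel_set: "fsigma S \<Longrightarrow> S \<in> sets borel"
  by (induction rule: fsigma.induct) auto

text \<open>Off a null set \<open>g\<close> is injective, but images of Lebesgue sets must be
  measurable too. The domain is therefore cut down to an F-sigma set \<open>C\<close>: on the line
  this is a countable union of compact sets, which the continuous \<open>g\<close> maps to compact
  sets, and every Lebesgue set is F-sigma up to a null set.\<close>

lemma piso_initial_segment:
  fixes P :: "real set"
  assumes P: "P \<in> sets lebesgue" "P \<subseteq> {0..}"
  defines "I \<equiv> {x. 0 \<le> x \<and> ennreal x < emeasure lebesgue P}"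
  shows "\<exists>P' Q' g. P' \<subseteq> P \<and> P - P' \<in> null_sets lebesgue \<and> Q' \<subseteq> I \<and> I - Q' \<in> null_sets lebesgue \<and>
    piso lebesgue lebesgue P' Q' g"
proof -
  define g where "g x = measure lebesgue (P \<inter> {0..x})" for x
  note gs = emeasure_initial_segment[OF P, folded g_def, folded I_def]
  have I: "I \<in> sets borel" unfolding I_def by measurable
  have gm: "g \<in> borel_measurable borel" using gs(2) by (rule borel_measurable_continuous_onI)
  \<comment> \<open>Both sides are measures in \<open>V\<close>, finite on
    \<open>{..<real n}\<close>, that agree on the intersection-stable generator
    \<open>{..<t}\<close> of the Borel sets.\<close>
  have push: "emeasure lebesgue (P \<inter> g -` V) = emeasure lborel (V \<inter> I)" if V: "V \<in> sets borel" for V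
  proof -
    define \<nu>1 where "\<nu>1 = distr (restrict_space lebesgue P) borel g"
    define \<nu>2 where "\<nu>2 = distr (restrict_space lborel I) borel (\<lambda>x. x)"
    have gm': "g \<in> measurable (restrict_space lebesgue P) borel"
      by (intro measurable_restrict_space1 measurable_completion) (use gm in simp)
    have im: "(\<lambda>x. x) \<in> measurable (restrict_space lborel I) borel"
      by (intro measurable_restrict_space1) simp
    have e1: "emeasure \<nu>1 W = emeasure lebesgue (P \<inter> g -` W)" if "W \<in> sets borel" for W
      using that gm' P unfolding \<nu>1_def
      by (subst emeasure_distr) (auto simp: emeasure_restrict_space space_restrict_space Int_commute)
    have e2: "emeasure \<nu>2 W = emeasure lborel (W \<inter> I)" if "W \<in> sets borel" for W
      using that im I unfolding \<nu>2_def
      by (subst emeasure_distr) (auto simp: emeasure_restrict_space space_restrict_space Int_commute)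
    have "\<nu>1 = \<nu>2"
    proof (rule measure_eqI_generator_eq[where E="range lessThan" and \<Omega>=UNIV and A="\<lambda>n. {..<real n}"])
      show "Int_stable (range lessThan :: real set set)"
      proof (rule Int_stableI)
        fix a b :: "real set" assume "a \<in> range lessThan" "b \<in> range lessThan"
        then obtain x y where "a = {..<x}" "b = {..<y}" by auto
        then have "a \<inter> b = {..<min x y}" by auto
        then show "a \<inter> b \<in> range lessThan" by simp
      qed
      fix X :: "real set" assume "X \<in> range lessThan"
      then obtain t where X: "X = {..<t}" by auto
      have "P \<inter> g -` {..<t} = {x\<in>P. g x < t}" by auto
      then show "emeasure \<nu>1 X = emeasure \<nu>2 X" using gs(4)[of t] by (simp add: X e1 e2)
    next
      fix n :: nat
      have "emeasure \<nu>1 {..<real n} \<le> emeasure lborel {0..real n}"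
      proof -
        have "P \<inter> g -` {..<real n} = {x\<in>P. g x < real n}" by auto
        moreover have "emeasure lborel ({..<real n} \<inter> I) \<le> emeasure lborel {0..real n}"
          by (rule emeasure_mono) (auto simp: I_def)
        ultimately show ?thesis using gs(4)[of "real n"] by (simp add: e1)
      qed
      then show "emeasure \<nu>1 {..<real n} \<noteq> \<infinity>" by (auto simp: top_unique)
    next
      show "sets \<nu>1 = sigma_sets UNIV (range lessThan)" "sets \<nu>2 = sigma_sets UNIV (range lessThan)"
        unfolding \<nu>1_def \<nu>2_def by (simp_all add: borel_Iio)
      show "(\<Union>n. {..<real n}) = UNIV" using reals_Archimedean2 by auto
    qed auto
    then show ?thesis using e1[OF V] e2[OF V] by simp
  qed
  \<comment> \<open>Points of \<open>P\<close> from which \<open>g\<close> stays constant up to some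
    rational on the right. Each of the countably many pieces lies in an interval where
    \<open>g\<close> does not grow, hence is null. Two points of \<open>P\<close> with equal values
    have a rational between them, so the smaller one is in \<open>N\<close>.\<close>
  define N where "N = (\<Union>r\<in>\<rat>. {x\<in>P. x < r \<and> g x = g r})"
  have N: "N \<in> null_sets lebesgue" unfolding N_def
  proof (intro null_sets_UN' countable_rat)
    fix r :: real assume "r \<in> \<rat>"
    define Z where "Z = {x\<in>P. x < r \<and> g x = g r}"
    show "{x\<in>P. x < r \<and> g x = g r} \<in> null_sets lebesgue" unfolding Z_def[symmetric]
    proof (cases "Z = {}")
      case False
      have Zb: "bdd_below Z" using P by (intro bdd_belowI[of _ 0]) (auto simp: Z_def)
      define l where "l = Inf Z"
      have "closed (g -` {g r})" by (intro closed_vimage gs(2)) auto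
      moreover have "Z \<subseteq> g -` {g r}" by (auto simp: Z_def)
      ultimately have gl: "g l = g r" using closure_minimal closure_contains_Inf[OF False Zb] unfolding l_def by blast
      have lr: "l \<le> r" using False cInf_lower[OF _ Zb] unfolding l_def Z_def by force
      have n: "P \<inter> {l..r} \<in> null_sets lebesgue" using gs(5)[OF lr gl] P by (intro null_setsI) auto
      show "Z \<in> null_sets lebesgue"
      proof (rule null_sets_completion_subset[OF _ n])
        show "Z \<subseteq> P \<inter> {l..r}" using cInf_lower[OF _ Zb] by (auto simp: l_def) (auto simp: Z_def)
      qed
    qed auto
  qed
  have "P - N \<in> sets lebesgue" using P N by auto
  then obtain C T where CT: "fsigma C" "T \<in> null_sets lebesgue" "C \<union> T = P - N" "disjnt C T"
    by (rule lebesgue_set_almost_fsigma)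
  have CP: "C \<subseteq> P" "C \<inter> N = {}" using CT by auto
  have Cm: "C \<in> sets lebesgue" using CT(1) by (intro sets_completionI_sets) (simp add: fsigma_imp_borel_set)
  have PC: "P - C \<in> null_sets lebesgue"
    by (rule null_sets_completion_subset[OF _ null_sets.Un[OF N CT(2)]]) (use CT(3) in auto)
  have inj: "inj_on g C"
  proof -
    have *: False if xy: "x \<in> C" "x < y" "g x = g y" for x y
    proof -
      obtain r where r: "r \<in> \<rat>" "x < r" "r < y" using Rats_dense_in_real[OF xy(2)] by auto
      then have "g r = g x" using monoD[OF gs(1), of x r] monoD[OF gs(1), of r y] xy by simp
      then have "x \<in> N" using r xy CP by (auto simp: N_def)
      then show False using xy CP by auto
    qed
    show ?thesis by (rule inj_onI) (metis * linorder_neqE_linordered_idom)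
  qed
  have img: "fsigma (g ` S)" if S: "fsigma S" for S
  proof -
    obtain F :: "nat \<Rightarrow> real set" where F: "range F \<subseteq> Collect compact" "S = \<Union>(F ` UNIV)"
      using S fsigma_Union_compact[of S] by blast
    have "g ` S = (\<Union>i. g ` F i)" unfolding F(2) by (rule image_UN)
    have "compact (g ` F i)" for i
      using F(1) by (intro compact_continuous_image continuous_on_subset[OF gs(2)]) auto
    then have "range (\<lambda>i. g ` F i) \<subseteq> Collect compact" by (intro image_subsetI CollectI)
    then show ?thesis using \<open>g ` S = (\<Union>i. g ` F i)\<close> unfolding fsigma_Union_compact by (intro exI[of _ "\<lambda>i. g ` F i"] conjI)
  qed
  have Qb: "g ` S \<in> sets borel" if "fsigma S" for S using img[OF that] by (rule fsigma_imp_borel_set)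
  have gI: "g ` C \<inter> I \<in> sets borel" using Qb[OF CT(1)] I by auto
  have push': "emeasure lebesgue (C \<inter> g -` V) = emeasure lborel (V \<inter> I)" if V: "V \<in> sets borel" for V
  proof -
    have vm: "g -` V \<in> sets lebesgue" using measurable_sets[OF gm V] by (intro sets_completionI_sets) simp
    have "emeasure lebesgue (C \<inter> g -` V) = emeasure lebesgue (P \<inter> g -` V)"
    proof (rule emeasure_eq_AE)
      show "AE x in lebesgue. (x \<in> C \<inter> g -` V) = (x \<in> P \<inter> g -` V)"
        by (rule AE_I'[OF PC]) (use CP in auto)
    qed (use Cm P vm in auto)
    then show ?thesis using push[OF V] by simp
  qed
  define C' where "C' = C \<inter> g -` I"
  define Q' where "Q' = g ` C'"
  have vI: "g -` I \<in> sets lebesgue" using measurable_sets[OF gm I] by (intro sets_completionI_sets) simp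
  have C'm: "C' \<in> sets lebesgue" using Cm vI by (auto simp: C'_def)
  have C'C: "C' \<subseteq> C" by (auto simp: C'_def)
  have Q'I: "Q' = g ` C \<inter> I" by (auto simp: Q'_def C'_def)
  have n1: "C - C' \<in> null_sets lebesgue"
  proof -
    have "C - C' = C \<inter> g -` (- I)" by (auto simp: C'_def)
    then have "emeasure lebesgue (C - C') = 0" using push'[of "- I"] I by simp
    then show ?thesis using Cm C'm by auto
  qed
  have n2: "I - Q' \<in> null_sets lebesgue"
  proof -
    have "C \<inter> g -` (I - Q') = {}" by (auto simp: Q'_def C'_def)
    moreover have "I - Q' \<in> sets borel" using gI I by (auto simp: Q'I)
    ultimately have "emeasure lborel ((I - Q') \<inter> I) = 0" using push'[of "I - Q'"] by simp
    moreover have "(I - Q') \<inter> I = I - Q'" by auto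
    ultimately show ?thesis using \<open>I - Q' \<in> sets borel\<close> by (intro null_sets_completionI) auto
  qed
  \<comment> \<open>A Lebesgue null set need not be Borel; \<open>push'\<close> is applied to a
    Borel null set containing it.\<close>
  have pn: "C \<inter> g -` S \<in> null_sets lebesgue" if S: "S \<in> null_sets lebesgue" "S \<subseteq> I" for S
  proof -
    obtain S' where S': "S' \<in> null_sets lborel" "S \<subseteq> S'" using S(1) unfolding null_sets_completion_iff2 by blast
    then have "emeasure lebesgue (C \<inter> g -` S') = emeasure lborel (S' \<inter> I)" by (intro push') auto
    also have "\<dots> \<le> emeasure lborel S'" using S' by (intro emeasure_mono) auto
    finally have "emeasure lebesgue (C \<inter> g -` S') = 0" using S' by auto
    moreover have "g -` S' \<in> sets lebesgue"
      using measurable_sets[OF gm, of S'] S' by (intro sets_completionI_sets) auto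
    ultimately have "C \<inter> g -` S' \<in> null_sets lebesgue" using Cm by auto
    then show ?thesis by (rule null_sets_completion_subset[rotated]) (use S' in auto)
  qed
  have ps: "C' \<inter> g -` E \<in> sets lebesgue" if E: "E \<in> sets lebesgue" "E \<subseteq> I" for E
  proof -
    obtain D T where DT: "fsigma D" "T \<in> null_sets lebesgue" "D \<union> T = E" "disjnt D T"
      using E(1) by (rule lebesgue_set_almost_fsigma)
    have "g -` D \<in> sets lebesgue"
      using measurable_sets[OF gm fsigma_imp_borel_set[OF DT(1)]] by (intro sets_completionI_sets) auto
    moreover have "C \<inter> g -` T \<in> null_sets lebesgue" using DT E by (intro pn) auto
    moreover have "C' \<inter> g -` E = C' \<inter> g -` D \<union> C' \<inter> (C \<inter> g -` T)" using DT(3) C'C by auto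
    ultimately show ?thesis using C'm by auto
  qed
  have im: "g ` E \<in> sets lebesgue \<and> emeasure lebesgue (g ` E) = emeasure lebesgue E"
    if E: "E \<in> sets lebesgue" "E \<subseteq> C'" for E
  proof -
    have fs: "g ` D \<in> sets borel \<and> emeasure lborel (g ` D) = emeasure lebesgue D" if D: "fsigma D" "D \<subseteq> C'" for D
    proof -
      have "C \<inter> g -` (g ` D) = D" using inj D(2) C'C by (auto simp: inj_on_def subset_iff)
      moreover have "g ` D \<inter> I = g ` D" using D(2) by (auto simp: C'_def)
      ultimately show ?thesis using push'[OF Qb[OF D(1)]] Qb[OF D(1)] by simp
    qed
    \<comment> \<open>\<open>D\<close> is an F-sigma subset of \<open>C' - T\<close> of full measure
      in \<open>C'\<close>. By injectivity the image of \<open>T\<close> lies in the Borel set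
      \<open>?V\<close> of points in the image of \<open>C'\<close> but not in that of
      \<open>D\<close>, and \<open>?V\<close> is null because its preimage is.\<close>
    have nl: "g ` T \<in> null_sets lebesgue" if T: "T \<in> null_sets lebesgue" "T \<subseteq> C'" for T
    proof -
      have "C' - T \<in> sets lebesgue" using C'm T by auto
      then obtain D T' where DT: "fsigma D" "T' \<in> null_sets lebesgue" "D \<union> T' = C' - T" "disjnt D T'"
        by (rule lebesgue_set_almost_fsigma)
      have DC: "D \<subseteq> C'" using DT by auto
      let ?V = "g ` C' - g ` D"
      have gC': "g ` C' \<in> sets borel" using gI Q'I by (simp add: Q'_def)
      then have V: "?V \<in> sets borel" using fs[OF DT(1) DC] by auto
      have "C \<inter> g -` ?V = C' - D" using inj DC C'C by (auto simp: inj_on_def subset_iff C'_def)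
      moreover have "C' - D \<in> null_sets lebesgue"
        by (rule null_sets_completion_subset[OF _ null_sets.Un[OF T(1) DT(2)]]) (use DT(3) in auto)
      ultimately have "emeasure lborel (?V \<inter> I) = 0" using push'[OF V] by auto
      moreover have "?V \<inter> I = ?V" by (auto simp: C'_def)
      ultimately have "?V \<in> null_sets lborel" using V by auto
      then have Vn: "?V \<in> null_sets lebesgue" by (rule null_sets_completionI)
      show ?thesis
      proof (rule null_sets_completion_subset[OF _ Vn])
        have "g ` T = g ` C' - g ` (C' - T)" using inj T(2) C'C by (auto simp: inj_on_def subset_iff)
        moreover have "g ` D \<subseteq> g ` (C' - T)" using DT(3) by auto
        moreover have "g ` T \<inter> g ` D = {}"
        proof -
          have "D \<inter> T = {}" using DT(3) by auto
          then show ?thesis using inj_on_image_Int[OF inj, of T D] T(2) DC C'C by auto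
        qed
        ultimately show "g ` T \<subseteq> ?V" using T(2) by blast
      qed
    qed
    obtain D T where DT: "fsigma D" "T \<in> null_sets lebesgue" "D \<union> T = E" "disjnt D T"
      using E(1) by (rule lebesgue_set_almost_fsigma)
    have d: "D \<subseteq> C'" "T \<subseteq> C'" using DT(3) E(2) by auto
    have gD: "g ` D \<in> sets lebesgue" "emeasure lebesgue (g ` D) = emeasure lebesgue D"
      using fs[OF DT(1) d(1)] by auto
    have gE: "g ` E = g ` D \<union> g ` T" using DT(3) by auto
    have Dm: "D \<in> sets lebesgue" using fsigma_imp_borel_set[OF DT(1)] by auto
    have "emeasure lebesgue (g ` E) = emeasure lebesgue (g ` D)"
      unfolding gE using gD nl[OF DT(2) d(2)] by (intro emeasure_Un_null_set) auto
    moreover have "emeasure lebesgue E = emeasure lebesgue D"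
      using DT(2,3) Dm emeasure_Un_null_set[of D lebesgue T] by simp
    moreover have "g ` E \<in> sets lebesgue" unfolding gE using gD nl[OF DT(2) d(2)] by auto
    ultimately show ?thesis using gD by simp
  qed
  have "piso lebesgue lebesgue C' Q' g"
    unfolding piso_def
  proof (intro conjI ballI impI C'm)
    show "Q' \<in> sets lebesgue" using gI Q'I by auto
    show "bij_betw g C' Q'" using inj_on_subset[OF inj C'C] by (simp add: bij_betw_def Q'_def)
    fix E :: "real set" assume E: "E \<in> sets lebesgue"
    { assume "E \<subseteq> C'"
      then show "g ` E \<in> sets lebesgue" "emeasure lebesgue (g ` E) = emeasure lebesgue E" using im[OF E] by auto }
    assume "E \<subseteq> Q'"
    then show "g -` E \<inter> C' \<in> sets lebesgue" using ps[OF E] Q'I by (auto simp: Int_commute)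
  qed
  moreover have "P - C' \<in> null_sets lebesgue"
    by (rule null_sets_completion_subset[OF _ null_sets.Un[OF PC n1]]) auto
  moreover have "Q' \<subseteq> I" "C' \<subseteq> P" using Q'I C'C CP by auto
  ultimately show ?thesis using n2 by blast
qed

section \<open>Normal forms for measurable subsets of the given space\<close>

lemma piso_measure_iso:
  assumes X: "X \<in> sets M" and Y: "Y \<in> sets N" and f: "measure_iso (restrict_space M X) (restrict_space N Y) f"
  shows "piso M N X Y f"
proof -
  let ?M = "restrict_space M X" and ?N = "restrict_space N Y"
  have sX: "space ?M = X" and sY: "space ?N = Y"
    using sets.sets_into_space[OF X] sets.sets_into_space[OF Y] by (auto simp: space_restrict_space)
  have b: "bij_betw f X Y" and m: "f \<in> measurable ?M ?N" and m': "inv_into X f \<in> measurable ?N ?M"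
    and d: "distr ?M ?N f = ?N"
    using f unfolding measure_iso_def sX sY by blast+
  have vm: "f -` E \<inter> X \<in> sets M \<and> emeasure M (f -` E \<inter> X) = emeasure N E" if E: "E \<in> sets N" "E \<subseteq> Y" for E
  proof -
    have E': "E \<in> sets ?N" using E Y by (simp add: sets_restrict_space_iff)
    have "f -` E \<inter> X \<in> sets ?M" using measurable_sets[OF m E'] sX by simp
    then have 1: "f -` E \<inter> X \<in> sets M" using X by (simp add: sets_restrict_space_iff)
    have "emeasure N E = emeasure (distr ?M ?N f) E" unfolding d using E Y by (simp add: emeasure_restrict_space)
    also have "\<dots> = emeasure ?M (f -` E \<inter> X)" using emeasure_distr[OF m E'] sX by simp
    also have "\<dots> = emeasure M (f -` E \<inter> X)" using X by (simp add: emeasure_restrict_space)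
    finally show ?thesis using 1 by simp
  qed
  have "f ` E \<in> sets N \<and> emeasure N (f ` E) = emeasure M E" if E: "E \<in> sets M" "E \<subseteq> X" for E
  proof -
    have E': "E \<in> sets ?M" using E X by (simp add: sets_restrict_space_iff)
    have "f ` E = inv_into X f -` E \<inter> Y"
    proof
      show "f ` E \<subseteq> inv_into X f -` E \<inter> Y" using b E(2) by (auto simp: bij_betw_def inv_into_f_f subset_iff)
      show "inv_into X f -` E \<inter> Y \<subseteq> f ` E"
      proof
        fix y assume y: "y \<in> inv_into X f -` E \<inter> Y"
        then have "f (inv_into X f y) = y" using b by (simp add: bij_betw_inv_into_right)
        then show "y \<in> f ` E" using y by (intro image_eqI[of _ _ "inv_into X f y"]) auto
      qed
    qed
    then have "f ` E \<in> sets ?N" using measurable_sets[OF m' E'] sY by simp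
    then have 1: "f ` E \<in> sets N" "f ` E \<subseteq> Y" using Y by (simp_all add: sets_restrict_space_iff)
    have "f -` (f ` E) \<inter> X = E" using b E(2) by (auto simp: bij_betw_def inj_on_def subset_iff)
    then show ?thesis using vm[OF 1] 1 by simp
  qed
  then show ?thesis unfolding piso_def using vm X Y b by blast
qed

lemma piso_translation:
  fixes S :: "real set"
  assumes "S \<in> sets lebesgue"
  shows "piso lebesgue lebesgue S ((\<lambda>x. x + c) ` S) (\<lambda>x. x + c)"
proof -
  have 1: "(\<lambda>x. x + c) ` E \<in> sets lebesgue" if "E \<in> sets lebesgue" for E and c :: real
    using lebesgue_sets_translation[OF that, of c] by (simp add: add.commute)
  have 2: "emeasure lebesgue ((\<lambda>x. x + c) ` E) = emeasure lebesgue E" for E and c :: real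
    using emeasure_lebesgue_affine[of 1 c E] by (simp add: add.commute)
  have 3: "(\<lambda>x. x + c) -` E \<inter> S \<in> sets lebesgue" if "E \<in> sets lebesgue" for E
  proof -
    have "(\<lambda>x. x + c) -` E = (\<lambda>x. x + (- c)) ` E" by (auto simp: image_iff) (metis add_diff_cancel_right')
    then show ?thesis using 1[OF that, of "-c"] assms by auto
  qed
  show ?thesis unfolding piso_def bij_betw_def
    using 1 2 3 assms by (auto intro!: inj_onI)
qed

text \<open>The passage to initial segments starts from subsets of the half-line. The unit intervals
  of the line are rearranged by the bijection \<open>int_encode\<close> of the integers with the
  naturals, each by a translation.\<close>

lemma piso_real_nonneg: "\<exists>f. piso lebesgue lebesgue (UNIV :: real set) {0::real..} f"
proof -
  define f where "f x = x + (real (int_encode \<lfloor>x\<rfloor>) - of_int \<lfloor>x\<rfloor>)" for x :: real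
  define P where "P k = {x::real. \<lfloor>x\<rfloor> = k}" for k
  have Pm: "P k \<in> sets lebesgue" for k
  proof -
    have "P k \<in> sets borel" unfolding P_def by measurable
    then show ?thesis by (intro sets_completionI_sets) simp
  qed
  have fl: "\<lfloor>f x\<rfloor> = int (int_encode \<lfloor>x\<rfloor>)" "frac (f x) = frac x" for x
  proof -
    have "f x = of_int (int (int_encode \<lfloor>x\<rfloor>)) + frac x" by (simp add: f_def frac_def)
    moreover have "0 \<le> frac x" "frac x < 1" by (auto simp: frac_lt_1)
    ultimately show 1: "\<lfloor>f x\<rfloor> = int (int_encode \<lfloor>x\<rfloor>)" by linarith
    show "frac (f x) = frac x" unfolding frac_def 1 by (simp add: f_def)
  qed
  have UP: "(\<Union>k. P k) = UNIV" by (auto simp: P_def)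
  have inj: "inj f"
  proof (rule injI)
    fix x y assume "f x = f y"
    then have "int_encode \<lfloor>x\<rfloor> = int_encode \<lfloor>y\<rfloor>" "frac x = frac y" using fl by (metis of_nat_eq_iff)+
    then have "\<lfloor>x\<rfloor> = \<lfloor>y\<rfloor>" using inj_int_encode by (auto dest: injD)
    then show "x = y" using \<open>frac x = frac y\<close> by (simp add: frac_def)
  qed
  have rng: "f ` UNIV = {0..}"
  proof
    show "f ` UNIV \<subseteq> {0..}"
    proof safe
      fix x have "0 \<le> \<lfloor>f x\<rfloor>" using fl by simp
      then show "f x \<ge> 0" by simp
    qed
    show "{0..} \<subseteq> f ` UNIV"
    proof
      fix y :: real assume "y \<in> {0..}"
      then have y: "0 \<le> \<lfloor>y\<rfloor>" by simp
      define x where "x = of_int (int_decode (nat \<lfloor>y\<rfloor>)) + frac y"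
      have "0 \<le> frac y" "frac y < 1" by (auto simp: frac_lt_1)
      then have "\<lfloor>x\<rfloor> = int_decode (nat \<lfloor>y\<rfloor>)" unfolding x_def by linarith
      then have "f x = y" using y by (simp add: f_def x_def frac_def)
      then show "y \<in> f ` UNIV" by blast
    qed
  qed
  have "piso lebesgue lebesgue (P k) (f ` P k) f" for k
  proof -
    have e: "f x = x + (real (int_encode k) - of_int k)" if "x \<in> P k" for x using that by (simp add: P_def f_def)
    have "f ` P k = (\<lambda>x. x + (real (int_encode k) - of_int k)) ` P k" by (rule image_cong) (use e in auto)
    then show ?thesis
      using piso_cong[OF piso_translation[OF Pm, of k "real (int_encode k) - of_int k"], of f] e by simp
  qed
  then have "piso lebesgue lebesgue (\<Union>k. P k) (f ` (\<Union>k. P k)) f"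
    by (rule piso_countable_UN) (simp only: UP inj)
  then show ?thesis unfolding UP rng by blast
qed

text \<open>Composition of the given isomorphism, the folding of the line and the passage to an
  initial segment. Up to null sets, measure is thus the only invariant of a measurable set.\<close>

lemma piso_standard:
  assumes iso: "isomorphic_mod0 M (lebesgue :: real measure)" and P: "P \<in> sets M"
  shows "\<exists>P' Q' g. P' \<subseteq> P \<and> P - P' \<in> null_sets M \<and> Q' \<subseteq> {x. 0 \<le> x \<and> ennreal x < emeasure M P} \<and>
    {x. 0 \<le> x \<and> ennreal x < emeasure M P} - Q' \<in> null_sets lebesgue \<and> piso M lebesgue P' Q' g"
proof -
  obtain X Y h where X: "X \<in> sets M" "space M - X \<in> null_sets M"
    and Y: "Y \<in> sets (lebesgue :: real measure)"
    and "measure_iso (restrict_space M X) (restrict_space (lebesgue :: real measure) Y) h"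
    using iso unfolding isomorphic_mod0_def by blast
  then have h: "piso M lebesgue X Y h" by (intro piso_measure_iso)
  obtain f where f: "piso lebesgue lebesgue (UNIV :: real set) {0::real..} f" using piso_real_nonneg by blast
  have k: "piso M lebesgue X (f ` Y) (f \<circ> h)" by (rule piso_comp[OF h piso_subset[OF f Y]]) simp
  define P0 where "P0 = P \<inter> X"
  have P0: "P0 \<in> sets M" "P0 \<subseteq> X" using P X by (auto simp: P0_def)
  have PP0: "P - P0 \<in> null_sets M"
    by (rule null_sets_subset[OF X(2)]) (use P P0 sets.sets_into_space[OF P] in \<open>auto simp: P0_def\<close>)
  define R where "R = (f \<circ> h) ` P0"
  have k0: "piso M lebesgue P0 R (f \<circ> h)" unfolding R_def by (rule piso_subset[OF k P0])
  have "emeasure M P = emeasure M P0"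
    using emeasure_Un_null_set[OF P0(1) PP0] by (simp add: P0_def Un_Diff_Int Int_commute sup_commute)
  then have eR: "emeasure lebesgue R = emeasure M P" using piso_emeasure[OF k0] by simp
  have "R \<subseteq> {0..}" using pisoD(5)[OF f] by (auto simp: R_def)
  then obtain R' Q' g where r: "R' \<subseteq> R" "R - R' \<in> null_sets lebesgue" "Q' \<subseteq> {x. 0 \<le> x \<and> ennreal x < emeasure M P}"
    "{x. 0 \<le> x \<and> ennreal x < emeasure M P} - Q' \<in> null_sets lebesgue" "piso lebesgue lebesgue R' Q' g"
    using piso_initial_segment[OF pisoD(2)[OF k0]] unfolding eR by blast
  define P' where "P' = (f \<circ> h) -` R' \<inter> P0"
  have v: "piso M lebesgue P' R' (f \<circ> h)" unfolding P'_def by (rule piso_vimage[OF k0 pisoD(1)[OF r(5)] r(1)])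
  have "piso M lebesgue P' Q' (g \<circ> (f \<circ> h))" by (rule piso_comp[OF v r(5)])
  moreover have "P - P' \<in> null_sets M"
  proof -
    have "emeasure M (P0 - P') = 0"
    proof -
      have "P0 - P' = (f \<circ> h) -` (R - R') \<inter> P0" unfolding P'_def R_def by blast
      then have "emeasure M (P0 - P') = emeasure lebesgue (R - R')"
        using piso_emeasure_vimage[OF k0 null_setsD2[OF r(2)]] by auto
      then show ?thesis using null_setsD1[OF r(2)] by simp
    qed
    then have "P0 - P' \<in> null_sets M" using P0 pisoD(1)[OF v] by auto
    then have "(P - P0) \<union> (P0 - P') \<in> null_sets M" using PP0 by auto
    moreover have "P - P' = (P - P0) \<union> (P0 - P')" by (auto simp: P0_def P'_def)
    ultimately show ?thesis by simp
  qed
  moreover have "P' \<subseteq> P" by (auto simp: P'_def P0_def)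
  ultimately show ?thesis using r(3,4) by blast
qed

lemma emeasure_space_isomorphic_mod0:
  assumes iso: "isomorphic_mod0 M (lebesgue :: real measure)"
  shows "emeasure M (space M) = \<infinity>"
proof -
  obtain X Y h where X: "X \<in> sets M"
    and Y: "Y \<in> sets (lebesgue :: real measure)" "space lebesgue - Y \<in> null_sets lebesgue"
    and "measure_iso (restrict_space M X) (restrict_space (lebesgue :: real measure) Y) h"
    using iso unfolding isomorphic_mod0_def by blast
  then have h: "piso M lebesgue X Y h" by (intro piso_measure_iso)
  have "emeasure lebesgue (UNIV :: real set) = emeasure lebesgue (Y \<union> (UNIV - Y))" by simp
  also have "\<dots> = emeasure lebesgue Y" using Y by (intro emeasure_Un_null_set) auto
  finally have "emeasure M X = \<infinity>" using piso_emeasure[OF h] by simp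
  then show ?thesis using emeasure_mono[OF sets.sets_into_space[OF X], of M] by (auto simp: top_unique)
qed

section \<open>A mixing rank-one map of the half-line\<close>

text \<open>Used to order a tower: levels that come from copies have prescribed heights, and the new
  intervals fill the remaining heights in any order.\<close>

lemma extend_to_bij_betw:
  assumes "finite S" "A \<subseteq> S" "inj_on f A" "f ` A \<subseteq> S"
  shows "\<exists>\<pi>. bij_betw \<pi> S S \<and> (\<forall>x\<in>A. \<pi> x = f x)"
proof -
  have fA: "finite A" using assms finite_subset by auto
  have "card (S - A) = card (S - f ` A)"
    using assms fA by (simp add: card_Diff_subset card_image)
  then obtain g where g: "bij_betw g (S - A) (S - f ` A)"
    using assms(1) finite_same_card_bij[of "S - A" "S - f ` A"] by auto
  define \<pi> where "\<pi> x = (if x \<in> A then f x else g x)" for x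
  have 1: "bij_betw \<pi> A (f ` A)" using assms(3) by (subst bij_betw_cong[of _ _ f]) (auto simp: \<pi>_def bij_betw_def)
  have 2: "bij_betw \<pi> (S - A) (S - f ` A)" using g by (subst bij_betw_cong[of _ _ g]) (auto simp: \<pi>_def)
  have "bij_betw \<pi> (A \<union> (S - A)) (f ` A \<union> (S - f ` A))" by (rule bij_betw_combine[OF 1 2]) auto
  moreover have "A \<union> (S - A) = S" "f ` A \<union> (S - f ` A) = S" using assms by auto
  ultimately show ?thesis by (auto simp: \<pi>_def)
qed

text \<open>The larger exponents on the two sides must agree, since two powers with exponents below
  \<open>z\<close> add up to less than \<open>3 ^ z\<close>. Base 2 would fail here: doubling a
  power gives the next one.\<close>

lemma sum_two_powers_unique:
  fixes a b c d :: nat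
  assumes "3 ^ b + 3 ^ c = 3 ^ d + (3::nat) ^ a" "a \<noteq> b"
  shows "a = c"
proof -
  have lt: "3 ^ x + 3 ^ y < (3::nat) ^ z" if xy: "x < z" "y < z" for x y z :: nat
  proof -
    obtain z' where z: "z = Suc z'" using xy by (cases z) auto
    have "(3::nat) ^ x \<le> 3 ^ z'" "(3::nat) ^ y \<le> 3 ^ z'" using xy z by (auto intro!: power_increasing)
    moreover have "0 < (3::nat) ^ z'" by simp
    ultimately show ?thesis unfolding z power_Suc by linarith
  qed
  have p: "0 < (3::nat) ^ x" for x by simp
  have "\<not> (b < d \<and> c < d)" "\<not> (b < a \<and> c < a)" "\<not> (d < b \<and> a < b)" "\<not> (d < c \<and> a < c)"
    using lt[of b d c] lt[of b a c] lt[of d b a] lt[of d c a] p[of a] p[of b] p[of c] p[of d] assms(1) by linarith+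
  then consider "b = d" | "b = a" | "c = d" | "c = a" by linarith
  then show ?thesis
  proof cases
    case 1 then show ?thesis using assms(1) by simp
  next
    case 3 then have "(3::nat) ^ b = 3 ^ a" using assms(1) by simp
    then show ?thesis using assms(2) by simp
  qed (use assms(2) in auto)
qed

text \<open>\<open>w0\<close> is the length of the base interval \<open>X 0\<close>, and
  \<open>q\<close> is the quality of the model: \<open>X 0\<close> does not meet itself under the
  first \<open>q\<close> powers, and under every positive power its returning part is covered by a
  set of measure at most \<open>w0 / q\<close>.\<close>

locale rank_one_model =
  fixes q :: nat and w0 :: real
  assumes q: "1 \<le> q" and w0: "0 < w0"
begin

text \<open>Stage \<open>j\<close> is a tower of \<open>h j\<close> intervals of length \<open>w j\<close> filling an initial segment \<open>X j\<close> of the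
  half-line. It is cut into \<open>r j\<close> columns, and column \<open>a\<close> is placed at height \<open>p j a\<close> of the next
  tower; all other levels of that tower are new intervals. The heights \<open>p j a\<close> form a Sidon set, so
  that two columns can meet under a given power in at most one way.\<close>

primrec h :: "nat \<Rightarrow> nat" where
  "h 0 = 1"
| "h (Suc j) = 2 * q * h j * 3 ^ (q * Suc j * h j)"

text \<open>With this many columns, one column of stage \<open>j\<close> has measure
  \<open>h j * w j / r j = w j / (q * (j + 1))\<close>. It is small against \<open>w0\<close> for
  large \<open>q\<close> and tends to 0 with \<open>j\<close>.\<close>

definition r :: "nat \<Rightarrow> nat" where "r j = q * Suc j * h j"

text \<open>Powers of 3 form a Sidon set; the scale \<open>q * h j\<close> preserves this when
  positions below \<open>h j\<close> inside the copies are added. The factor 2 in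
  \<open>h (Suc j)\<close> confines all copies to the lower half of the next tower.\<close>

definition p :: "nat \<Rightarrow> nat \<Rightarrow> nat" where "p j a = q * h j * 3 ^ a"

primrec w :: "nat \<Rightarrow> real" where
  "w 0 = w0"
| "w (Suc j) = w j / real (r j)"

text \<open>The height of an interval in its tower as a function of its place on the line. Interval
  \<open>i\<close> of stage \<open>j + 1\<close> lies in interval \<open>i div r j\<close> of stage
  \<open>j\<close> and belongs to column \<open>i mod r j\<close>. Heights of new intervals are left
  to \<open>SOME\<close>; about them the later arguments use bijectivity only.\<close>

primrec pos :: "nat \<Rightarrow> nat \<Rightarrow> nat" where
  "pos 0 = id"
| "pos (Suc j) = (SOME \<pi>. bij_betw \<pi> {..<h (Suc j)} {..<h (Suc j)} \<and>
     (\<forall>i<h j * r j. \<pi> i = p j (i mod r j) + pos j (i div r j)))"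

definition idx :: "nat \<Rightarrow> real \<Rightarrow> nat" where "idx j x = nat \<lfloor>x / w j\<rfloor>"

definition X :: "nat \<Rightarrow> real set" where "X j = {x. 0 \<le> x \<and> idx j x < h j}"

definition Pos :: "nat \<Rightarrow> real \<Rightarrow> nat" where "Pos j x = pos j (idx j x)"

definition e :: "nat \<Rightarrow> nat \<Rightarrow> nat" where "e j = inv_into {..<h j} (pos j)"

text \<open>Translation of \<open>x\<close> to the level at height \<open>P\<close>, with the offset
  inside the interval kept.\<close>

definition mv :: "nat \<Rightarrow> nat \<Rightarrow> real \<Rightarrow> real" where
  "mv j P x = real (e j P) * w j + (x - real (idx j x) * w j)"

text \<open>One step up in the first tower where \<open>x\<close> is not on the top level. Later
  towers prescribe the same translation.\<close>

definition S :: "real \<Rightarrow> real" where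
  "S x = (let j = LEAST j. x \<in> X j \<and> Suc (Pos j x) < h j in mv j (Suc (Pos j x)) x)"

definition ivl :: "nat \<Rightarrow> nat \<Rightarrow> real set" where
  "ivl j i = {real i * w j..<real (Suc i) * w j}"

section \<open>Sizes of the towers and spacing of the columns\<close>

lemma h_pos: "1 \<le> h j"
  using q by (induction j) auto

lemma r_ge: "Suc j \<le> r j" "1 \<le> r j" "h j \<le> r j"
proof -
  have "1 * 1 * Suc j \<le> q * h j * Suc j" by (intro mult_le_mono q h_pos order_refl)
  moreover have "q * h j * Suc j = r j" by (simp add: r_def algebra_simps)
  ultimately show "Suc j \<le> r j" by simp
  then show "1 \<le> r j" by simp
  have "1 * 1 * h j \<le> q * Suc j * h j" by (intro mult_le_mono q order_refl) simp
  then show "h j \<le> r j" by (simp add: r_def)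
qed

lemma w_pos: "0 < w j"
  using w0 r_ge(2) by (induction j) (auto intro!: divide_pos_pos simp: Suc_le_eq)

lemma w_Suc_le: "w (Suc j) \<le> w j"
proof -
  have "w j / real (r j) \<le> w j / 1" using w_pos[of j] r_ge(2)[of j] by (intro divide_left_mono) auto
  then show ?thesis by simp
qed

lemma w_antimono: "j \<le> k \<Longrightarrow> w k \<le> w j"
  by (rule lift_Suc_antimono_le[of w]) (auto intro: w_Suc_le simp del: w.simps)

lemma w_le: "w j \<le> w0"
  using w_antimono[of 0 j] by simp

lemma w_Suc_bound: "w (Suc j) \<le> w0 / real (Suc j)"
proof -
  have "w j / real (r j) \<le> w0 / real (Suc j)"
    using w_pos[of j] r_ge(1)[of j] w_le[of j] by (intro frac_le) auto
  then show ?thesis by simp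
qed

lemma w_tendsto: "w \<longlonglongrightarrow> 0"
proof -
  have "(\<lambda>j. w (Suc j)) \<longlonglongrightarrow> 0"
  proof (rule tendsto_sandwich[of "\<lambda>_. 0" _ _ "\<lambda>j. w0 / real (Suc j)"])
    show "(\<lambda>j. w0 / real (Suc j)) \<longlonglongrightarrow> 0"
      using tendsto_mult[OF tendsto_const[of w0] LIMSEQ_inverse_real_of_nat] by (simp add: divide_inverse)
  qed (use w_Suc_bound w_pos less_imp_le in \<open>auto simp del: w.simps intro!: always_eventually\<close>)
  then show ?thesis by (rule LIMSEQ_imp_Suc)
qed

lemma copy_bound: "a < r j \<Longrightarrow> s < h j \<Longrightarrow> 2 * (p j a + s) < h (Suc j)"
proof -
  assume a: "a < r j" and s: "s < h j"
  have "1 * h j * 1 \<le> q * h j * 3 ^ a" by (intro mult_le_mono q order_refl) simp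
  then have "p j a + s < 3 * (q * h j * 3 ^ a)" using s unfolding p_def by linarith
  also have "\<dots> = q * h j * 3 ^ Suc a" by simp
  also have "\<dots> \<le> q * h j * 3 ^ r j" using a by (intro mult_le_mono power_increasing) auto
  finally show "2 * (p j a + s) < h (Suc j)" by (simp add: r_def)
qed

lemma p_pos: "1 \<le> p j a"
  using mult_le_mono[OF mult_le_mono[OF q h_pos[of j]], of 1 "3 ^ a"] by (simp add: p_def)

lemma p_inj: 
  assumes "p j a + s = p j b + t" "s < h j" "t < h j"
  shows "a = b \<and> s = t"
proof -
  have *: False if "a < b" "p j a + s = p j b + t" "s < h j" for a b s t
  proof -
    have "3 * (q * h j * 3 ^ a) = q * h j * 3 ^ Suc a" by simp
    also have "\<dots> \<le> p j b" unfolding p_def using that by (intro mult_le_mono power_increasing) auto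
    finally have "3 * p j a \<le> p j b" by (simp add: p_def)
    moreover have "1 * h j * 1 \<le> q * h j * 3 ^ a" by (intro mult_le_mono q order_refl) simp
    then have "h j \<le> p j a" by (simp add: p_def)
    ultimately show False using that by linarith
  qed
  have "a = b" using *[of a b s t] *[of b a t s] assms by (metis linorder_neqE_nat)
  then show ?thesis using assms by simp
qed

text \<open>The height differences of the two pairs of columns agree up to an error below
  \<open>2 * h j\<close>. Powers of 3 are odd, so \<open>D\<close> is even; if it were nonzero, the
  scale \<open>q * h j\<close> would make the discrepancy at least \<open>2 * h j\<close>. Hence
  \<open>D = 0\<close>, and uniqueness of sums of two powers applies.\<close>

lemma p_sidon:
  assumes 1: "p j a + s + n = p j b + t" and 2: "p j a' + s' + n = p j b' + t'"
    and lt: "s < h j" "t < h j" "s' < h j" "t' < h j" and ne: "a \<noteq> b"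
  shows "a = a'"
proof -
  define D :: int where "D = 3 ^ b + 3 ^ a' - 3 ^ b' - 3 ^ a"
  have p: "int (p j x) = int (q * h j) * 3 ^ x" for x by (simp add: p_def)
  have "int (q * h j) * D = int (p j b) + int (p j a') - int (p j b') - int (p j a)"
    unfolding p D_def by (simp add: algebra_simps)
  also have "\<dots> = (int s - int t) - (int s' - int t')" using 1 2 by linarith
  finally have e: "int (q * h j) * D = (int s - int t) - (int s' - int t')" .
  have "even D" by (simp add: D_def)
  have "D = 0"
  proof (rule ccontr)
    assume "D \<noteq> 0"
    then have "2 \<le> \<bar>D\<bar>" using \<open>even D\<close> by presburger
    have "h j \<le> q * h j" using q by simp
    then have "int (h j) * 2 \<le> int (q * h j) * \<bar>D\<bar>" using \<open>2 \<le> \<bar>D\<bar>\<close> by (intro mult_mono) (simp_all del: of_nat_mult)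
    also have "\<dots> = \<bar>int (q * h j) * D\<bar>" by (simp add: abs_mult)
    also have "\<dots> < 2 * int (h j)" unfolding e using lt by linarith
    finally show False by simp
  qed
  then have "int (3 ^ b + 3 ^ a') = int (3 ^ b' + 3 ^ a)" by (simp add: D_def)
  then have "3 ^ b + 3 ^ a' = 3 ^ b' + (3::nat) ^ a" by (simp only: of_nat_eq_iff)
  then show ?thesis using sum_two_powers_unique ne by blast
qed

lemma hr_le: "h j * r j \<le> h (Suc j)"
proof -
  have "r j \<le> 3 ^ r j" by (rule less_imp_le[OF less_le_trans[OF less_exp power_mono]]) auto
  then have "1 * h j * r j \<le> (2 * q) * h j * 3 ^ r j" using q by (intro mult_le_mono) auto
  then show ?thesis by (simp add: r_def)
qed

lemma pos_bij: "bij_betw (pos j) {..<h j} {..<h j}"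
  and pos_Suc: "i < h j * r j \<Longrightarrow> pos (Suc j) i = p j (i mod r j) + pos j (i div r j)"
proof -
  have *: "bij_betw (pos (Suc j)) {..<h (Suc j)} {..<h (Suc j)} \<and>
     (\<forall>i<h j * r j. pos (Suc j) i = p j (i mod r j) + pos j (i div r j))"
    if b: "bij_betw (pos j) {..<h j} {..<h j}" for j
  proof -
    let ?f = "\<lambda>i. p j (i mod r j) + pos j (i div r j)"
    have d: "i div r j < h j" "i mod r j < r j" "pos j (i div r j) < h j" if "i < h j * r j" for i
    proof -
      show "i div r j < h j" using that by (simp add: less_mult_imp_div_less)
      then show "pos j (i div r j) < h j" using b by (auto simp: bij_betw_def)
      show "i mod r j < r j" using r_ge(2)[of j] by simp
    qed
    have i1: "inj_on ?f {..<h j * r j}"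
    proof (rule inj_onI)
      fix i k assume ik: "i \<in> {..<h j * r j}" "k \<in> {..<h j * r j}" "?f i = ?f k"
      then have lt: "i < h j * r j" "k < h j * r j" by auto
      have 1: "i mod r j = k mod r j \<and> pos j (i div r j) = pos j (k div r j)"
        by (rule p_inj[OF ik(3) d(3)[OF lt(1)] d(3)[OF lt(2)]])
      have 2: "i div r j = k div r j"
        using inj_onD[OF bij_betw_imp_inj_on[OF b]] 1 d(1)[OF lt(1)] d(1)[OF lt(2)] by blast
      have "i = i div r j * r j + i mod r j" by (rule div_mult_mod_eq[symmetric])
      also have "\<dots> = k div r j * r j + k mod r j" using 1 2 by simp
      also have "\<dots> = k" by (rule div_mult_mod_eq)
      finally show "i = k" .
    qed
    have i2: "?f ` {..<h j * r j} \<subseteq> {..<h (Suc j)}"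
    proof (rule image_subsetI)
      fix i assume "i \<in> {..<h j * r j}"
      then show "?f i \<in> {..<h (Suc j)}" using copy_bound[OF d(2,3), of i i] by (simp del: h.simps)
    qed
    have i3: "{..<h j * r j} \<subseteq> {..<h (Suc j)}" using hr_le[of j] by (simp only: lessThan_subset_iff)
    note extend_to_bij_betw[OF finite_lessThan i3 i1 i2]
    then have "\<exists>\<pi>. bij_betw \<pi> {..<h (Suc j)} {..<h (Suc j)} \<and> (\<forall>i<h j * r j. \<pi> i = ?f i)"
      by (simp only: Ball_def lessThan_iff)
    from someI_ex[OF this] show ?thesis unfolding pos.simps(2) .
  qed
  have b: "bij_betw (pos j) {..<h j} {..<h j}" for j
  proof (induction j)
    case (Suc j) then show ?case using * by blast
  qed (simp add: bij_betw_def)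
  show "bij_betw (pos j) {..<h j} {..<h j}" by (rule b)
  show "i < h j * r j \<Longrightarrow> pos (Suc j) i = p j (i mod r j) + pos j (i div r j)" using *[OF b] by blast
qed

lemma pos_lt: "i < h j \<Longrightarrow> pos j i < h j"
  using pos_bij[of j] by (auto simp: bij_betw_def)

lemma e_lt: "P < h j \<Longrightarrow> e j P < h j"
  using bij_betw_inv_into[OF pos_bij[of j]] by (auto simp: e_def bij_betw_def)

lemma pos_e: "P < h j \<Longrightarrow> pos j (e j P) = P"
  using bij_betw_inv_into_right[OF pos_bij[of j]] by (simp add: e_def)

lemma e_pos: "i < h j \<Longrightarrow> e j (pos j i) = i"
  using bij_betw_inv_into_left[OF pos_bij[of j]] by (simp add: e_def)

lemma idx_ivl: "0 \<le> x \<Longrightarrow> idx j x = i \<longleftrightarrow> x \<in> ivl j i"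
proof -
  assume x: "0 \<le> x"
  have "0 \<le> x / w j" using x w_pos[of j] by simp
  then have "idx j x = i \<longleftrightarrow> \<lfloor>x / w j\<rfloor> = int i" unfolding idx_def by (auto simp: nat_eq_iff)
  also have "\<dots> \<longleftrightarrow> real i \<le> x / w j \<and> x / w j < real i + 1" by (simp add: floor_eq_iff)
  also have "\<dots> \<longleftrightarrow> x \<in> ivl j i" using w_pos[of j] by (simp add: ivl_def field_simps)
  finally show ?thesis .
qed

lemma ivl_nonneg: "x \<in> ivl j i \<Longrightarrow> 0 \<le> x"
  using w_pos[of j] by (auto simp: ivl_def intro: order_trans[rotated])

lemma X_eq: "X j = {0..<real (h j) * w j}"
proof -
  have "x \<in> X j \<longleftrightarrow> x \<in> {0..<real (h j) * w j}" for x
  proof (cases "0 \<le> x")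
    case True
    then have "0 \<le> \<lfloor>x / w j\<rfloor>" using w_pos[of j] by simp
    then have "idx j x < h j \<longleftrightarrow> \<lfloor>x / w j\<rfloor> < int (h j)" unfolding idx_def by linarith
    also have "\<dots> \<longleftrightarrow> x / w j < real (h j)" by (simp add: floor_less_iff)
    also have "\<dots> \<longleftrightarrow> x < real (h j) * w j" using w_pos[of j] by (rule pos_divide_less_eq)
    finally show ?thesis using True by (simp add: X_def)
  qed (simp add: X_def)
  then show ?thesis by blast
qed

lemma idx_Suc: "0 \<le> x \<Longrightarrow> idx j x = idx (Suc j) x div r j"
proof -
  assume x: "0 \<le> x"
  have "x / w j = (x / w (Suc j)) / real_of_int (int (r j))" using w_pos[of j] r_ge(2)[of j] by (simp add: field_simps)
  then have "\<lfloor>x / w j\<rfloor> = \<lfloor>x / w (Suc j)\<rfloor> div int (r j)"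
    by (simp only: floor_divide_real_eq_div[OF of_nat_0_le_iff])
  then show ?thesis using x w_pos[of "Suc j"] unfolding idx_def
    by (simp add: nat_div_distrib del: w.simps)
qed

lemma X_Suc: "X j \<subseteq> X (Suc j)" and idx_Suc_lt: "x \<in> X j \<Longrightarrow> idx (Suc j) x < h j * r j"
proof -
  have *: "idx (Suc j) x < h j * r j" if "x \<in> X j" for x
    using that idx_Suc[of x j] r_ge(2)[of j] by (simp add: X_def div_less_iff_less_mult)
  then show "X j \<subseteq> X (Suc j)" using hr_le[of j] by (auto simp: X_def simp del: h.simps intro: less_le_trans)
  show "x \<in> X j \<Longrightarrow> idx (Suc j) x < h j * r j" by (rule *)
qed

lemma X_mono: "j \<le> k \<Longrightarrow> X j \<subseteq> X k"
  by (rule lift_Suc_mono_le[of X]) (auto intro: subsetD[OF X_Suc])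

lemma Pos_Suc: "x \<in> X j \<Longrightarrow> Pos (Suc j) x = p j (idx (Suc j) x mod r j) + Pos j x"
  using pos_Suc[OF idx_Suc_lt] idx_Suc[of x j] by (simp add: Pos_def X_def)

lemma Pos_lt: "x \<in> X j \<Longrightarrow> Pos j x < h j"
  by (simp add: X_def Pos_def pos_lt)

lemma Pos_Suc_bound: "x \<in> X j \<Longrightarrow> 2 * Pos (Suc j) x < h (Suc j)" "x \<in> X j \<Longrightarrow> 1 \<le> Pos (Suc j) x"
  using copy_bound[of "idx (Suc j) x mod r j" j "Pos j x"] Pos_lt[of x j] r_ge(2)[of j]
    Pos_Suc[of x j] p_pos[of j "idx (Suc j) x mod r j"] by auto

lemma Pos_Suc_less: "x \<in> X j \<Longrightarrow> Suc (Pos (Suc j) x) < h (Suc j)"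
  using Pos_Suc_bound[of x j] by linarith

text \<open>Each stage at least doubles the total length: the height gains the factor
  \<open>2 * q * 3 ^ r j\<close> while the width loses only the factor \<open>r j\<close>. Hence the
  sets \<open>X j\<close> exhaust the half-line.\<close>

lemma hw_ge: "w0 * 2 ^ j \<le> real (h j) * w j"
proof (induction j)
  case (Suc j)
  have "r j \<le> 3 ^ r j" by (rule less_imp_le[OF less_le_trans[OF less_exp power_mono]]) auto
  then have "real (r j) \<le> 3 ^ r j" by (metis of_nat_le_iff of_nat_numeral of_nat_power)
  then have "1 * real (r j) \<le> real q * 3 ^ r j" using q by (intro mult_mono) auto
  then have 1: "2 \<le> 2 * real q * 3 ^ r j / real (r j)" using r_ge(2)[of j] by (simp add: field_simps)
  have "w0 * 2 ^ Suc j = 2 * (w0 * 2 ^ j)" by simp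
  also have "\<dots> \<le> (2 * real q * 3 ^ r j / real (r j)) * (real (h j) * w j)"
    by (rule mult_mono[OF 1 Suc]) (use w0 in auto)
  also have "\<dots> = real (h (Suc j)) * w (Suc j)" by (simp add: r_def)
  finally show ?case .
qed simp

lemma X_UN: "(\<Union>j. X j) = {0..}"
proof
  show "(\<Union>j. X j) \<subseteq> {0..}" by (auto simp: X_def)
  show "{0..} \<subseteq> (\<Union>j. X j)"
  proof
    fix x :: real assume x: "x \<in> {0..}"
    obtain j where "x / w0 < 2 ^ j" using real_arch_pow[of 2 "x / w0"] by auto
    then have "x < w0 * 2 ^ j" using w0 by (simp add: field_simps)
    then have "x \<in> X j" using x hw_ge[of j] by (auto simp: X_eq)
    then show "x \<in> (\<Union>j. X j)" by (rule UN_I[OF UNIV_I])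
  qed
qed

text \<open>A point of \<open>X j\<close> is neither at the bottom nor at the top of the next tower.
  This makes \<open>S\<close> defined everywhere and onto.\<close>

lemma ex_interior: "0 \<le> x \<Longrightarrow> \<exists>j. x \<in> X j \<and> Suc (Pos j x) < h j \<and> 1 \<le> Pos j x"
proof -
  assume "0 \<le> x"
  then obtain j where "x \<in> X j" using X_UN by blast
  then show ?thesis using Pos_Suc_less[of x j] Pos_Suc_bound[of x j] X_Suc[of j] by blast
qed

section \<open>The map of the half-line and its iterates\<close>

lemma mv:
  assumes "x \<in> X j" "P < h j"
  shows "mv j P x \<in> X j" "Pos j (mv j P x) = P" "idx j (mv j P x) = e j P"
    "mv j P x - real (idx j (mv j P x)) * w j = x - real (idx j x) * w j"
proof -
  have "x \<in> ivl j (idx j x)" using assms(1) idx_ivl[of x j] by (auto simp: X_def)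
  then have i: "mv j P x \<in> ivl j (e j P)" by (simp add: mv_def ivl_def algebra_simps)
  then show 1: "idx j (mv j P x) = e j P" using idx_ivl ivl_nonneg by blast
  show "mv j P x \<in> X j" using ivl_nonneg[OF i] 1 e_lt[OF assms(2)] by (simp add: X_def)
  show "Pos j (mv j P x) = P" using 1 pos_e[OF assms(2)] by (simp add: Pos_def)
  show "mv j P x - real (idx j (mv j P x)) * w j = x - real (idx j x) * w j" unfolding 1 by (simp add: mv_def)
qed

lemma mv_self: "x \<in> X j \<Longrightarrow> mv j (Pos j x) x = x"
  by (simp add: mv_def Pos_def e_pos X_def)

lemma mv_mv: "x \<in> X j \<Longrightarrow> P < h j \<Longrightarrow> mv j Q (mv j P x) = mv j Q x"
  using mv[of x j P] by (simp add: mv_def)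

text \<open>Consistency of the stages: all levels of stage \<open>j\<close> are cut in the same way,
  so moving between two of them within a column is the same translation at both stages.\<close>

lemma mv_Suc:
  assumes x: "x \<in> X j" and P: "P < h j"
  shows "mv (Suc j) (p j (idx (Suc j) x mod r j) + P) x = mv j P x"
proof -
  let ?a = "idx (Suc j) x mod r j"
  let ?i = "e j P * r j + ?a"
  have a: "?a < r j" using r_ge(2)[of j] by simp
  have "?i < (e j P + 1) * r j" using a by simp
  also have "\<dots> \<le> h j * r j" using e_lt[OF P] by (intro mult_le_mono1) simp
  finally have i: "?i < h j * r j" .
  have "pos (Suc j) ?i = p j ?a + P" using pos_Suc[OF i] a pos_e[OF P] by simp
  moreover have "?i < h (Suc j)" using i hr_le[of j] by linarith
  ultimately have ei: "e (Suc j) (p j ?a + P) = ?i" using e_pos by metis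
  have "idx (Suc j) x = idx j x * r j + ?a" using idx_Suc[of x j] x div_mult_mod_eq[of "idx (Suc j) x" "r j"] by (simp add: X_def)
  then have "real (idx (Suc j) x) = real (idx j x) * real (r j) + real ?a" by (metis of_nat_add of_nat_mult)
  moreover have "w j = real (r j) * w (Suc j)" using r_ge(2)[of j] by simp
  ultimately show ?thesis unfolding mv_def ei by (simp add: algebra_simps del: w.simps)
qed

lemma mv_step_mono:
  assumes "x \<in> X j" "Suc (Pos j x) < h j" "j \<le> k"
  shows "x \<in> X k \<and> Suc (Pos k x) < h k \<and> mv k (Suc (Pos k x)) x = mv j (Suc (Pos j x)) x"
  using assms(3)
proof (induction k rule: dec_induct)
  case (step k)
  then show ?case using X_Suc[of k] Pos_Suc_less[of x k] mv_Suc[of x k "Suc (Pos k x)"] Pos_Suc[of x k]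
    by (auto simp del: h.simps)
qed (use assms in auto)

lemma S_eq:
  assumes "x \<in> X j" "Suc (Pos j x) < h j"
  shows "S x = mv j (Suc (Pos j x)) x"
proof -
  let ?k = "LEAST j. x \<in> X j \<and> Suc (Pos j x) < h j"
  have "x \<in> X ?k \<and> Suc (Pos ?k x) < h ?k" by (rule LeastI[of _ j]) (use assms in auto)
  moreover have "?k \<le> j" by (rule Least_le) (use assms in auto)
  ultimately show ?thesis using mv_step_mono[of x ?k j] by (simp add: S_def Let_def)
qed

lemma S_iter:
  assumes "x \<in> X j" "Pos j x + n < h j"
  shows "(S ^^ n) x = mv j (Pos j x + n) x"
  using assms(2)
proof (induction n)
  case 0 then show ?case using mv_self[OF assms(1)] by simp
next
  case (Suc n)
  then have IH: "(S ^^ n) x = mv j (Pos j x + n) x" by simp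
  have m: "(S ^^ n) x \<in> X j" "Pos j ((S ^^ n) x) = Pos j x + n"
    unfolding IH using mv[OF assms(1), of "Pos j x + n"] Suc.prems by auto
  then have "S ((S ^^ n) x) = mv j (Pos j x + Suc n) ((S ^^ n) x)" using S_eq[OF m(1)] Suc.prems by simp
  also have "\<dots> = mv j (Pos j x + Suc n) x" unfolding IH using mv_mv[OF assms(1), of "Pos j x + n"] Suc.prems by simp
  finally show ?case by simp
qed

lemma S_bij: "bij_betw S {0..} {0..}"
proof -
  have nn: "S x \<in> {0..}" if x: "x \<in> {0..}" for x
  proof -
    obtain j where "x \<in> X j" "Suc (Pos j x) < h j" using ex_interior[of x] x by auto
    then show ?thesis using S_eq[of x j] mv(1)[of x j "Suc (Pos j x)"] by (auto simp: X_def)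
  qed
  have inj: "inj_on S {0..}"
  proof (rule inj_onI)
    fix x y assume xy: "x \<in> {0..}" "y \<in> {0..}" "S x = S y"
    obtain j where j: "x \<in> X j" "Suc (Pos j x) < h j" using ex_interior[of x] xy by auto
    obtain k where k: "y \<in> X k" "Suc (Pos k y) < h k" using ex_interior[of y] xy by auto
    define l where "l = max j k"
    have l: "x \<in> X l" "Suc (Pos l x) < h l" "y \<in> X l" "Suc (Pos l y) < h l"
      using mv_step_mono[OF j, of l] mv_step_mono[OF k, of l] by (auto simp: l_def)
    have eq: "mv l (Suc (Pos l x)) x = mv l (Suc (Pos l y)) y" using S_eq[OF l(1,2)] S_eq[OF l(3,4)] xy(3) by simp
    then have P: "Pos l x = Pos l y" using mv(2)[OF l(1,2)] mv(2)[OF l(3,4)] by simp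
    have "x = mv l (Pos l x) (mv l (Suc (Pos l x)) x)" using mv_mv[OF l(1,2)] mv_self[OF l(1)] by simp
    also have "\<dots> = mv l (Pos l y) (mv l (Suc (Pos l y)) y)" using P eq by simp
    also have "\<dots> = y" using mv_mv[OF l(3,4)] mv_self[OF l(3)] by simp
    finally show "x = y" .
  qed
  have "y \<in> S ` {0..}" if y: "y \<in> {0..}" for y
  proof -
    obtain j where j: "y \<in> X j" "1 \<le> Pos j y" using ex_interior[of y] y by auto
    define x where "x = mv j (Pos j y - 1) y"
    have P: "Pos j y < h j" by (rule Pos_lt[OF j(1)])
    have x: "x \<in> X j" "Pos j x = Pos j y - 1" unfolding x_def using mv[OF j(1), of "Pos j y - 1"] P by auto
    have "S x = mv j (Pos j y) x" using S_eq[OF x(1)] x(2) j(2) P by simp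
    also have "\<dots> = y" unfolding x_def using mv_mv[OF j(1), of "Pos j y - 1"] mv_self[OF j(1)] P by simp
    finally show ?thesis using x(1) by (auto simp: X_def)
  qed
  then show ?thesis using nn inj by (auto simp: bij_betw_def)
qed

lemma level_eq: "P < h j \<Longrightarrow> {x \<in> X j. Pos j x = P} = ivl j (e j P)"
proof -
  assume P: "P < h j"
  have "x \<in> X j \<and> Pos j x = P \<longleftrightarrow> x \<in> ivl j (e j P)" for x
  proof
    assume x: "x \<in> X j \<and> Pos j x = P"
    then have "idx j x = e j P" using e_pos[of "idx j x" j] by (auto simp: X_def Pos_def)
    then show "x \<in> ivl j (e j P)" using x idx_ivl by (auto simp: X_def)
  next
    assume x: "x \<in> ivl j (e j P)"
    then have "idx j x = e j P" using idx_ivl ivl_nonneg by blast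
    then show "x \<in> X j \<and> Pos j x = P" using ivl_nonneg[OF x] e_lt[OF P] pos_e[OF P] by (simp add: X_def Pos_def)
  qed
  then show ?thesis by blast
qed

lemma mv_level: "P < h j \<Longrightarrow> Q < h j \<Longrightarrow> mv j Q ` ivl j (e j P) = ivl j (e j Q)"
proof -
  have *: "mv j Q ` ivl j (e j P) \<subseteq> ivl j (e j Q)" if "P < h j" "Q < h j" for P Q
    using mv[of _ j Q] that by (auto simp flip: level_eq)
  assume PQ: "P < h j" "Q < h j"
  show ?thesis
  proof
    show "ivl j (e j Q) \<subseteq> mv j Q ` ivl j (e j P)"
    proof
      fix y assume y: "y \<in> ivl j (e j Q)"
      then have y': "y \<in> X j" "Pos j y = Q" using level_eq[OF PQ(2)] by auto
      have "mv j P y \<in> ivl j (e j P)" using * PQ y by blast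
      moreover have "mv j Q (mv j P y) = y" using mv_mv[OF y'(1) PQ(1)] mv_self[OF y'(1)] y'(2) by simp
      ultimately show "y \<in> mv j Q ` ivl j (e j P)" by (metis image_eqI)
    qed
  qed (use * PQ in auto)
qed

lemma S_level: "P + n < h j \<Longrightarrow> (S ^^ n) ` ivl j (e j P) = ivl j (e j (P + n))"
proof -
  assume P: "P + n < h j"
  have "(S ^^ n) ` ivl j (e j P) = mv j (P + n) ` ivl j (e j P)"
    by (rule image_cong) (use P S_iter[of _ j n] in \<open>auto simp flip: level_eq\<close>)
  also have "\<dots> = ivl j (e j (P + n))" using P by (intro mv_level) auto
  finally show ?thesis .
qed

text \<open>\<open>S\<close> is a translation on each level below a top level, and these countably
  many intervals cover the half-line.\<close>

lemma S_piso: "piso lebesgue lebesgue {0..} {0..} S"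
proof -
  define L where "L = (\<lambda>(j, P). if Suc P < h j then ivl j (e j P) else {})"
  have "piso lebesgue lebesgue (L i) (S ` L i) S" for i
  proof (cases i)
    case (Pair j P)
    show ?thesis
    proof (cases "Suc P < h j")
      case True
      define c where "c = (real (e j (Suc P)) - real (e j P)) * w j"
      have L: "L i = ivl j (e j P)" using True by (simp add: L_def Pair)
      have m: "ivl j (e j P) \<in> sets lebesgue" by (simp add: ivl_def)
      have S: "S x = x + c" if "x \<in> ivl j (e j P)" for x
      proof -
        have x: "x \<in> X j" "Pos j x = P" using that True by (auto simp flip: level_eq)
        have "idx j x = e j P" using that idx_ivl ivl_nonneg by blast
        then show ?thesis using S_eq[OF x(1)] x(2) True by (simp add: mv_def c_def algebra_simps)
      qed
      then have "S ` ivl j (e j P) = (\<lambda>x. x + c) ` ivl j (e j P)" by (intro image_cong) auto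
      then show ?thesis unfolding L using piso_cong[OF piso_translation[OF m, of c], of S] S by simp
    qed (simp add: L_def Pair piso_empty)
  qed
  moreover have U: "(\<Union>i. L i) = {0..}"
  proof
    show "(\<Union>i. L i) \<subseteq> {0..}" using ivl_nonneg by (force simp: L_def split: if_splits)
    show "{0..} \<subseteq> (\<Union>i. L i)"
    proof
      fix x :: real assume "x \<in> {0..}"
      then obtain j where j: "x \<in> X j" "Suc (Pos j x) < h j" using ex_interior[of x] by auto
      then have "x \<in> ivl j (e j (Pos j x))" using level_eq[of "Pos j x" j] by auto
      then show "x \<in> (\<Union>i. L i)" using j by (intro UN_I[of "(j, Pos j x)"]) (auto simp: L_def)
    qed
  qed
  ultimately have "piso lebesgue lebesgue (\<Union>i. L i) (S ` (\<Union>i. L i)) S"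
    by (intro piso_countable_UN) (use S_bij in \<open>simp_all only: U bij_betw_def\<close>)
  then show ?thesis unfolding U using S_bij by (simp add: bij_betw_def)
qed

section \<open>Rarity of returns\<close>

text \<open>Column \<open>a\<close>, that is, the part of \<open>X j\<close> placed at height
  \<open>p j a\<close> in the next tower.\<close>

definition copy :: "nat \<Rightarrow> nat \<Rightarrow> real set" where
  "copy j a = (\<Union>i<h j. ivl (Suc j) (i * r j + a))"

lemma copy_measure: "copy j a \<in> lmeasurable" "measure lebesgue (copy j a) \<le> w0 / (real q * real (Suc j))"
proof -
  have m: "ivl k i \<in> lmeasurable" "measure lebesgue (ivl k i) = w k" for k i
  proof -
    have "emeasure lebesgue (ivl k i) = ennreal (w k)" using w_pos[of k] by (simp add: ivl_def algebra_simps)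
    moreover have "ivl k i \<in> sets lebesgue" by (simp add: ivl_def)
    ultimately show "ivl k i \<in> lmeasurable" "measure lebesgue (ivl k i) = w k"
      using w_pos[of k] by (auto intro: fmeasurableI simp: measure_def)
  qed
  show "copy j a \<in> lmeasurable" unfolding copy_def using m by (intro fmeasurable.finite_UN) auto
  have "measure lebesgue (copy j a) \<le> (\<Sum>i<h j. measure lebesgue (ivl (Suc j) (i * r j + a)))"
    unfolding copy_def using m by (intro measure_UNION_le) auto
  also have "\<dots> = real (h j) * w (Suc j)" by (simp only: m sum_constant card_lessThan)
  also have "\<dots> = w j / (real q * real (Suc j))" 
  proof -
    have "real (r j) = real (h j) * (real q * real (Suc j))" by (simp add: r_def algebra_simps)
    moreover have "real (h j) \<noteq> 0" using h_pos[of j] by simp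
    ultimately show ?thesis by simp
  qed
  also have "\<dots> \<le> w0 / (real q * real (Suc j))" using w_le[of j] q by (intro divide_right_mono) auto
  finally show "measure lebesgue (copy j a) \<le> w0 / (real q * real (Suc j))" .
qed

lemma copy_iff: "x \<in> X j \<Longrightarrow> idx (Suc j) x mod r j = a \<Longrightarrow> x \<in> copy j a"
proof -
  assume x: "x \<in> X j" and a: "idx (Suc j) x mod r j = a"
  then have "idx (Suc j) x = idx j x * r j + a"
    using idx_Suc[of x j] div_mult_mod_eq[of "idx (Suc j) x" "r j"] by (simp add: X_def)
  then have "x \<in> ivl (Suc j) (idx j x * r j + a)" using idx_ivl[of x] x by (auto simp: X_def)
  then show ?thesis using x by (auto simp: copy_def X_def)
qed

text \<open>Copies lie in the lower half of the next tower, so \<open>n\<close> steps with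
  \<open>2 * n \<le> h (Suc j)\<close> do not carry a point of \<open>X j\<close> out at the top,
  and heights simply add up.\<close>

lemma return_pos:
  assumes "x \<in> X j" "(S ^^ n) x \<in> X j" "2 * n \<le> h (Suc j)"
  shows "p j (idx (Suc j) x mod r j) + Pos j x + n
    = p j (idx (Suc j) ((S ^^ n) x) mod r j) + Pos j ((S ^^ n) x)"
proof -
  have x: "x \<in> X (Suc j)" using assms X_Suc by blast
  have lt: "Pos (Suc j) x + n < h (Suc j)" using Pos_Suc_bound(1)[OF assms(1)] assms(3) by linarith
  have "Pos (Suc j) ((S ^^ n) x) = Pos (Suc j) x + n" using S_iter[OF x lt] mv(2)[OF x lt] by simp
  then show ?thesis using Pos_Suc[OF assms(1)] Pos_Suc[OF assms(2)] by simp
qed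

text \<open>The mechanism behind all return estimates. A start and a return below height
  \<open>k \<le> n\<close> in the same column would differ in height by less than \<open>n\<close>,
  so the column has to change. The Sidon property then forces all returning points to start in one
  common column, whose measure is small.\<close>

lemma return_bound:
  assumes "2 * n \<le> h (Suc j)" "k \<le> n"
  shows "\<exists>a. {x \<in> X j. Pos j x < k \<and> (S ^^ n) x \<in> X j \<and> Pos j ((S ^^ n) x) < k} \<subseteq> copy j a"
proof -
  let ?A = "{x \<in> X j. Pos j x < k \<and> (S ^^ n) x \<in> X j \<and> Pos j ((S ^^ n) x) < k}"
  show ?thesis
  proof (cases "?A = {}")
    case False
    then obtain x where x: "x \<in> ?A" by blast
    have "?A \<subseteq> copy j (idx (Suc j) x mod r j)"
    proof
      fix y assume y: "y \<in> ?A"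
      have 1: "p j (idx (Suc j) x mod r j) + Pos j x + n
        = p j (idx (Suc j) ((S ^^ n) x) mod r j) + Pos j ((S ^^ n) x)"
        using x assms(1) by (intro return_pos) auto
      have 2: "p j (idx (Suc j) y mod r j) + Pos j y + n
        = p j (idx (Suc j) ((S ^^ n) y) mod r j) + Pos j ((S ^^ n) y)"
        using y assms(1) by (intro return_pos) auto
      have "idx (Suc j) x mod r j \<noteq> idx (Suc j) ((S ^^ n) x) mod r j"
        using 1 x assms(2) by auto
      then have "idx (Suc j) x mod r j = idx (Suc j) y mod r j"
        using p_sidon[OF 1 2] Pos_lt x y by auto
      then show "y \<in> copy j (idx (Suc j) x mod r j)" using y by (intro copy_iff) auto
    qed
    then show ?thesis by blast
  qed auto
qed

lemma return_bound_X:
  assumes "h (Suc i) < 2 * n"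
  shows "\<exists>j a. i < j \<and> {x \<in> X i. (S ^^ n) x \<in> X i} \<subseteq> copy j a"
proof -
  have mono: "h j \<le> h (Suc j)" for j using hr_le[of j] r_ge(2)[of j] by (metis le_trans mult_le_mono2 mult_1_right)
  have big: "Suc j \<le> h (Suc j)" for j
    using r_ge(1)[of j] hr_le[of j] h_pos[of j] by (metis le_trans mult_1 mult_le_mono1)
  \<comment> \<open>The first stage such that \<open>2 * n\<close> is at most the height of the next
    tower. Minimality gives \<open>h j < 2 * n\<close>; points of the preceding stage lie in the
    lower half of tower \<open>j\<close>, hence below height \<open>n\<close>, and the return bound
    applies with \<open>k = n\<close>.\<close>
  define j where "j = (LEAST j. 2 * n \<le> h (Suc j))"
  have "2 * n \<le> h (Suc (2 * n))" using big[of "2 * n"] by linarith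
  then have j1: "2 * n \<le> h (Suc j)" unfolding j_def by (rule LeastI)
  have hm: "h a \<le> h b" if "a \<le> b" for a b using lift_Suc_mono_le[of h, OF mono that] .
  have ij: "i < j"
  proof (rule ccontr)
    assume "\<not> i < j"
    then have "h (Suc j) \<le> h (Suc i)" by (intro hm) simp
    then show False using j1 assms by linarith
  qed
  then obtain k where k: "j = Suc k" by (cases j) auto
  have "\<not> 2 * n \<le> h (Suc k)" using not_less_Least[of k "\<lambda>j. 2 * n \<le> h (Suc j)"] k by (simp add: j_def)
  then have j2: "h j < 2 * n" using k by simp
  obtain a where a: "{x \<in> X j. Pos j x < n \<and> (S ^^ n) x \<in> X j \<and> Pos j ((S ^^ n) x) < n} \<subseteq> copy j a"
    using return_bound[OF j1 order_refl] by blast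
  have "X i \<subseteq> X k" using ij k by (intro X_mono) simp
  moreover have "x \<in> X j \<and> Pos j x < n" if "x \<in> X k" for x
    using Pos_Suc_bound(1)[OF that] X_Suc[of k] that j2 k by auto
  ultimately have "{x \<in> X i. (S ^^ n) x \<in> X i} \<subseteq> copy j a" using a by blast
  then show ?thesis using ij by blast
qed

lemma X0: "X 0 = {0..<w0}"
  by (simp add: X_eq)

text \<open>For small \<open>n\<close> the return bound applies with \<open>k = 1\<close>, because
  the tower of stage 0 is a single level. For larger \<open>n\<close> the bound for general stages
  takes over.\<close>

lemma return_X0:
  assumes "1 \<le> n"
  shows "\<exists>j a. {x \<in> X 0. (S ^^ n) x \<in> X 0} \<subseteq> copy j a"
proof (cases "2 * n \<le> h 1")
  case True
  obtain a where "{x \<in> X 0. Pos 0 x < 1 \<and> (S ^^ n) x \<in> X 0 \<and> Pos 0 ((S ^^ n) x) < 1} \<subseteq> copy 0 a"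
    using return_bound[of n 0 1] True assms by auto
  moreover have "Pos 0 x < 1" if "x \<in> X 0" for x using Pos_lt[OF that] by simp
  ultimately show ?thesis by blast
next
  case False then show ?thesis using return_bound_X[of 0 n] by auto
qed

text \<open>Distinct heights \<open>p 0 a\<close> differ by at least \<open>2 * q\<close>, and stage
  0 has a single level, so \<open>n \<le> q\<close> steps are too few for a change of
  column.\<close>

lemma no_return_X0:
  assumes "1 \<le> n" "n \<le> q"
  shows "{x \<in> X 0. (S ^^ n) x \<in> X 0} = {}"
proof -
  have False if x: "x \<in> X 0" "(S ^^ n) x \<in> X 0" for x
  proof -
    have "q * 1 \<le> q * 3 ^ (q * Suc 0 * h 0)" by (intro mult_le_mono) auto
    moreover have "h (Suc 0) = 2 * (q * 3 ^ (q * Suc 0 * h 0))" by simp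
    ultimately have "2 * n \<le> h (Suc 0)" using assms(2) by linarith
    then have eq: "p 0 (idx (Suc 0) x mod r 0) + n = p 0 (idx (Suc 0) ((S ^^ n) x) mod r 0)"
      using return_pos[OF x] Pos_lt[OF x(1)] Pos_lt[OF x(2)] by simp
    define a b where "a = idx (Suc 0) x mod r 0" and "b = idx (Suc 0) ((S ^^ n) x) mod r 0"
    have e: "q * 3 ^ a + n = q * 3 ^ b" using eq by (simp add: p_def a_def b_def)
    then have "q * 3 ^ a < q * 3 ^ b" using assms by linarith
    then have "a < b" by simp
    then have "(3::nat) ^ Suc a \<le> 3 ^ b" by (intro power_increasing) auto
    then have "q * 3 ^ Suc a \<le> q * 3 ^ b" by (rule mult_le_mono2)
    moreover have "q * 1 \<le> q * 3 ^ a" by (intro mult_le_mono) auto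
    moreover have "q * 3 ^ Suc a = 3 * (q * 3 ^ a)" by simp
    ultimately show False using e assms q by linarith
  qed
  then show ?thesis by blast
qed

section \<open>Approximation by levels, and mixing of the model\<close>

lemma tail_measure:
  assumes D: "D \<in> lmeasurable" "D \<subseteq> {0..}"
  shows "(\<lambda>j. measure lebesgue (D - X j)) \<longlonglongrightarrow> 0"
proof -
  have Xm: "X j \<in> sets lebesgue" for j by (simp add: X_eq)
  have "(\<lambda>j. measure lebesgue (D - X j)) \<longlonglongrightarrow> measure lebesgue (\<Inter>j. D - X j)"
  proof (rule Lim_measure_decseq)
    show "decseq (\<lambda>j. D - X j)" using X_mono by (auto simp: decseq_def)
    show "emeasure lebesgue (D - X i) \<noteq> \<infinity>" for i
      using fmeasurableD2[OF fmeasurable_Diff[OF D(1) Xm[of i]]] by simp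
  qed (use D Xm in auto)
  moreover have "(\<Inter>j. D - X j) = {}" using D(2) X_UN by blast
  ultimately show ?thesis by (simp only: measure_empty)
qed

text \<open>A compact \<open>K\<close> approximates \<open>B\<close> from within. The intervals of
  stage \<open>j\<close> that meet \<open>K\<close> cover it and stay in its closed neighbourhood of
  radius \<open>w j\<close>, whose measure tends to that of \<open>K\<close>. All late stages work,
  so several sets can be treated at one stage.\<close>

lemma approx_levels:
  assumes B: "B \<in> lmeasurable" "B \<subseteq> {0..}" and \<epsilon>: "0 < \<epsilon>"
  shows "\<exists>J. \<forall>j\<ge>J. \<exists>I\<subseteq>{..<h j}. measure lebesgue (sym_diff B (\<Union>i\<in>I. ivl j i)) < \<epsilon>"
proof -
  have Xm: "X j \<in> sets lebesgue" for j by (simp add: X_eq)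
  have "\<forall>\<^sub>F j in sequentially. measure lebesgue (B - X j) < \<epsilon> / 3"
    by (rule order_tendstoD(2)[OF tail_measure[OF B]]) (use \<epsilon> in simp)
  then obtain m where m: "measure lebesgue (B - X m) < \<epsilon> / 3" by (auto simp: eventually_sequentially)
  have "B \<inter> X m \<in> sets lebesgue" using B Xm by auto
  then obtain K where K: "closed K" "K \<subseteq> B \<inter> X m" "B \<inter> X m - K \<in> lmeasurable"
      "emeasure lebesgue (B \<inter> X m - K) < ennreal (\<epsilon> / 3)"
    using sets_lebesgue_inner_closed[of "B \<inter> X m" "\<epsilon> / 3"] \<epsilon> by auto
  have m2: "measure lebesgue (B \<inter> X m - K) < \<epsilon> / 3"
    using K(3,4) \<epsilon> by (simp add: emeasure_eq_measure2 ennreal_less_iff)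
  have Kl: "K \<in> lmeasurable" by (rule fmeasurableI2[OF B(1)]) (use K in auto)
  have Bd: "B - X m \<in> lmeasurable" using B Xm by (intro fmeasurable_Diff)
  show ?thesis
  proof (cases "K = {}")
    case True
    have "measure lebesgue (sym_diff B {}) \<le> measure lebesgue ((B - X m) \<union> (B \<inter> X m - K))"
      using True Bd K(3) by (intro measure_mono_fmeasurable fmeasurable.Un) (use B in auto)
    also have "\<dots> \<le> measure lebesgue (B - X m) + measure lebesgue (B \<inter> X m - K)"
      using Bd K(3) by (intro measure_Un_le) auto
    finally have "measure lebesgue (sym_diff B {}) < \<epsilon>" using m m2 \<epsilon> by linarith
    then show ?thesis by (intro exI[of _ 0] allI impI exI[of _ "{}"]) simp
  next
    case False
    define V where "V j = {x. infdist x K \<le> w j}" for j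
    have Vc: "closed (V j)" for j unfolding V_def by (intro closed_Collect_le continuous_intros)
    have VV: "x \<in> cbox (- w0) (real (h m) * w m + w0)" if "x \<in> V j" for x j
    proof -
      obtain y where y: "y \<in> K" "infdist x K = dist x y" using infdist_attains_inf[OF K(1) False, of x] by auto
      then have "\<bar>x - y\<bar> \<le> w0" using that w_le[of j] by (simp add: V_def dist_real_def)
      moreover have "0 \<le> y" "y \<le> real (h m) * w m" using y K(2) by (auto simp: X_eq)
      ultimately show ?thesis by auto
    qed
    have Vf: "V j \<in> lmeasurable" for j
    proof (rule fmeasurableI2[OF lmeasurable_cbox])
      show "V j \<subseteq> cbox (- w0) (real (h m) * w m + w0)" using VV by blast
    qed (use Vc[of j] in \<open>intro sets_completionI_sets, simp\<close>)
    have "(\<lambda>j. measure lebesgue (V j)) \<longlonglongrightarrow> measure lebesgue (\<Inter>j. V j)"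
    proof (rule Lim_measure_decseq)
      show "decseq V" using w_antimono by (auto simp: decseq_def V_def intro: order_trans)
      show "emeasure lebesgue (V i) \<noteq> \<infinity>" for i using fmeasurableD2[OF Vf[of i]] by simp
    qed (use Vf in auto)
    moreover have "(\<Inter>j. V j) = K"
    proof
      show "K \<subseteq> (\<Inter>j. V j)" using w_pos by (auto simp: V_def less_imp_le)
      show "(\<Inter>j. V j) \<subseteq> K"
      proof
        fix x assume "x \<in> (\<Inter>j. V j)"
        then have "infdist x K \<le> w j" for j by (auto simp: V_def)
        then have "infdist x K \<le> 0" using w_tendsto by (intro LIMSEQ_le_const[of w]) auto
        then have "infdist x K = 0" using infdist_nonneg[of x K] by linarith
        then show "x \<in> K" using in_closed_iff_infdist_zero[OF K(1) False] by blast
      qed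
    qed
    ultimately have "(\<lambda>j. measure lebesgue (V j)) \<longlonglongrightarrow> measure lebesgue K" by simp
    then have "\<forall>\<^sub>F j in sequentially. measure lebesgue (V j) < measure lebesgue K + \<epsilon> / 3"
      by (rule order_tendstoD(2)) (use \<epsilon> in simp)
    then obtain J0 where J0: "\<And>j. J0 \<le> j \<Longrightarrow> measure lebesgue (V j) < measure lebesgue K + \<epsilon> / 3"
      by (auto simp: eventually_sequentially)
    have "\<exists>I\<subseteq>{..<h j}. measure lebesgue (sym_diff B (\<Union>i\<in>I. ivl j i)) < \<epsilon>" if j: "max J0 m \<le> j" for j
    proof -
      define I where "I = {i. i < h j \<and> ivl j i \<inter> K \<noteq> {}}"
      define U where "U = (\<Union>i\<in>I. ivl j i)"
      have KU: "K \<subseteq> U"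
      proof
        fix x assume x: "x \<in> K"
        then have "x \<in> X j" using K(2) X_mono[of m j] j by auto
        then have "x \<in> ivl j (idx j x)" "idx j x < h j" using idx_ivl[of x j] by (auto simp: X_def)
        then show "x \<in> U" using x by (auto simp: U_def I_def)
      qed
      have UV: "U \<subseteq> V j"
      proof
        fix x assume "x \<in> U"
        then obtain i y where i: "x \<in> ivl j i" "y \<in> ivl j i" "y \<in> K" by (auto simp: U_def I_def)
        have "infdist x K \<le> dist x y" using i(3) by (rule infdist_le)
        also have "\<dots> \<le> w j" using i(1,2) by (auto simp: ivl_def dist_real_def algebra_simps)
        finally show "x \<in> V j" by (simp add: V_def)
      qed
      have fI: "finite I" by (simp add: I_def)
      have Um: "U \<in> sets lebesgue" unfolding U_def using fI by (intro sets.finite_UN) (auto simp: ivl_def)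
      have VK: "V j - K \<in> lmeasurable" using Vf Kl by (intro fmeasurable_Diff) auto
      have "K \<subseteq> V j" using KU UV by blast
      then have m3: "measure lebesgue (V j - K) < \<epsilon> / 3"
        using J0[of j] j measurable_measure_Diff[OF Vf, of K] Kl by auto
      have fm: "B - X m \<union> (B \<inter> X m - K) \<in> lmeasurable" using Bd K(3) by (rule fmeasurable.Un)
      have "measure lebesgue (sym_diff B U) \<le> measure lebesgue ((B - X m) \<union> (B \<inter> X m - K) \<union> (V j - K))"
        using KU UV K(2) B Um by (intro measure_mono_fmeasurable fmeasurable.Un[OF fm VK]) auto
      also have "\<dots> \<le> measure lebesgue ((B - X m) \<union> (B \<inter> X m - K)) + measure lebesgue (V j - K)"
        using fm VK by (intro measure_Un_le) auto
      also have "measure lebesgue ((B - X m) \<union> (B \<inter> X m - K))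
          \<le> measure lebesgue (B - X m) + measure lebesgue (B \<inter> X m - K)"
        using Bd K(3) by (intro measure_Un_le) auto
      finally have "measure lebesgue (sym_diff B U) < \<epsilon>" using m m2 m3 by linarith
      then show ?thesis by (intro exI[of _ I]) (auto simp: U_def I_def)
    qed
    then show ?thesis by blast
  qed
qed

lemma S_tower:
  assumes "finite \<B>" "\<And>B. B \<in> \<B> \<Longrightarrow> B \<in> lmeasurable \<and> B \<subseteq> {0..}" "0 < \<epsilon>"
  shows "\<exists>F H. F \<in> lmeasurable \<and> F \<subseteq> {0..} \<and> measure lebesgue F < \<epsilon> \<and>
    disjoint_family_on (\<lambda>n. (S ^^ n) ` F) {..<H} \<and>
    (\<forall>B\<in>\<B>. \<exists>Q\<subseteq>{..<H}. measure lebesgue (sym_diff B (\<Union>n\<in>Q. (S ^^ n) ` F)) < \<epsilon>)"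
proof -
  have "\<exists>J. \<forall>B\<in>\<B>. \<forall>j\<ge>J. \<exists>I\<subseteq>{..<h j}. measure lebesgue (sym_diff B (\<Union>i\<in>I. ivl j i)) < \<epsilon>"
    using assms(1,2)
  proof (induction \<B>)
    case (insert B \<B>)
    obtain J where J: "\<forall>B\<in>\<B>. \<forall>j\<ge>J. \<exists>I\<subseteq>{..<h j}. measure lebesgue (sym_diff B (\<Union>i\<in>I. ivl j i)) < \<epsilon>"
      using insert by blast
    obtain J' where J': "\<forall>j\<ge>J'. \<exists>I\<subseteq>{..<h j}. measure lebesgue (sym_diff B (\<Union>i\<in>I. ivl j i)) < \<epsilon>"
      using approx_levels[of B \<epsilon>] insert.prems assms(3) by blast
    show ?case by (rule exI[of _ "max J J'"]) (use J J' in auto)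
  qed auto
  then obtain J where J: "\<And>B j. B \<in> \<B> \<Longrightarrow> J \<le> j \<Longrightarrow>
      \<exists>I\<subseteq>{..<h j}. measure lebesgue (sym_diff B (\<Union>i\<in>I. ivl j i)) < \<epsilon>" by blast
  have "\<forall>\<^sub>F j in sequentially. w j < \<epsilon>" using order_tendstoD(2)[OF w_tendsto assms(3)] .
  then obtain J' where J': "\<And>j. J' \<le> j \<Longrightarrow> w j < \<epsilon>" by (auto simp: eventually_sequentially)
  define j where "j = max J J'"
  \<comment> \<open>The bottom level: its images are the levels in order of height, and
    \<open>pos j\<close> translates the approximating intervals into such levels.\<close>
  define F where "F = ivl j (e j 0)"
  have lev: "(S ^^ n) ` F = ivl j (e j n)" if "n < h j" for n
    unfolding F_def using S_level[of 0 n j] that by simp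
  have Fe: "emeasure lebesgue F = ennreal (w j)" using w_pos[of j] by (simp add: F_def ivl_def algebra_simps)
  have "F \<in> lmeasurable" "measure lebesgue F < \<epsilon>"
    using Fe J'[of j] w_pos[of j] by (auto intro!: fmeasurableI simp: measure_def j_def F_def ivl_def)
  moreover have "F \<subseteq> {0..}" using ivl_nonneg by (auto simp: F_def)
  moreover have "disjoint_family_on (\<lambda>n. (S ^^ n) ` F) {..<h j}"
    unfolding disjoint_family_on_def
  proof (intro ballI impI)
    fix m n assume mn: "m \<in> {..<h j}" "n \<in> {..<h j}" "m \<noteq> n"
    then have "ivl j (e j m) \<inter> ivl j (e j n) = {}"
      by (subst (1 2) level_eq[symmetric]) auto
    then show "(S ^^ m) ` F \<inter> (S ^^ n) ` F = {}" using mn lev by simp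
  qed
  moreover have "\<exists>Q\<subseteq>{..<h j}. measure lebesgue (sym_diff B (\<Union>n\<in>Q. (S ^^ n) ` F)) < \<epsilon>" if B: "B \<in> \<B>" for B
  proof -
    obtain I where I: "I \<subseteq> {..<h j}" "measure lebesgue (sym_diff B (\<Union>i\<in>I. ivl j i)) < \<epsilon>"
      using J[OF B, of j] by (auto simp: j_def)
    have "(S ^^ pos j i) ` F = ivl j i" if "i \<in> I" for i
    proof -
      have i: "i < h j" using I(1) that by auto
      show ?thesis unfolding lev[OF pos_lt[OF i]] e_pos[OF i] ..
    qed
    then have "(\<Union>n\<in>pos j ` I. (S ^^ n) ` F) = (\<Union>i\<in>I. ivl j i)" by simp
    then show ?thesis using I pos_lt by (intro exI[of _ "pos j ` I"]) auto
  qed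
  ultimately show ?thesis by blast
qed

text \<open>Up to the small parts of \<open>A\<close> and \<open>B\<close> outside
  \<open>X i\<close>, a return takes place inside \<open>X i\<close> and starts in one column. The
  covering set \<open>Z\<close> is the form in which the estimate can be pulled back along a partial
  isomorphism.\<close>

lemma S_mixing:
  assumes A: "A \<in> lmeasurable" "A \<subseteq> {0..}" and B: "B \<in> lmeasurable" "B \<subseteq> {0..}" and \<epsilon>: "0 < \<epsilon>"
  shows "\<exists>N. \<forall>n\<ge>N. \<exists>Z\<in>lmeasurable. measure lebesgue Z < \<epsilon> \<and> {x\<in>A. (S ^^ n) x \<in> B} \<subseteq> Z"
proof -
  have Sn: "piso lebesgue lebesgue {0..} {0..} (S ^^ n)" for n
  proof (induction n)
    case 0
    show ?case by (auto simp: piso_def bij_betw_def)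
  next
    case (Suc n) then show ?case using piso_comp[OF Suc S_piso] by (simp add: comp_def)
  qed
  have Xm: "X j \<in> sets lebesgue" for j by (simp add: X_eq)
  have "(\<lambda>j. w0 / real (Suc j)) \<longlonglongrightarrow> 0"
    using tendsto_mult[OF tendsto_const[of w0] LIMSEQ_inverse_real_of_nat] by (simp add: divide_inverse)
  then have "\<forall>\<^sub>F j in sequentially. measure lebesgue (A - X j) < \<epsilon> / 3 \<and> measure lebesgue (B - X j) < \<epsilon> / 3 \<and> w0 / real (Suc j) < \<epsilon> / 3"
    using \<epsilon> by (intro eventually_conj order_tendstoD(2)[OF tail_measure[OF A]] order_tendstoD(2)[OF tail_measure[OF B]] order_tendstoD(2)) auto
  then obtain i where i: "measure lebesgue (A - X i) < \<epsilon> / 3" "measure lebesgue (B - X i) < \<epsilon> / 3" "w0 / real (Suc i) < \<epsilon> / 3"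
    by (auto simp: eventually_sequentially)
  have "\<exists>Z\<in>lmeasurable. measure lebesgue Z < \<epsilon> \<and> {x\<in>A. (S ^^ n) x \<in> B} \<subseteq> Z" if n: "h (Suc i) \<le> n" for n
  proof -
    have "h (Suc i) < 2 * n" using n h_pos[of "Suc i"] by linarith
    then obtain j a where ja: "i < j" "{x \<in> X i. (S ^^ n) x \<in> X i} \<subseteq> copy j a"
      using return_bound_X by blast
    have "measure lebesgue (copy j a) \<le> w0 / (real q * real (Suc j))" by (rule copy_measure)
    also have "\<dots> \<le> w0 / (1 * real (Suc i))" using q w0 ja(1) by (intro divide_left_mono mult_mono mult_pos_pos) auto
    finally have c: "measure lebesgue (copy j a) < \<epsilon> / 3" using i(3) unfolding mult_1 by linarith
    let ?V = "(S ^^ n) -` (B - X i) \<inter> {0..}"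
    have Bi: "B - X i \<in> sets lebesgue" "B - X i \<subseteq> {0..}" using B Xm by auto
    have V: "?V \<in> sets lebesgue" "emeasure lebesgue ?V = emeasure lebesgue (B - X i)"
      using pisoD(8)[OF Sn Bi] piso_emeasure_vimage[OF Sn Bi] by auto
    have BXf: "B - X i \<in> lmeasurable" "A - X i \<in> lmeasurable" using A B Xm by (auto intro: fmeasurable_Diff)
    have Vf: "?V \<in> lmeasurable" "measure lebesgue ?V = measure lebesgue (B - X i)"
      using V BXf by (auto simp: fmeasurable_def measure_def)
    let ?Z = "copy j a \<union> (A - X i) \<union> ?V"
    have fm: "copy j a \<union> (A - X i) \<in> lmeasurable" using copy_measure(1) BXf(2) by (rule fmeasurable.Un)
    have "{x\<in>A. (S ^^ n) x \<in> B} \<subseteq> ?Z"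
    proof
      fix x assume x: "x \<in> {x\<in>A. (S ^^ n) x \<in> B}"
      then have "x \<in> {0..}" using A(2) by auto
      then show "x \<in> ?Z" using x ja(2) by blast
    qed
    moreover have "measure lebesgue ?Z \<le> measure lebesgue (copy j a \<union> (A - X i)) + measure lebesgue ?V"
      using fm Vf by (intro measure_Un_le) auto
    moreover have "measure lebesgue (copy j a \<union> (A - X i)) \<le> measure lebesgue (copy j a) + measure lebesgue (A - X i)"
      using copy_measure(1) BXf by (intro measure_Un_le) auto
    ultimately show ?thesis using fmeasurable.Un[OF fm Vf(1)] c i(1,2) Vf(2) by (intro bexI[of _ ?Z]) auto
  qed
  then show ?thesis by blast
qed

lemma S_return:
  assumes "1 \<le> n"
  shows "\<exists>Z\<in>lmeasurable. measure lebesgue Z \<le> w0 / real q \<and> {x\<in>{0..<w0}. (S ^^ n) x \<in> {0..<w0}} \<subseteq> Z"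
proof -
  obtain j a where "{x \<in> X 0. (S ^^ n) x \<in> X 0} \<subseteq> copy j a" using return_X0[OF assms] by blast
  moreover have "w0 / (real q * real (Suc j)) \<le> w0 / (real q * 1)"
    using q w0 by (intro divide_left_mono mult_mono mult_pos_pos) auto
  ultimately show ?thesis using copy_measure[of j a] unfolding X0 by (intro bexI[of _ "copy j a"]) auto
qed

lemma S_no_return: "1 \<le> n \<Longrightarrow> n \<le> q \<Longrightarrow> x \<in> {0..<w0} \<Longrightarrow> (S ^^ n) x \<notin> {0..<w0}"
  using no_return_X0[of n] unfolding X0 by blast

end

section \<open>Centralizers of mixing maps of rank one\<close>

text \<open>Rank one at precision \<open>\<epsilon>\<close> for the sets in \<open>\<B>\<close>. In
  infinite measure the tower is not asked to fill the space. The bound on the base makes the loss of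
  boundedly many levels negligible.\<close>

definition tower_approx :: "'a measure \<Rightarrow> ('a \<Rightarrow> 'a) \<Rightarrow> 'a set set \<Rightarrow> real \<Rightarrow> bool" where
  "tower_approx M f \<B> \<epsilon> \<longleftrightarrow>
     (\<exists>F\<in>fmeasurable M. \<exists>H. measure M F < \<epsilon> \<and> disjoint_family_on (\<lambda>n. (f ^^ n) ` F) {..<H} \<and>
        (\<forall>B\<in>\<B>. \<exists>Q\<subseteq>{..<H}. measure M (sym_diff B (\<Union>n\<in>Q. (f ^^ n) ` F)) < \<epsilon>))"

definition mixing_map :: "'a measure \<Rightarrow> ('a \<Rightarrow> 'a) \<Rightarrow> bool" where
  "mixing_map M f \<longleftrightarrow>
     (\<forall>A\<in>fmeasurable M. \<forall>B\<in>fmeasurable M. (\<lambda>n. measure M ((f ^^ n) ` A \<inter> B)) \<longlonglongrightarrow> 0)"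

lemma aut_maps_funpow: "f \<in> aut_maps M \<Longrightarrow> f ^^ n \<in> aut_maps M"
  by (induction n) (simp_all add: aut_maps_id aut_maps_comp)

lemma fmeasurable_subset_space: "A \<in> fmeasurable M \<Longrightarrow> A \<subseteq> space M"
  by (meson fmeasurableD sets.sets_into_space)

lemma aut_image_fmeasurable:
  assumes "f \<in> aut_maps M" "A \<in> fmeasurable M"
  shows "f ` A \<in> fmeasurable M" "measure M (f ` A) = measure M A"
proof -
  have "A \<in> sets M" "emeasure M A < \<infinity>" using assms(2) by (auto simp: fmeasurable_def)
  then show "f ` A \<in> fmeasurable M" "measure M (f ` A) = measure M A"
    using aut_image[OF assms(1), of A] by (auto simp: fmeasurable_def measure_def)
qed

lemma aut_image_set_ops:
  assumes "f \<in> aut_maps M" "A \<subseteq> space M" "B \<subseteq> space M"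
  shows "f ` (A \<inter> B) = f ` A \<inter> f ` B" "f ` (A - B) = f ` A - f ` B"
    "f ` (sym_diff A B) = sym_diff (f ` A) (f ` B)"
proof -
  have i: "inj_on f (space M)" using aut_mapsD(1)[OF assms(1)] by (simp add: bij_betw_def)
  show "f ` (A \<inter> B) = f ` A \<inter> f ` B" by (rule inj_on_image_Int[OF i assms(2,3)])
  have d: "f ` (A - B) = f ` A - f ` B" if "A \<subseteq> space M" "B \<subseteq> space M" for A B
    by (rule inj_on_image_set_diff[OF i]) (use that in auto)
  show "f ` (A - B) = f ` A - f ` B" by (rule d[OF assms(2,3)])
  show "f ` (sym_diff A B) = sym_diff (f ` A) (f ` B)"
    using d[OF assms(2,3)] d[OF assms(3,2)] by (simp only: image_Un)
qed

lemma measure_eq_null_sym_diff: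
  assumes "A \<in> sets M" "B \<in> sets M" "sym_diff A B \<in> null_sets M"
  shows "measure M A = measure M B"
proof -
  have "AE x in M. x \<in> A \<longleftrightarrow> x \<in> B" by (rule AE_I'[OF assms(3)]) auto
  then have "emeasure M A = emeasure M B" using assms(1,2) by (rule emeasure_eq_AE)
  then show ?thesis by (simp add: measure_def)
qed

lemma measure_Int_perturb:
  assumes "A \<in> fmeasurable M" "A' \<in> fmeasurable M" "B \<in> fmeasurable M" "B' \<in> fmeasurable M"
  shows "measure M (A \<inter> B) \<le> measure M (A' \<inter> B') + (measure M (sym_diff A A') + measure M (sym_diff B B'))"
proof -
  have fA: "sym_diff A A' \<in> fmeasurable M" and fB: "sym_diff B B' \<in> fmeasurable M"
    using assms by (intro fmeasurable_sym_diff; simp)+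
  have "measure M (A \<inter> B) \<le> measure M ((A' \<inter> B') \<union> (sym_diff A A' \<union> sym_diff B B'))"
    using assms by (intro measure_mono_fmeasurable fmeasurable.Un fA fB fmeasurable_Int_fmeasurable) auto
  also have "\<dots> \<le> measure M (A' \<inter> B') + measure M (sym_diff A A' \<union> sym_diff B B')"
    using assms fA fB by (intro measure_Un_le) auto
  also have "measure M (sym_diff A A' \<union> sym_diff B B') \<le> measure M (sym_diff A A') + measure M (sym_diff B B')"
    using fA fB by (intro measure_Un_le) auto
  finally show ?thesis by simp
qed

lemma measure_aut_Int_perturb:
  assumes v: "v \<in> aut_maps M" "v' \<in> aut_maps M"
    and fm: "A \<in> fmeasurable M" "A' \<in> fmeasurable M" "B \<in> fmeasurable M" "B' \<in> fmeasurable M"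
  shows "measure M (v ` A \<inter> v' ` B)
    \<le> measure M (v ` A' \<inter> v' ` B') + (measure M (sym_diff A A') + measure M (sym_diff B B'))"
proof -
  have s: "measure M (sym_diff (g ` C) (g ` D)) = measure M (sym_diff C D)"
    if "g \<in> aut_maps M" "C \<in> fmeasurable M" "D \<in> fmeasurable M" for g C D
    using aut_image_set_ops(3)[OF that(1) fmeasurable_subset_space[OF that(2)] fmeasurable_subset_space[OF that(3)]]
      aut_image_fmeasurable(2)[OF that(1) fmeasurable_sym_diff[OF that(2,3)]] by simp
  show ?thesis
    using measure_Int_perturb[of "v ` A" M "v ` A'" "v' ` B" "v' ` B'"] aut_image_fmeasurable(1)[OF v(1)]
      aut_image_fmeasurable(1)[OF v(2)] fm by (simp add: s v)
qed

text \<open>\<open>two_sided M f k A B\<close> is the measure of \<open>f\<^sup>k A \<inter> B\<close> for an integer \<open>k\<close>, written without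
  negative powers.\<close>

definition two_sided :: "'a measure \<Rightarrow> ('a \<Rightarrow> 'a) \<Rightarrow> int \<Rightarrow> 'a set \<Rightarrow> 'a set \<Rightarrow> real" where
  "two_sided M f k A B = measure M ((f ^^ nat k) ` A \<inter> (f ^^ nat (- k)) ` B)"

lemma two_sided_swap: "two_sided M f k A B = two_sided M f (- k) B A"
  by (simp add: two_sided_def Int_commute)

lemma two_sided_mixing:
  assumes "mixing_map M f" "A \<in> fmeasurable M" "B \<in> fmeasurable M" "0 < \<epsilon>"
  shows "\<exists>K. \<forall>k. K \<le> \<bar>k\<bar> \<longrightarrow> two_sided M f k A B < \<epsilon>"
proof -
  have "\<forall>\<^sub>F n in sequentially. measure M ((f ^^ n) ` A \<inter> B) < \<epsilon> \<and> measure M ((f ^^ n) ` B \<inter> A) < \<epsilon>"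
    using assms by (intro eventually_conj order_tendstoD(2)[of _ 0]) (auto simp: mixing_map_def)
  then obtain N where N: "\<And>n. N \<le> n \<Longrightarrow> measure M ((f ^^ n) ` A \<inter> B) < \<epsilon> \<and> measure M ((f ^^ n) ` B \<inter> A) < \<epsilon>"
    by (auto simp: eventually_sequentially)
  have "two_sided M f k A B < \<epsilon>" if "int N \<le> \<bar>k\<bar>" for k
  proof (cases "0 \<le> k")
    case True
    then show ?thesis using N[of "nat k"] that by (simp add: two_sided_def)
  next
    case False
    then show ?thesis using N[of "nat (- k)"] that by (simp add: two_sided_def Int_commute)
  qed
  then show ?thesis by blast
qed

section \<open>Coefficients of a commuting map on one tower\<close>

locale commuting_tower =
  fixes M :: "'a measure" and f u :: "'a \<Rightarrow> 'a" and F :: "'a set" and H :: nat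
  assumes f: "f \<in> aut_maps M" and u: "u \<in> aut_maps M" and comm: "AE x in M. u (f x) = f (u x)"
    and F: "F \<in> fmeasurable M" and disj: "disjoint_family_on (\<lambda>n. (f ^^ n) ` F) {..<H}"
begin

abbreviation L :: "nat \<Rightarrow> 'a set" where "L n \<equiv> (f ^^ n) ` F"

definition c :: "nat \<Rightarrow> nat \<Rightarrow> real" where "c m n = measure M (u ` L m \<inter> L n)"

text \<open>The common value of \<open>c m n\<close> for \<open>n - m = k\<close>; divided by
  \<open>measure M F\<close>, it is the coefficient of the \<open>k\<close>-th power of
  \<open>f\<close> in \<open>u\<close>. At most one of the two indices is nonzero.\<close>

definition \<gamma> :: "int \<Rightarrow> real" where "\<gamma> k = c (nat (- k)) (nat k)"

definition pairs :: "nat set \<Rightarrow> nat set \<Rightarrow> int \<Rightarrow> (nat \<times> nat) set" where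
  "pairs P Q k = {(m, n) \<in> P \<times> Q. int n - int m = k}"

lemma L_fm: "L n \<in> fmeasurable M" and L_measure: "measure M (L n) = measure M F"
  using aut_image_fmeasurable[OF aut_maps_funpow[OF f] F] by auto

lemma uL_fm: "u ` L n \<in> fmeasurable M" and uL_measure: "measure M (u ` L n) = measure M F"
  using aut_image_fmeasurable[OF u L_fm] L_measure by auto

lemma L_disjoint: "m < H \<Longrightarrow> n < H \<Longrightarrow> m \<noteq> n \<Longrightarrow> L m \<inter> L n = {}"
  using disjoint_family_onD[OF disj, of m n] by simp

lemma uL_disjoint: "m < H \<Longrightarrow> n < H \<Longrightarrow> m \<noteq> n \<Longrightarrow> u ` L m \<inter> u ` L n = {}"
  using aut_image_set_ops(1)[OF u fmeasurable_subset_space[OF L_fm] fmeasurable_subset_space[OF L_fm], of m n]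
    L_disjoint[of m n] by simp

lemma Int_fm: "u ` L m \<inter> L n \<in> fmeasurable M"
  using uL_fm L_fm by (intro fmeasurable_Int_fmeasurable) auto

lemma c_nonneg: "0 \<le> c m n" by (simp add: c_def)

lemma \<gamma>_nonneg: "0 \<le> \<gamma> k" by (simp add: \<gamma>_def c_nonneg)

text \<open>Apply \<open>f\<close> to the intersection: it preserves measure and passes through
  \<open>u\<close> up to a null set.\<close>

lemma c_Suc: "c (Suc m) (Suc n) = c m n"
proof -
  have Lm: "L m \<in> sets M" using L_fm by auto
  have LS: "L (Suc n) = f ` L n" for n by (simp add: image_comp)
  have "sym_diff ((u \<circ> f) ` L m) ((f \<circ> u) ` L m) \<in> null_sets M"
    by (rule aut_image_ae) (use f u comm Lm in \<open>auto intro: aut_maps_comp\<close>)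
  then have n: "sym_diff (u ` f ` L m) (f ` u ` L m) \<in> null_sets M"
    by (simp only: image_comp[of u f "L m"] image_comp[of f u "L m"])
  have s: "u ` f ` L m \<inter> f ` L n \<in> sets M" "f ` u ` L m \<inter> f ` L n \<in> sets M"
    using Lm L_fm[of n] aut_image(1)[OF f] aut_image(1)[OF u] by auto
  have "c (Suc m) (Suc n) = measure M (u ` f ` L m \<inter> f ` L n)" by (simp only: c_def LS)
  also have "\<dots> = measure M (f ` u ` L m \<inter> f ` L n)"
    by (rule measure_eq_null_sym_diff[OF s], rule null_sets_subset[OF n]) (use s in auto)
  also have "f ` u ` L m \<inter> f ` L n = f ` (u ` L m \<inter> L n)"
    using aut_image_set_ops(1)[OF f fmeasurable_subset_space[OF uL_fm] fmeasurable_subset_space[OF L_fm]] by simp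
  also have "measure M \<dots> = c m n" unfolding c_def by (rule aut_image_fmeasurable(2)[OF f Int_fm])
  finally show ?thesis .
qed

lemma c_add: "c (m + k) (n + k) = c m n"
  by (induction k) (simp_all add: c_Suc)

lemma c_eq_\<gamma>: "c m n = \<gamma> (int n - int m)"
proof (cases "m \<le> n")
  case True
  then show ?thesis using c_add[of 0 m "n - m"] by (simp add: \<gamma>_def nat_diff_distrib)
next
  case False
  then show ?thesis using c_add[of "m - n" n 0] by (simp add: \<gamma>_def nat_diff_distrib)
qed

text \<open>For \<open>k \<ge> 0\<close> the coefficients measure the disjoint parts of the image of
  the base in the levels; for \<open>k \<le> 0\<close> they measure the parts of the base covered by
  the disjoint images of the levels. Each family adds up to at most
  \<open>measure M F\<close>.\<close>

lemma sum_\<gamma>_le: "(\<Sum>k\<in>{- int H<..<int H}. \<gamma> k) \<le> 2 * measure M F"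
proof -
  have 1: "(\<Sum>n<H. c 0 n) \<le> measure M F"
  proof -
    have "(\<Sum>n<H. c 0 n) = measure M (\<Union>n<H. u ` L 0 \<inter> L n)"
      unfolding c_def
    proof (rule measure_UNION'[symmetric, OF finite_lessThan Int_fm], rule pairwiseI)
      fix m n assume "m \<in> {..<H}" "n \<in> {..<H}" "m \<noteq> n"
      then have "L m \<inter> L n = {}" by (intro L_disjoint) auto
      then show "disjnt (u ` L 0 \<inter> L m) (u ` L 0 \<inter> L n)" unfolding disjnt_def by blast
    qed
    also have "\<dots> \<le> measure M (u ` L 0)"
      by (rule measure_mono_fmeasurable[OF _ sets.finite_UN[OF finite_lessThan fmeasurableD[OF Int_fm]] uL_fm]) auto
    finally show ?thesis unfolding uL_measure .
  qed
  have 2: "(\<Sum>n<H. c n 0) \<le> measure M F"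
  proof -
    have "(\<Sum>n<H. c n 0) = measure M (\<Union>n<H. u ` L n \<inter> L 0)"
      unfolding c_def
    proof (rule measure_UNION'[symmetric, OF finite_lessThan Int_fm], rule pairwiseI)
      fix m n assume "m \<in> {..<H}" "n \<in> {..<H}" "m \<noteq> n"
      then have "u ` L m \<inter> u ` L n = {}" by (intro uL_disjoint) auto
      then show "disjnt (u ` L m \<inter> L 0) (u ` L n \<inter> L 0)" unfolding disjnt_def by blast
    qed
    also have "\<dots> \<le> measure M (L 0)"
      by (rule measure_mono_fmeasurable[OF _ sets.finite_UN[OF finite_lessThan fmeasurableD[OF Int_fm]] L_fm]) auto
    finally show ?thesis unfolding L_measure .
  qed
  have "{- int H<..<int H} \<subseteq> int ` {..<H} \<union> (\<lambda>n. - int n) ` {..<H}"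
  proof
    fix k assume k: "k \<in> {- int H<..<int H}"
    show "k \<in> int ` {..<H} \<union> (\<lambda>n. - int n) ` {..<H}"
    proof (cases "0 \<le> k")
      case True
      then show ?thesis using k by (intro UnI1 image_eqI[of _ _ "nat k"]) auto
    next
      case False
      then show ?thesis using k by (intro UnI2 image_eqI[of _ _ "nat (- k)"]) auto
    qed
  qed
  then have "(\<Sum>k\<in>{- int H<..<int H}. \<gamma> k) \<le> (\<Sum>k\<in>int ` {..<H} \<union> (\<lambda>n. - int n) ` {..<H}. \<gamma> k)"
    by (intro sum_mono2) (auto simp: \<gamma>_nonneg)
  also have "\<dots> \<le> (\<Sum>k\<in>int ` {..<H}. \<gamma> k) + (\<Sum>k\<in>(\<lambda>n. - int n) ` {..<H}. \<gamma> k)"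
  proof -
    have "0 \<le> sum \<gamma> (int ` {..<H} \<inter> (\<lambda>n. - int n) ` {..<H})" by (intro sum_nonneg \<gamma>_nonneg)
    then show ?thesis using sum.union_inter[of "int ` {..<H}" "(\<lambda>n. - int n) ` {..<H}" \<gamma>] by simp
  qed
  also have "(\<Sum>k\<in>int ` {..<H}. \<gamma> k) = (\<Sum>n<H. c 0 n)" by (subst sum.reindex) (auto simp: \<gamma>_def)
  also have "(\<Sum>k\<in>(\<lambda>n. - int n) ` {..<H}. \<gamma> k) = (\<Sum>n<H. c n 0)"
    by (subst sum.reindex) (auto simp: \<gamma>_def inj_on_def)
  finally show ?thesis using 1 2 by linarith
qed

lemma pairs_finite: "P \<subseteq> {..<H} \<Longrightarrow> Q \<subseteq> {..<H} \<Longrightarrow> finite (pairs P Q k)"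
  unfolding pairs_def by (rule finite_subset[of _ "{..<H} \<times> {..<H}"]) auto

lemma UN_L_fm: "Q \<subseteq> {..<H} \<Longrightarrow> (\<Union>n\<in>Q. L n) \<in> fmeasurable M"
  by (intro fmeasurable.finite_UN L_fm) (auto intro: finite_subset)

text \<open>Pairs of levels are grouped by their difference, which turns \<open>u\<close> on unions
  of levels into a convolution with \<open>\<gamma>\<close>.\<close>

lemma measure_eq_sum:
  assumes P: "P \<subseteq> {..<H}" and Q: "Q \<subseteq> {..<H}"
  shows "measure M (u ` (\<Union>m\<in>P. L m) \<inter> (\<Union>n\<in>Q. L n)) = (\<Sum>k\<in>{- int H<..<int H}. real (card (pairs P Q k)) * \<gamma> k)"
proof -
  have fin: "finite (P \<times> Q)" using P Q finite_subset by blast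
  have "u ` (\<Union>m\<in>P. L m) \<inter> (\<Union>n\<in>Q. L n) = (\<Union>(m, n)\<in>P \<times> Q. u ` L m \<inter> L n)" by blast
  also have "measure M \<dots> = (\<Sum>i\<in>P \<times> Q. measure M (case i of (m, n) \<Rightarrow> u ` L m \<inter> L n))"
  proof (rule measure_UNION'[OF fin])
    show "(case i of (m, n) \<Rightarrow> u ` L m \<inter> L n) \<in> fmeasurable M" for i using Int_fm by (cases i) auto
    show "pairwise (\<lambda>i j. disjnt (case i of (m, n) \<Rightarrow> u ` L m \<inter> L n) (case j of (m, n) \<Rightarrow> u ` L m \<inter> L n)) (P \<times> Q)"
    proof (rule pairwiseI)
      fix i j assume ij: "i \<in> P \<times> Q" "j \<in> P \<times> Q" "i \<noteq> j"
      obtain m n m' n' where e: "i = (m, n)" "j = (m', n')" by (cases i, cases j)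
      then have lt: "m < H" "n < H" "m' < H" "n' < H" using ij P Q by auto
      have "u ` L m \<inter> u ` L m' = {} \<or> L n \<inter> L n' = {}"
        using uL_disjoint[OF lt(1,3)] L_disjoint[OF lt(2,4)] ij e by blast
      then show "disjnt (case i of (m, n) \<Rightarrow> u ` L m \<inter> L n) (case j of (m, n) \<Rightarrow> u ` L m \<inter> L n)"
        unfolding e disjnt_def prod.case by blast
    qed
  qed
  also have "\<dots> = (\<Sum>i\<in>P \<times> Q. \<gamma> (int (snd i) - int (fst i)))"
    by (rule sum.cong) (auto simp: c_eq_\<gamma>[symmetric] c_def)
  also have "\<dots> = (\<Sum>k\<in>{- int H<..<int H}. \<Sum>i\<in>{i \<in> P \<times> Q. int (snd i) - int (fst i) = k}. \<gamma> (int (snd i) - int (fst i)))"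
  proof (rule sum.group[symmetric, OF fin])
    show "(\<lambda>i. int (snd i) - int (fst i)) ` (P \<times> Q) \<subseteq> {- int H<..<int H}"
    proof (rule image_subsetI)
      fix i assume "i \<in> P \<times> Q"
      then have "fst i < H" "snd i < H" using P Q by auto
      then show "int (snd i) - int (fst i) \<in> {- int H<..<int H}" by auto
    qed
  qed auto
  also have "\<dots> = (\<Sum>k\<in>{- int H<..<int H}. real (card (pairs P Q k)) * \<gamma> k)"
  proof (rule sum.cong[OF refl])
    fix k
    have "{i \<in> P \<times> Q. int (snd i) - int (fst i) = k} = pairs P Q k" by (auto simp: pairs_def)
    moreover have "(\<Sum>i\<in>pairs P Q k. \<gamma> (int (snd i) - int (fst i))) = (\<Sum>i\<in>pairs P Q k. \<gamma> k)"
      by (rule sum.cong) (auto simp: pairs_def)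
    ultimately show "(\<Sum>i\<in>{i \<in> P \<times> Q. int (snd i) - int (fst i) = k}. \<gamma> (int (snd i) - int (fst i)))
      = real (card (pairs P Q k)) * \<gamma> k" by simp
  qed
  finally show ?thesis .
qed

lemma L_add: "(f ^^ k) ` L n = L (n + k)"
  by (simp add: image_comp funpow_add[symmetric] add.commute)

lemma two_sided_fm:
  assumes "A \<in> fmeasurable M" "B \<in> fmeasurable M"
  shows "(f ^^ k) ` A \<inter> (f ^^ l) ` B \<in> fmeasurable M"
  using aut_image_fmeasurable(1)[OF aut_maps_funpow[OF f]] assms by (intro fmeasurable_Int_fmeasurable) auto

text \<open>Every pair contributes one full level to the overlap, and different pairs contribute
  different levels.\<close>

lemma pairs_le_two_sided:
  assumes P: "P \<subseteq> {..<H}" and Q: "Q \<subseteq> {..<H}"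
  shows "real (card (pairs P Q k)) * measure M F \<le> two_sided M f k (\<Union>m\<in>P. L m) (\<Union>n\<in>Q. L n)"
proof -
  have fin: "finite (pairs P Q k)" by (rule pairs_finite[OF P Q])
  have add: "fst i + nat k = snd i + nat (- k)" if "i \<in> pairs P Q k" for i
    using that by (auto simp: pairs_def)
  have "real (card (pairs P Q k)) * measure M F = (\<Sum>i\<in>pairs P Q k. measure M (L (fst i + nat k)))"
    by (simp add: L_measure)
  also have "\<dots> = measure M (\<Union>i\<in>pairs P Q k. L (fst i + nat k))"
  proof (rule measure_UNION'[symmetric, OF fin L_fm], rule pairwiseI)
    fix i j assume ij: "i \<in> pairs P Q k" "j \<in> pairs P Q k" "i \<noteq> j"
    have ne: "fst i + nat k \<noteq> fst j + nat k" using ij add[of i] add[of j] by (auto simp: prod_eq_iff)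
    have lt: "fst i + nat k < H" if "i \<in> pairs P Q k" for i
    proof (cases "0 \<le> k")
      case True
      then show ?thesis using add[OF that] that Q by (auto simp: pairs_def)
    next
      case False
      then show ?thesis using that P by (auto simp: pairs_def)
    qed
    show "disjnt (L (fst i + nat k)) (L (fst j + nat k))"
      unfolding disjnt_def by (rule L_disjoint[OF lt[OF ij(1)] lt[OF ij(2)] ne])
  qed
  also have "\<dots> \<le> two_sided M f k (\<Union>m\<in>P. L m) (\<Union>n\<in>Q. L n)"
    unfolding two_sided_def
  proof (rule measure_mono_fmeasurable[OF _ _ two_sided_fm[OF UN_L_fm[OF P] UN_L_fm[OF Q]]])
    show "(\<Union>i\<in>pairs P Q k. L (fst i + nat k)) \<subseteq> (f ^^ nat k) ` (\<Union>m\<in>P. L m) \<inter> (f ^^ nat (- k)) ` (\<Union>n\<in>Q. L n)"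
    proof (rule UN_least)
      fix i assume i: "i \<in> pairs P Q k"
      have "fst i \<in> P" "snd i \<in> Q" using i by (auto simp: pairs_def)
      note UN_upper[OF this(1), of L] UN_upper[OF this(2), of L]
      note image_mono[OF this(1), of "f ^^ nat k"] image_mono[OF this(2), of "f ^^ nat (- k)"]
      then show "L (fst i + nat k) \<subseteq> (f ^^ nat k) ` (\<Union>m\<in>P. L m) \<inter> (f ^^ nat (- k)) ` (\<Union>n\<in>Q. L n)"
        unfolding L_add add[OF i, symmetric] by blast
    qed
    show "(\<Union>i\<in>pairs P Q k. L (fst i + nat k)) \<in> sets M"
      using fin L_fm by (intro sets.finite_UN) auto
  qed
  finally show ?thesis .
qed

text \<open>Converse estimate. The shift pushes at most \<open>k\<close> levels over the top of the
  tower, where nothing is known about disjointness; they are counted separately in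
  \<open>R\<close>.\<close>

lemma two_sided_le_pairs_nonneg:
  assumes P: "P \<subseteq> {..<H}" and Q: "Q \<subseteq> {..<H}" and k: "0 \<le> k"
  shows "two_sided M f k (\<Union>m\<in>P. L m) (\<Union>n\<in>Q. L n) \<le> (real (card (pairs P Q k)) + real_of_int \<bar>k\<bar>) * measure M F"
proof -
  have fin: "finite (pairs P Q k)" by (rule pairs_finite[OF P Q])
  define R where "R = {H..<H + nat k}"
  have fm1: "(\<Union>i\<in>pairs P Q k. L (snd i)) \<in> fmeasurable M" and fm2: "(\<Union>n\<in>R. L n) \<in> fmeasurable M"
    using fin by (intro fmeasurable.finite_UN L_fm; simp add: R_def)+
  have sub: "(f ^^ nat k) ` (\<Union>m\<in>P. L m) \<inter> (\<Union>n\<in>Q. L n) \<subseteq> (\<Union>i\<in>pairs P Q k. L (snd i)) \<union> (\<Union>n\<in>R. L n)"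
  proof
    fix x assume x: "x \<in> (f ^^ nat k) ` (\<Union>m\<in>P. L m) \<inter> (\<Union>n\<in>Q. L n)"
    then obtain m where m: "m \<in> P" "x \<in> (f ^^ nat k) ` L m" by blast
    obtain n where n: "n \<in> Q" "x \<in> L n" using x by blast
    have xm: "x \<in> L (m + nat k)" using m(2) unfolding L_add .
    show "x \<in> (\<Union>i\<in>pairs P Q k. L (snd i)) \<union> (\<Union>n\<in>R. L n)"
    proof (cases "m + nat k < H")
      case True
      have "n < H" using n(1) Q by auto
      then have "m + nat k = n" using L_disjoint[OF True, of n] xm n(2) by blast
      then have "(m, n) \<in> pairs P Q k" using m(1) n(1) k by (auto simp: pairs_def)
      then show ?thesis using n(2) by (intro UnI1 UN_I[of "(m, n)"]) simp_all
    next
      case False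
      have "m < H" using m(1) P by auto
      then have "m + nat k \<in> R" using False by (simp add: R_def)
      then show ?thesis using xm by (intro UnI2 UN_I)
    qed
  qed
  have "two_sided M f k (\<Union>m\<in>P. L m) (\<Union>n\<in>Q. L n) = measure M ((f ^^ nat k) ` (\<Union>m\<in>P. L m) \<inter> (\<Union>n\<in>Q. L n))"
    using k by (simp add: two_sided_def)
  also have "\<dots> \<le> measure M ((\<Union>i\<in>pairs P Q k. L (snd i)) \<union> (\<Union>n\<in>R. L n))"
    using two_sided_fm[OF UN_L_fm[OF P] UN_L_fm[OF Q], of "nat k" 0]
    by (intro measure_mono_fmeasurable[OF sub _ fmeasurable.Un[OF fm1 fm2]]) auto
  also have "\<dots> \<le> measure M (\<Union>i\<in>pairs P Q k. L (snd i)) + measure M (\<Union>n\<in>R. L n)"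
    using fm1 fm2 by (intro measure_Un_le) auto
  also have "measure M (\<Union>i\<in>pairs P Q k. L (snd i)) \<le> (\<Sum>i\<in>pairs P Q k. measure M (L (snd i)))"
    using fin L_fm by (intro measure_UNION_le) auto
  also have "measure M (\<Union>n\<in>R. L n) \<le> (\<Sum>n\<in>R. measure M (L n))"
    using L_fm by (intro measure_UNION_le) (auto simp: R_def)
  finally show ?thesis using k by (simp add: L_measure R_def algebra_simps)
qed

lemma card_pairs_swap: "card (pairs P Q k) = card (pairs Q P (- k))"
proof -
  have "pairs Q P (- k) = prod.swap ` pairs P Q k" by (auto simp: pairs_def image_iff)
  then show ?thesis by (simp add: card_image)
qed

lemma two_sided_le_pairs:
  assumes P: "P \<subseteq> {..<H}" and Q: "Q \<subseteq> {..<H}"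
  shows "two_sided M f k (\<Union>m\<in>P. L m) (\<Union>n\<in>Q. L n) \<le> (real (card (pairs P Q k)) + real_of_int \<bar>k\<bar>) * measure M F"
proof (cases "0 \<le> k")
  case True then show ?thesis by (rule two_sided_le_pairs_nonneg[OF P Q])
next
  case False
  then show ?thesis using two_sided_le_pairs_nonneg[OF Q P, of "- k"]
    by (simp add: two_sided_swap[of M f k] card_pairs_swap[of P Q k])
qed

end

section \<open>Domination of one power by the commuting map\<close>

lemma two_sided_perturb:
  assumes f: "f \<in> aut_maps M"
    and fm: "A \<in> fmeasurable M" "A' \<in> fmeasurable M" "B \<in> fmeasurable M" "B' \<in> fmeasurable M"
  shows "two_sided M f k A B \<le> two_sided M f k A' B' + (measure M (sym_diff A A') + measure M (sym_diff B B'))"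
  unfolding two_sided_def by (intro measure_aut_Int_perturb aut_maps_funpow f fm)

lemma two_sided_le:
  assumes f: "f \<in> aut_maps M" and fm: "A \<in> fmeasurable M" "B \<in> fmeasurable M"
  shows "two_sided M f k A B \<le> measure M A"
proof -
  note i = aut_image_fmeasurable[OF aut_maps_funpow[OF f]]
  have "two_sided M f k A B \<le> measure M ((f ^^ nat k) ` A)"
    unfolding two_sided_def using i(1) fm by (intro measure_mono_fmeasurable) auto
  then show ?thesis using i(2)[OF fm(1)] by simp
qed

text \<open>On a tower that resolves all the sets involved, \<open>u\<close> acts as \<open>\<Sum>\<^sub>k \<gamma> k / \<mu> F \<cdot> f\<^sup>k\<close>. Mixing
  confines the coefficients that matter to a range independent of the tower, so one of them stays
  bounded below.\<close>

lemma commuting_dominates_power: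
  assumes f: "f \<in> aut_maps M" and u: "u \<in> aut_maps M" and comm: "AE x in M. u (f x) = f (u x)"
    and mix: "mixing_map M f"
    and tow: "\<And>\<B> \<epsilon>. finite \<B> \<Longrightarrow> \<B> \<subseteq> fmeasurable M \<Longrightarrow> 0 < \<epsilon> \<Longrightarrow> tower_approx M f \<B> \<epsilon>"
    and A: "A \<in> fmeasurable M" and B: "B \<in> fmeasurable M" and pos: "0 < measure M (u ` A \<inter> B)"
  shows "\<exists>k \<theta>. 0 < \<theta> \<and> (\<forall>A'\<in>fmeasurable M. \<forall>B'\<in>fmeasurable M. \<theta> * two_sided M f k A' B' \<le> measure M (u ` A' \<inter> B'))"
proof -
  define \<eta> where "\<eta> = measure M (u ` A \<inter> B)"
  have \<eta>: "0 < \<eta>" using pos by (simp add: \<eta>_def)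
  obtain K where K: "\<And>k. K \<le> \<bar>k\<bar> \<Longrightarrow> two_sided M f k A B < \<eta> / 8"
    using two_sided_mixing[OF mix A B, of "\<eta> / 8"] \<eta> by auto
  define K' where "K' = max K 1"
  define C where "C = measure M A + 1"
  have C: "0 < C" "measure M A \<le> C" using measure_nonneg[of M A] by (auto simp: C_def intro: add_nonneg_pos)
  \<comment> \<open>Fewer than \<open>2 * K'\<close> exponents have modulus below \<open>K'\<close>,
    and an overlap is at most \<open>C\<close>. Coefficients up to
    \<open>\<theta> * measure M F\<close> at these exponents account for at most
    \<open>\<eta> / 8\<close>.\<close>
  define \<theta> where "\<theta> = \<eta> / (16 * real_of_int K' * C)"
  have K': "1 \<le> K'" "K \<le> K'" by (auto simp: K'_def)
  have \<theta>: "0 < \<theta>" using \<eta> C K' by (auto simp: \<theta>_def intro!: divide_pos_pos mult_pos_pos)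
  show ?thesis
  proof (rule ccontr)
    assume "\<not> ?thesis"
    \<comment> \<open>If no exponent works, every \<open>k\<close> has its own witnesses
      \<open>X k\<close>, \<open>Y k\<close>. Only those with modulus of \<open>k\<close> below
      \<open>K'\<close> are used, so one tower resolves all of them together with \<open>A\<close>
      and \<open>B\<close>.\<close>
    then have "\<exists>A'\<in>fmeasurable M. \<exists>B'\<in>fmeasurable M. measure M (u ` A' \<inter> B') < \<theta> * two_sided M f k A' B'" for k
      using \<theta> by (meson not_le)
    then obtain X Y where XY: "\<And>k. X k \<in> fmeasurable M" "\<And>k. Y k \<in> fmeasurable M"
      "\<And>k. measure M (u ` X k \<inter> Y k) < \<theta> * two_sided M f k (X k) (Y k)" by metis
    define I where "I = {- K'<..<K'}"
    have finI: "finite I" by (simp add: I_def)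
    define gap where "gap k = \<theta> * two_sided M f k (X k) (Y k) - measure M (u ` X k \<inter> Y k)" for k
    have gap: "0 < gap k" for k using XY(3) by (simp add: gap_def)
    \<comment> \<open>\<open>D * \<epsilon>\<close> collects the errors: \<open>\<theta>\<close>
      times the levels lost over the top and the perturbation of both sets, plus the perturbation of
      both sets under \<open>u\<close>.\<close>
    define D where "D = \<theta> * (real_of_int K' + 2) + 2"
    have D: "0 < D" using \<theta> K' by (auto simp: D_def intro!: add_pos_pos mult_pos_pos)
    obtain \<epsilon> where \<epsilon>: "0 < \<epsilon>" "\<epsilon> < 1" "\<epsilon> < \<eta> / 32" "\<And>k. k \<in> I \<Longrightarrow> D * \<epsilon> < gap k"
    proof -
      define m where "m = Min (insert 1 (insert (\<eta> / 32) ((\<lambda>k. gap k / D) ` I)))"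
      have fin: "finite (insert 1 (insert (\<eta> / 32) ((\<lambda>k. gap k / D) ` I)))" using finI by simp
      have "0 < m" unfolding m_def using fin gap D \<eta> by (subst Min_gr_iff) auto
      moreover have "m \<le> 1" "m \<le> \<eta> / 32" unfolding m_def by (rule Min_le[OF fin]; simp)+
      moreover have "D * (m / 2) < gap k" if "k \<in> I" for k
      proof -
        have "m \<le> gap k / D" unfolding m_def by (rule Min_le[OF fin]) (use that in blast)
        then have "D * m \<le> gap k" using D by (simp add: field_simps)
        then show ?thesis using gap[of k] by simp
      qed
      ultimately show ?thesis by (intro that[of "m / 2"]) simp_all
    qed
    define \<B> where "\<B> = {A, B} \<union> X ` I \<union> Y ` I"
    have "finite \<B>" "\<B> \<subseteq> fmeasurable M" using A B XY(1,2) finI by (auto simp: \<B>_def)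
    then have "tower_approx M f \<B> \<epsilon>" using \<epsilon>(1) by (intro tow)
    then obtain F H where Fs: "F \<in> fmeasurable M" "measure M F < \<epsilon>"
      and disj: "disjoint_family_on (\<lambda>n. (f ^^ n) ` F) {..<H}"
      and ap: "\<And>B. B \<in> \<B> \<Longrightarrow> \<exists>Q\<subseteq>{..<H}. measure M (sym_diff B (\<Union>n\<in>Q. (f ^^ n) ` F)) < \<epsilon>"
      unfolding tower_approx_def by blast
    interpret commuting_tower M f u F H by unfold_locales (use f u comm Fs disj in auto)
    have uperturb: "measure M (u ` A1 \<inter> B1) \<le> measure M (u ` A2 \<inter> B2) + (measure M (sym_diff A1 A2) + measure M (sym_diff B1 B2))"
      if "A1 \<in> fmeasurable M" "A2 \<in> fmeasurable M" "B1 \<in> fmeasurable M" "B2 \<in> fmeasurable M" for A1 A2 B1 B2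
      using measure_aut_Int_perturb[OF u aut_maps_id that] by simp
    obtain QA where QA: "QA \<subseteq> {..<H}" "measure M (sym_diff A (\<Union>n\<in>QA. L n)) < \<epsilon>" using ap[of A] by (auto simp: \<B>_def)
    obtain QB where QB: "QB \<subseteq> {..<H}" "measure M (sym_diff B (\<Union>n\<in>QB. L n)) < \<epsilon>" using ap[of B] by (auto simp: \<B>_def)
    let ?A = "\<Union>n\<in>QA. L n" and ?B = "\<Union>n\<in>QB. L n"
    have fm: "?A \<in> fmeasurable M" "?B \<in> fmeasurable M" using UN_L_fm QA QB by auto
    have low: "\<eta> - 2 * \<epsilon> \<le> measure M (u ` ?A \<inter> ?B)"
      using uperturb[OF A fm(1) B fm(2)] QA(2) QB(2) by (simp add: \<eta>_def)
    have Fpos: "0 < measure M F"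
    proof (rule ccontr)
      assume "\<not> 0 < measure M F"
      then have F0: "measure M F = 0" by (simp add: zero_less_measure_iff)
      have "measure M (u ` ?A \<inter> ?B) \<le> measure M (u ` ?A)"
        using aut_image_fmeasurable(1)[OF u fm(1)] fm by (intro measure_mono_fmeasurable) auto
      also have "\<dots> = measure M ?A" by (rule aut_image_fmeasurable(2)[OF u fm(1)])
      also have "\<dots> \<le> (\<Sum>n\<in>QA. measure M (L n))"
        using L_fm QA(1) by (intro measure_UNION_le) (auto intro: finite_subset)
      also have "\<dots> = 0" by (simp add: L_measure F0)
      finally show False using low \<epsilon>(3) \<eta> by linarith
    qed
    have small: "two_sided M f k ?A ?B \<le> \<eta> / 8 + 2 * \<epsilon>" if "K' \<le> \<bar>k\<bar>" for k
    proof -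
      have "measure M (sym_diff ?A A) = measure M (sym_diff A ?A)" "measure M (sym_diff ?B B) = measure M (sym_diff B ?B)"
        by (simp_all only: sym_diff_commute)
      then show ?thesis using two_sided_perturb[OF f fm(1) A fm(2) B, of k] K[of k] K'(2) that QA(2) QB(2) by linarith
    qed
    have le: "two_sided M f k ?A ?B \<le> C" for k
    proof -
      have "measure M ?A \<le> measure M (A \<union> sym_diff A ?A)"
        using A fm by (intro measure_mono_fmeasurable fmeasurable.Un fmeasurable_sym_diff) auto
      also have "\<dots> \<le> measure M A + measure M (sym_diff A ?A)"
        using A fm by (intro measure_Un_le) auto
      finally show ?thesis using two_sided_le[OF f fm, of k] QA(2) \<epsilon>(2) by (simp add: C_def)
    qed
    \<comment> \<open>Otherwise the exponents in \<open>I\<close> give at most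
      \<open>\<eta> / 8\<close>, and the others at most \<open>\<eta> / 8 + 2 * \<epsilon>\<close>
      times the total mass 2. The sum \<open>3 * \<eta> / 8 + 4 * \<epsilon>\<close> is less than
      the actual overlap.\<close>
    have "\<exists>k\<in>I. \<theta> * measure M F \<le> \<gamma> k"
    proof (rule ccontr)
      assume "\<not> ?thesis"
      then have lt: "\<gamma> k \<le> \<theta> * measure M F" if "k \<in> I" for k using that by force
      let ?R = "{- int H<..<int H}"
      have summand: "measure M F * (real (card (pairs QA QB k)) * \<gamma> k)
        \<le> (if k \<in> I then C * (\<theta> * measure M F) else 0) + (\<eta> / 8 + 2 * \<epsilon>) * \<gamma> k" for k
      proof -
        have "measure M F * (real (card (pairs QA QB k)) * \<gamma> k) = (real (card (pairs QA QB k)) * measure M F) * \<gamma> k"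
          by simp
        also have "\<dots> \<le> two_sided M f k ?A ?B * \<gamma> k"
          by (intro mult_right_mono pairs_le_two_sided QA(1) QB(1) \<gamma>_nonneg)
        also have "\<dots> \<le> (if k \<in> I then C * (\<theta> * measure M F) else 0) + (\<eta> / 8 + 2 * \<epsilon>) * \<gamma> k"
        proof (cases "k \<in> I")
          case True
          have "two_sided M f k ?A ?B * \<gamma> k \<le> C * (\<theta> * measure M F)"
            using le lt[OF True] C \<gamma>_nonneg by (intro mult_mono) auto
          moreover have "0 \<le> (\<eta> / 8 + 2 * \<epsilon>) * \<gamma> k" using \<eta> \<epsilon>(1) \<gamma>_nonneg by simp
          ultimately show ?thesis using True by simp
        next
          case False
          then have "K' \<le> \<bar>k\<bar>" by (auto simp: I_def)
          then show ?thesis using mult_right_mono[OF small \<gamma>_nonneg] False by simp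
        qed
        finally show ?thesis .
      qed
      have "measure M F * measure M (u ` ?A \<inter> ?B) = (\<Sum>k\<in>?R. measure M F * (real (card (pairs QA QB k)) * \<gamma> k))"
        unfolding measure_eq_sum[OF QA(1) QB(1)] by (rule sum_distrib_left)
      also have "\<dots> \<le> (\<Sum>k\<in>?R. (if k \<in> I then C * (\<theta> * measure M F) else 0) + (\<eta> / 8 + 2 * \<epsilon>) * \<gamma> k)"
        by (rule sum_mono) (rule summand)
      also have "\<dots> = (\<Sum>k\<in>?R. if k \<in> I then C * (\<theta> * measure M F) else 0) + (\<eta> / 8 + 2 * \<epsilon>) * (\<Sum>k\<in>?R. \<gamma> k)"
        by (simp only: sum.distrib sum_distrib_left)
      also have "(\<Sum>k\<in>?R. if k \<in> I then C * (\<theta> * measure M F) else 0) \<le> real (card I) * (C * (\<theta> * measure M F))"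
      proof -
        have "(\<Sum>k\<in>?R. if k \<in> I then C * (\<theta> * measure M F) else 0) = (\<Sum>k\<in>?R \<inter> I. C * (\<theta> * measure M F))"
          by (rule sum.inter_restrict[symmetric]) simp
        also have "\<dots> = real (card (?R \<inter> I)) * (C * (\<theta> * measure M F))" by simp
        also have "\<dots> \<le> real (card I) * (C * (\<theta> * measure M F))"
          using finI C \<theta> by (intro mult_right_mono of_nat_mono card_mono) auto
        finally show ?thesis .
      qed
      also have "real (card I) * (C * (\<theta> * measure M F)) \<le> (2 * real_of_int K') * (C * (\<theta> * measure M F))"
        using K' C \<theta> by (intro mult_right_mono) (auto simp: I_def)
      also have "(2 * real_of_int K') * (C * (\<theta> * measure M F)) = \<eta> / 8 * measure M F"
        using K' C by (simp add: \<theta>_def field_simps)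
      also have "(\<eta> / 8 + 2 * \<epsilon>) * (\<Sum>k\<in>?R. \<gamma> k) \<le> (\<eta> / 8 + 2 * \<epsilon>) * (2 * measure M F)"
        using sum_\<gamma>_le \<eta> \<epsilon>(1) by (intro mult_left_mono) auto
      finally have "measure M F * measure M (u ` ?A \<inter> ?B) \<le> measure M F * (3 * \<eta> / 8 + 4 * \<epsilon>)"
        by (simp add: algebra_simps)
      then have "measure M (u ` ?A \<inter> ?B) \<le> 3 * \<eta> / 8 + 4 * \<epsilon>" using Fpos by simp
      then show False using low \<epsilon>(3) \<eta> by linarith
    qed
    then obtain k where k: "k \<in> I" "\<theta> * measure M F \<le> \<gamma> k" by blast
    obtain QX where QX: "QX \<subseteq> {..<H}" "measure M (sym_diff (X k) (\<Union>n\<in>QX. L n)) < \<epsilon>"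
      using ap[of "X k"] k(1) by (auto simp: \<B>_def)
    obtain QY where QY: "QY \<subseteq> {..<H}" "measure M (sym_diff (Y k) (\<Union>n\<in>QY. L n)) < \<epsilon>"
      using ap[of "Y k"] k(1) by (auto simp: \<B>_def)
    let ?X = "\<Union>n\<in>QX. L n" and ?Y = "\<Union>n\<in>QY. L n"
    have fm2: "?X \<in> fmeasurable M" "?Y \<in> fmeasurable M" using UN_L_fm QX QY by auto
    have "\<theta> * (real (card (pairs QX QY k)) * measure M F) \<le> measure M (u ` ?X \<inter> ?Y)"
    proof (cases "k \<in> {- int H<..<int H}")
      case True
      have "\<theta> * (real (card (pairs QX QY k)) * measure M F) = real (card (pairs QX QY k)) * (\<theta> * measure M F)" by simp
      also have "\<dots> \<le> real (card (pairs QX QY k)) * \<gamma> k" using k(2) by (intro mult_left_mono) auto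
      also have "\<dots> \<le> (\<Sum>k\<in>{- int H<..<int H}. real (card (pairs QX QY k)) * \<gamma> k)"
        using True \<gamma>_nonneg by (intro member_le_sum) auto
      also have "\<dots> = measure M (u ` ?X \<inter> ?Y)" using measure_eq_sum[OF QX(1) QY(1)] by simp
      finally show ?thesis .
    next
      case False
      have "pairs QX QY k = {}"
      proof (rule ccontr)
        assume "pairs QX QY k \<noteq> {}"
        then obtain m n where mn: "m \<in> QX" "n \<in> QY" "int n - int m = k" by (auto simp: pairs_def)
        then have "m < H" "n < H" using QX(1) QY(1) by auto
        then show False using False mn(3) by auto
      qed
      then show ?thesis by simp
    qed
    moreover have "two_sided M f k ?X ?Y \<le> real (card (pairs QX QY k)) * measure M F + real_of_int K' * \<epsilon>"
    proof -
      have "real_of_int \<bar>k\<bar> * measure M F \<le> real_of_int K' * \<epsilon>"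
        using k(1) Fs(2) K' by (intro mult_mono) (auto simp: I_def)
      then show ?thesis using two_sided_le_pairs[OF QX(1) QY(1), of k] by (simp add: algebra_simps)
    qed
    moreover have "two_sided M f k (X k) (Y k) \<le> two_sided M f k ?X ?Y + 2 * \<epsilon>"
      using two_sided_perturb[OF f XY(1) fm2(1) XY(2) fm2(2), of k k k] QX(2) QY(2) by linarith
    ultimately have "\<theta> * (two_sided M f k (X k) (Y k) - real_of_int K' * \<epsilon> - 2 * \<epsilon>) \<le> measure M (u ` ?X \<inter> ?Y)"
      using mult_left_mono[of "two_sided M f k (X k) (Y k) - real_of_int K' * \<epsilon> - 2 * \<epsilon>"
          "real (card (pairs QX QY k)) * measure M F" \<theta>] \<theta> by linarith
    moreover have "measure M (u ` ?X \<inter> ?Y) \<le> measure M (u ` X k \<inter> Y k) + 2 * \<epsilon>"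
    proof -
      have "measure M (sym_diff ?X (X k)) = measure M (sym_diff (X k) ?X)" "measure M (sym_diff ?Y (Y k)) = measure M (sym_diff (Y k) ?Y)"
        by (simp_all only: sym_diff_commute)
      then show ?thesis using uperturb[OF fm2(1) XY(1) fm2(2) XY(2), of k k] QX(2) QY(2) by linarith
    qed
    ultimately have "gap k \<le> D * \<epsilon>" by (simp add: gap_def D_def algebra_simps)
    then show False using \<epsilon>(4)[OF k(1)] by linarith
  qed
qed

section \<open>Passage between classes and representatives, and the centralizer\<close>

lemma pow_ae_class:
  assumes "f \<in> aut_maps M"
  shows "ae_rel M `` {f} [^]\<^bsub>Aut M\<^esub> (n::nat) = ae_rel M `` {f ^^ n}"
proof (induction n)
  case 0
  then show ?case by (simp add: Aut_def nat_pow_def id_def)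
next
  case (Suc n)
  have "ae_rel M `` {f} [^]\<^bsub>Aut M\<^esub> Suc n = ae_rel M `` {f ^^ n} \<otimes>\<^bsub>Aut M\<^esub> ae_rel M `` {f}"
    using Suc by (simp add: nat_pow_def)
  also have "\<dots> = ae_rel M `` {f ^^ n \<circ> f}" by (rule mult_ae_class[OF aut_maps_funpow[OF assms] assms])
  finally show ?case by (simp only: funpow_Suc_right)
qed

lemma pow_rep:
  assumes "T \<in> carrier (Aut M)"
  shows "T [^]\<^bsub>Aut M\<^esub> (n::nat) = ae_rel M `` {rep T ^^ n}"
  using pow_ae_class[OF rep_aut[OF assms], of n] ae_class_rep[OF assms] by simp

lemma inv_ae_class:
  assumes f: "f \<in> aut_maps M"
  shows "inv\<^bsub>Aut M\<^esub> (ae_rel M `` {f}) = ae_rel M `` {inv_into (space M) f}"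
proof -
  interpret group "Aut M" by (rule group_Aut)
  note g = aut_maps_inv[OF f]
  have "ae_rel M `` {inv_into (space M) f} \<otimes>\<^bsub>Aut M\<^esub> ae_rel M `` {f} = ae_rel M `` {inv_into (space M) f \<circ> f}"
    by (rule mult_ae_class[OF g f])
  also have "\<dots> = ae_rel M `` {id}"
    by (subst ae_class_eq[OF aut_maps_comp[OF g f] aut_maps_id])
       (use aut_mapsD(1)[OF f] in \<open>auto simp: bij_betw_def\<close>)
  also have "\<dots> = \<one>\<^bsub>Aut M\<^esub>" by (simp add: Aut_def)
  finally show ?thesis by (rule inv_equality[OF _ ae_class_carrier[OF f] ae_class_carrier[OF g]])
qed

lemma inv_rep:
  assumes "T \<in> carrier (Aut M)"
  shows "inv\<^bsub>Aut M\<^esub> T = ae_rel M `` {inv_into (space M) (rep T)}"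
  using inv_ae_class[OF rep_aut[OF assms]] ae_class_rep[OF assms] by simp

lemma measure_act_Int:
  assumes "f \<in> aut_maps M" "A \<in> fmeasurable M" "B \<in> fmeasurable M"
  shows "measure M (act (ae_rel M `` {f}) A \<inter> B) = measure M (f ` A \<inter> B)"
proof -
  have A: "A \<in> sets M" using assms(2) by auto
  note n = act_class[OF assms(1) A]
  have s: "act (ae_rel M `` {f}) A \<inter> B \<in> sets M" "f ` A \<inter> B \<in> sets M"
    using act_fmeasurable(1)[OF ae_class_carrier[OF assms(1)] assms(2)] aut_image(1)[OF assms(1) A] assms(3) by auto
  show ?thesis by (rule measure_eq_null_sym_diff[OF s], rule null_sets_subset[OF n]) (use s in auto)
qed

lemma measure_act_sym_diff:
  assumes "f \<in> aut_maps M" "g \<in> aut_maps M" "A \<in> fmeasurable M"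
  shows "measure M (sym_diff (act (ae_rel M `` {f}) A) (act (ae_rel M `` {g}) A)) = measure M (sym_diff (f ` A) (g ` A))"
proof -
  have A: "A \<in> sets M" using assms(3) by auto
  let ?F = "act (ae_rel M `` {f}) A" and ?G = "act (ae_rel M `` {g}) A"
  note n = act_class[OF assms(1) A] act_class[OF assms(2) A]
  have s: "?F \<in> sets M" "?G \<in> sets M" "f ` A \<in> sets M" "g ` A \<in> sets M"
    using act_fmeasurable(1)[OF ae_class_carrier[OF assms(1)] assms(3)]
      act_fmeasurable(1)[OF ae_class_carrier[OF assms(2)] assms(3)] aut_image(1)[OF assms(1) A] aut_image(1)[OF assms(2) A] by auto
  show ?thesis
    by (rule measure_eq_null_sym_diff, use s in simp, use s in simp, rule null_sets_subset[OF null_sets.Un[OF n]])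
       (use s in auto)
qed

lemma mixing_iff:
  assumes "T \<in> carrier (Aut M)"
  shows "mixing M T \<longleftrightarrow> mixing_map M (rep T)"
  unfolding mixing_def mixing_map_def pow_rep[OF assms]
  by (intro ball_cong refl) (simp add: measure_act_Int[OF aut_maps_funpow[OF rep_aut[OF assms]]])

text \<open>Supplies a set of positive finite measure from which the domination argument can
  start.\<close>

lemma ex_measure_one:
  assumes iso: "isomorphic_mod0 M (lebesgue :: real measure)"
  shows "\<exists>A\<in>fmeasurable M. measure M A = 1"
proof -
  let ?I = "{x::real. 0 \<le> x \<and> ennreal x < emeasure M (space M)}"
  have I: "?I = {0..}" using emeasure_space_isomorphic_mod0[OF iso] by auto
  obtain P' g and Q' :: "real set" where g: "Q' \<subseteq> {0..}" "{0..} - Q' \<in> null_sets lebesgue" "piso M lebesgue P' Q' g"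
    using piso_standard[OF iso sets.top] unfolding I by blast
  let ?E = "Q' \<inter> {0..1::real}"
  have E: "?E \<in> sets lebesgue" "?E \<subseteq> Q'" using pisoD(2)[OF g(3)] by auto
  have "emeasure lebesgue ?E = emeasure lebesgue (?E \<union> ({0..} - Q') \<inter> {0..1})"
    using g(2) E by (intro emeasure_Un_null_set[symmetric]) (auto intro: null_sets_completion_subset)
  also have "?E \<union> ({0..} - Q') \<inter> {0..1} = {0..1}" by auto
  finally have "emeasure M (g -` ?E \<inter> P') = 1" using piso_emeasure_vimage[OF g(3) E] by simp
  moreover have "g -` ?E \<inter> P' \<in> sets M" by (rule pisoD(8)[OF g(3) E])
  ultimately show ?thesis by (intro bexI[of _ "g -` ?E \<inter> P'"]) (auto simp: measure_def intro!: fmeasurableI)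
qed

lemma measure_Diff_Int:
  assumes "A \<in> fmeasurable M" "B \<in> fmeasurable M"
  shows "measure M A = measure M (A - B) + measure M (A \<inter> B)"
proof -
  have "measure M (A - A \<inter> B) = measure M A - measure M (A \<inter> B)"
    by (rule measurable_measure_Diff) (use assms in auto)
  moreover have "A - A \<inter> B = A - B" by blast
  ultimately show ?thesis by simp
qed

text \<open>Domination yields an inclusion of images modulo null sets, and equality of finite
  measures upgrades it to equality. Negative \<open>k\<close> is handled by moving the power to the
  other side: the identity shown is that \<open>?p\<close> and \<open>?m \<circ> ?u\<close> have the
  same class, where at least one of \<open>?p\<close>, \<open>?m\<close> is the identity
  map.\<close>

lemma centralizer_powers:
  assumes iso: "isomorphic_mod0 M (lebesgue :: real measure)"
    and T: "T \<in> carrier (Aut M)" and mix: "mixing_map M (rep T)"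
    and tow: "\<And>\<B> \<epsilon>. finite \<B> \<Longrightarrow> \<B> \<subseteq> fmeasurable M \<Longrightarrow> 0 < \<epsilon> \<Longrightarrow> tower_approx M (rep T) \<B> \<epsilon>"
    and U: "U \<in> carrier (Aut M)" and comm: "U \<otimes>\<^bsub>Aut M\<^esub> T = T \<otimes>\<^bsub>Aut M\<^esub> U"
  shows "\<exists>n::int. U = T [^]\<^bsub>Aut M\<^esub> n"
proof -
  interpret group "Aut M" by (rule group_Aut)
  let ?f = "rep T" and ?u = "rep U"
  note f = rep_aut[OF T] and u = rep_aut[OF U]
  note fn = aut_maps_funpow[OF f]
  have "ae_rel M `` {?u \<circ> ?f} = ae_rel M `` {?f \<circ> ?u}"
    using comm mult_ae_class[OF u f] mult_ae_class[OF f u] ae_class_rep[OF T] ae_class_rep[OF U] by simp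
  then have "AE x in M. (?u \<circ> ?f) x = (?f \<circ> ?u) x"
    using ae_class_eq[OF aut_maps_comp[OF u f] aut_maps_comp[OF f u]] by blast
  then have ae: "AE x in M. ?u (?f x) = ?f (?u x)" by simp
  obtain A where A: "A \<in> fmeasurable M" "measure M A = 1" using ex_measure_one[OF iso] by blast
  have "0 < measure M (?u ` A \<inter> ?u ` A)" using aut_image_fmeasurable(2)[OF u A(1)] A(2) by simp
  then obtain k \<theta> where k: "0 < \<theta>"
    "\<And>A B. A \<in> fmeasurable M \<Longrightarrow> B \<in> fmeasurable M \<Longrightarrow> \<theta> * two_sided M ?f k A B \<le> measure M (?u ` A \<inter> B)"
    using commuting_dominates_power[OF f u ae mix tow A(1) aut_image_fmeasurable(1)[OF u A(1)]] by blast
  let ?p = "?f ^^ nat k" and ?m = "?f ^^ nat (- k)"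
  note p = fn[of "nat k"] and m = fn[of "nat (- k)"]
  have "ae_rel M `` {?p} = ae_rel M `` {?m \<circ> ?u}"
  proof (rule Aut_eqI[OF iso])
    show "ae_rel M `` {?p} \<in> carrier (Aut M)" "ae_rel M `` {?m \<circ> ?u} \<in> carrier (Aut M)"
      using p m u by (auto intro: ae_class_carrier aut_maps_comp)
    fix D assume D: "D \<in> fmeasurable M"
    let ?P = "?p ` D" and ?U = "?u ` D"
    let ?V = "?m ` ?U"
    have fm: "?P \<in> fmeasurable M" "?U \<in> fmeasurable M" "?V \<in> fmeasurable M"
      using aut_image_fmeasurable(1) p m u D by blast+
    \<comment> \<open>\<open>W\<close> is the preimage of \<open>?P\<close> under \<open>?m\<close>,
      so that \<open>?m\<close> carries \<open>W - ?U\<close>, which is disjoint from the image of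
      \<open>D\<close> under \<open>?u\<close>, to \<open>?P - ?V\<close>.\<close>
    define W where "W = inv_into (space M) ?m ` ?P"
    have W: "W \<in> fmeasurable M" unfolding W_def by (rule aut_image_fmeasurable(1)[OF aut_maps_inv[OF m] fm(1)])
    have mW: "?m ` W = ?P"
    proof -
      have "?m ` space M = space M" using aut_mapsD(1)[OF m] by (simp add: bij_betw_def)
      then have "?m (inv_into (space M) ?m x) = x" if "x \<in> ?P" for x
        using fmeasurable_subset_space[OF fm(1)] that by (intro f_inv_into_f) auto
      then show ?thesis unfolding W_def image_image by force
    qed
    have mWU: "?m ` (W - ?U) = ?P - ?V"
      using aut_image_set_ops(2)[OF m fmeasurable_subset_space[OF W] fmeasurable_subset_space[OF fm(2)]] mW by simp
    have "\<theta> * two_sided M ?f k D (W - ?U) \<le> measure M (?u ` D \<inter> (W - ?U))"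
      using D W fm by (intro k(2)) auto
    also have "?u ` D \<inter> (W - ?U) = {}" by blast
    finally have "two_sided M ?f k D (W - ?U) \<le> 0" using k(1) by (simp add: mult_le_0_iff)
    then have "measure M (?P \<inter> (?P - ?V)) \<le> 0" unfolding two_sided_def mWU .
    moreover have "?P \<inter> (?P - ?V) = ?P - ?V" by blast
    ultimately have 1: "measure M (?P - ?V) = 0" using measure_nonneg[of M "?P - ?V"] by simp
    have e1: "measure M ?P = measure M (?P - ?V) + measure M (?P \<inter> ?V)" by (rule measure_Diff_Int[OF fm(1,3)])
    have e2: "measure M ?V = measure M (?V - ?P) + measure M (?P \<inter> ?V)"
      using measure_Diff_Int[OF fm(3,1)] by (simp only: Int_commute)
    have "measure M ?P = measure M ?V"
      using aut_image_fmeasurable(2)[OF p D] aut_image_fmeasurable(2)[OF m fm(2)] aut_image_fmeasurable(2)[OF u D] by simp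
    then have 2: "measure M (?V - ?P) = 0" using 1 e1 e2 by simp
    have "measure M (sym_diff ?P ?V) \<le> measure M (?P - ?V) + measure M (?V - ?P)"
      using fm by (intro measure_Un_le) auto
    then have "measure M (sym_diff ?P ?V) = 0" using 1 2 measure_nonneg[of M "sym_diff ?P ?V"] by simp
    then show "measure M (sym_diff (act (ae_rel M `` {?p}) D) (act (ae_rel M `` {?m \<circ> ?u}) D)) = 0"
      using measure_act_sym_diff[OF p aut_maps_comp[OF m u] D] by (simp add: image_comp)
  qed
  then have "T [^]\<^bsub>Aut M\<^esub> nat k = T [^]\<^bsub>Aut M\<^esub> nat (- k) \<otimes>\<^bsub>Aut M\<^esub> U"
    using mult_ae_class[OF m u] ae_class_rep[OF U] by (simp add: pow_rep[OF T])
  moreover have pw: "T [^]\<^bsub>Aut M\<^esub> n \<in> carrier (Aut M)" for n :: nat using T by (rule nat_pow_closed)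
  ultimately have e: "U = inv\<^bsub>Aut M\<^esub> (T [^]\<^bsub>Aut M\<^esub> nat (- k)) \<otimes>\<^bsub>Aut M\<^esub> T [^]\<^bsub>Aut M\<^esub> nat k"
    by (intro inv_solve_left[THEN iffD2, OF U pw pw])
  show ?thesis
  proof (cases "0 \<le> k")
    case True
    then have "U = T [^]\<^bsub>Aut M\<^esub> nat k" using e pw[of "nat k"] by simp
    then show ?thesis by (metis int_pow_int)
  next
    case False
    then have "U = inv\<^bsub>Aut M\<^esub> (T [^]\<^bsub>Aut M\<^esub> nat (- k))" using e pw[of "nat (- k)"] by simp
    then have "U = T [^]\<^bsub>Aut M\<^esub> (- int (nat (- k)))" unfolding int_pow_neg_int[OF T] .
    then show ?thesis by blast
  qed
qed

section \<open>Openness of the tower condition\<close>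

lemma r_metric_ge_rho:
  assumes "dense_family M A"
  shows "rho M A S T \<le> r_metric M A S T"
proof -
  have "0 \<le> (SUP n\<in>{0::nat<..}. d_w M A (S [^]\<^bsub>Aut M\<^esub> n) (T [^]\<^bsub>Aut M\<^esub> n))"
    by (rule cSUP_upper2[OF d_w_bdd[OF assms], of 1]) (auto simp: d_w_nonneg)
  then show ?thesis by (simp add: r_metric_def)
qed

text \<open>The part \<open>rho\<close> of the metric suffices: a single term of its series controls
  a set \<open>A i\<close> close to \<open>B\<close>.\<close>

lemma rep_image_close:
  assumes d: "dense_family M A" and T: "T \<in> carrier (Aut M)" and B: "B \<in> fmeasurable M" and e: "0 < e"
  shows "\<exists>\<delta>>0. \<forall>S\<in>carrier (Aut M). r_metric M A T S < \<delta> \<longrightarrow> measure M (sym_diff (rep T ` B) (rep S ` B)) < e"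
proof -
  obtain i where i: "i \<ge> 1" "measure M (sym_diff (A i) B) < e / 3"
    using d B e unfolding dense_family_def by (meson divide_pos_pos zero_less_numeral)
  have Ai: "A i \<in> fmeasurable M" using i d by (auto simp: dense_family_def)
  define \<delta> where "\<delta> = (1/2) ^ i * (e / 3)"
  have im: "measure M (sym_diff (rep U ` B) (rep U ` A i)) < e / 3" if U: "U \<in> carrier (Aut M)" for U
    using aut_image_set_ops(3)[OF rep_aut[OF U] fmeasurable_subset_space[OF B] fmeasurable_subset_space[OF Ai]]
      aut_image_fmeasurable(2)[OF rep_aut[OF U] fmeasurable_sym_diff[OF B Ai]] i(2) by (simp add: sym_diff_commute)
  have "measure M (sym_diff (rep T ` B) (rep S ` B)) < e"
    if S: "S \<in> carrier (Aut M)" and r: "r_metric M A T S < \<delta>" for S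
  proof -
    have "(1/2) ^ i * measure M (sym_diff (act T (A i)) (act S (A i))) \<le> (1/2) ^ i * (measure M (sym_diff (act T (A i)) (act S (A i))) +
         measure M (sym_diff (act (inv\<^bsub>Aut M\<^esub> T) (A i)) (act (inv\<^bsub>Aut M\<^esub> S) (A i))))"
      by (intro mult_left_mono) auto
    also have "\<dots> = (\<Sum>\<^sub>\<infinity>i\<in>{i}. (1/2) ^ i * (measure M (sym_diff (act T (A i)) (act S (A i))) +
         measure M (sym_diff (act (inv\<^bsub>Aut M\<^esub> T) (A i)) (act (inv\<^bsub>Aut M\<^esub> S) (A i)))))" by simp
    also have "\<dots> \<le> rho M A T S" unfolding rho_def
      by (rule infsum_mono_neutral[OF _ rho_summable[OF d T S]]) (use i in auto)
    also have "\<dots> < (1/2) ^ i * (e / 3)" using r_metric_ge_rho[OF d, of T S] r by (simp add: \<delta>_def)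
    finally have c: "measure M (sym_diff (rep T ` A i) (rep S ` A i)) < e / 3" by (simp add: act_def)
    note fm = aut_image_fmeasurable(1)[OF rep_aut]
    have "measure M (sym_diff (rep T ` B) (rep S ` B)) \<le> measure M (sym_diff (rep T ` B) (rep T ` A i)) + measure M (sym_diff (rep T ` A i) (rep S ` B))"
      by (rule measure_sym_diff_triangle; intro fm S T Ai B)
    also have "measure M (sym_diff (rep T ` A i) (rep S ` B)) \<le> measure M (sym_diff (rep T ` A i) (rep S ` A i)) + measure M (sym_diff (rep S ` A i) (rep S ` B))"
      by (rule measure_sym_diff_triangle; intro fm S T Ai B)
    finally show ?thesis using c im[OF T] im[OF S] by (simp add: sym_diff_commute[of "rep S ` A i"])
  qed
  moreover have "0 < \<delta>" using e by (simp add: \<delta>_def)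
  ultimately show ?thesis by blast
qed

lemma rep_funpow_image_close:
  assumes d: "dense_family M A" and T: "T \<in> carrier (Aut M)" and B: "B \<in> fmeasurable M" and e: "0 < e"
  shows "\<exists>\<delta>>0. \<forall>S\<in>carrier (Aut M). r_metric M A T S < \<delta> \<longrightarrow>
    measure M (sym_diff ((rep T ^^ n) ` B) ((rep S ^^ n) ` B)) < e"
  using e
proof (induction n arbitrary: e)
  case 0
  then show ?case by (intro exI[of _ 1]) auto
next
  case (Suc n)
  note fn = aut_image_fmeasurable(1)[OF aut_maps_funpow[OF rep_aut] B]
  note f1 = aut_image_fmeasurable(1)[OF rep_aut]
  obtain \<delta>1 where \<delta>1: "0 < \<delta>1" "\<And>S. S \<in> carrier (Aut M) \<Longrightarrow> r_metric M A T S < \<delta>1 \<Longrightarrow>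
      measure M (sym_diff ((rep T ^^ n) ` B) ((rep S ^^ n) ` B)) < e / 2" using Suc.IH[of "e / 2"] Suc.prems by auto
  obtain \<delta>2 where \<delta>2: "0 < \<delta>2" "\<And>S. S \<in> carrier (Aut M) \<Longrightarrow> r_metric M A T S < \<delta>2 \<Longrightarrow>
      measure M (sym_diff (rep T ` (rep T ^^ n) ` B) (rep S ` (rep T ^^ n) ` B)) < e / 2"
    using rep_image_close[OF d T fn[OF T, of n], of "e / 2"] Suc.prems by auto
  have "measure M (sym_diff ((rep T ^^ Suc n) ` B) ((rep S ^^ Suc n) ` B)) < e"
    if S: "S \<in> carrier (Aut M)" "r_metric M A T S < min \<delta>1 \<delta>2" for S
  proof -
    let ?X = "(rep T ^^ n) ` B" and ?Y = "(rep S ^^ n) ` B"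
    have "measure M (sym_diff (rep T ` ?X) (rep S ` ?Y)) \<le> measure M (sym_diff (rep T ` ?X) (rep S ` ?X)) + measure M (sym_diff (rep S ` ?X) (rep S ` ?Y))"
      by (rule measure_sym_diff_triangle; intro f1 fn S T)
    also have "measure M (sym_diff (rep S ` ?X) (rep S ` ?Y)) = measure M (sym_diff ?X ?Y)"
      using aut_image_set_ops(3)[OF rep_aut[OF S(1)] fmeasurable_subset_space[OF fn[OF T]] fmeasurable_subset_space[OF fn[OF S(1)]]]
        aut_image_fmeasurable(2)[OF rep_aut[OF S(1)] fmeasurable_sym_diff[OF fn[OF T] fn[OF S(1)]]] by simp
    finally show ?thesis using \<delta>1(2)[OF S(1)] \<delta>2(2)[OF S(1)] S(2) by (simp add: image_comp)
  qed
  then show ?case using \<delta>1(1) \<delta>2(1) by (intro exI[of _ "min \<delta>1 \<delta>2"]) auto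
qed

text \<open>A nearby \<open>S\<close> moves each of the finitely many levels only slightly, but
  disjointness must hold exactly. The small overlaps are cut out of the base.\<close>

lemma tower_approx_open:
  assumes d: "dense_family M A" and T: "T \<in> carrier (Aut M)" and fin: "finite \<B>" and sub: "\<B> \<subseteq> fmeasurable M"
    and tow: "tower_approx M (rep T) \<B> \<epsilon>"
  shows "\<exists>\<delta>>0. \<forall>S\<in>carrier (Aut M). r_metric M A T S < \<delta> \<longrightarrow> tower_approx M (rep S) \<B> \<epsilon>"
proof -
  let ?f = "rep T"
  note f = rep_aut[OF T]
  obtain F H where F: "F \<in> fmeasurable M" "measure M F < \<epsilon>"
    and disj: "disjoint_family_on (\<lambda>n. (?f ^^ n) ` F) {..<H}"
    and ap: "\<forall>B\<in>\<B>. \<exists>Q\<subseteq>{..<H}. measure M (sym_diff B (\<Union>n\<in>Q. (?f ^^ n) ` F)) < \<epsilon>"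
    using tow unfolding tower_approx_def by blast
  obtain Q where Q: "\<And>B. B \<in> \<B> \<Longrightarrow> Q B \<subseteq> {..<H}"
    "\<And>B. B \<in> \<B> \<Longrightarrow> measure M (sym_diff B (\<Union>n\<in>Q B. (?f ^^ n) ` F)) < \<epsilon>"
    using ap by metis
  define gap where "gap = Min (insert 1 ((\<lambda>B. \<epsilon> - measure M (sym_diff B (\<Union>n\<in>Q B. (?f ^^ n) ` F))) ` \<B>))"
  have gap: "0 < gap" unfolding gap_def using fin Q(2) by (subst Min_gr_iff) auto
  have gap_le: "measure M (sym_diff B (\<Union>n\<in>Q B. (?f ^^ n) ` F)) + gap \<le> \<epsilon>" if "B \<in> \<B>" for B
  proof -
    have "gap \<le> \<epsilon> - measure M (sym_diff B (\<Union>n\<in>Q B. (?f ^^ n) ` F))"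
      unfolding gap_def by (rule Min_le) (use fin that in auto)
    then show ?thesis by simp
  qed
  \<comment> \<open>Each level changes by at most \<open>(H + 1) * e\<close> and at most
    \<open>H\<close> levels occur, so a union of levels changes by at most
    \<open>gap / 2\<close>.\<close>
  define e where "e = gap / (2 * (real H + 1)\<^sup>2)"
  have e: "0 < e" using gap by (auto simp: e_def intro!: divide_pos_pos)
  have "\<exists>\<delta>>0. \<forall>n<H. \<forall>S\<in>carrier (Aut M). r_metric M A T S < \<delta> \<longrightarrow>
    measure M (sym_diff ((?f ^^ n) ` F) ((rep S ^^ n) ` F)) < e" for H
  proof (induction H)
    case (Suc H)
    then obtain \<delta>1 where "0 < \<delta>1" "\<forall>n<H. \<forall>S\<in>carrier (Aut M). r_metric M A T S < \<delta>1 \<longrightarrow>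
      measure M (sym_diff ((?f ^^ n) ` F) ((rep S ^^ n) ` F)) < e" by blast
    moreover obtain \<delta>2 where "0 < \<delta>2" "\<forall>S\<in>carrier (Aut M). r_metric M A T S < \<delta>2 \<longrightarrow>
      measure M (sym_diff ((?f ^^ H) ` F) ((rep S ^^ H) ` F)) < e" using rep_funpow_image_close[OF d T F(1) e] by blast
    ultimately show ?case by (intro exI[of _ "min \<delta>1 \<delta>2"]) (auto simp: less_Suc_eq)
  qed (use zero_less_one in blast)
  from this[of H] obtain \<delta> where \<delta>0: "0 < \<delta> \<and> (\<forall>n<H. \<forall>S\<in>carrier (Aut M). r_metric M A T S < \<delta> \<longrightarrow>
    measure M (sym_diff ((?f ^^ n) ` F) ((rep S ^^ n) ` F)) < e)" by (rule exE)
  then have \<delta>: "0 < \<delta>" "\<And>n S. n < H \<Longrightarrow> S \<in> carrier (Aut M) \<Longrightarrow> r_metric M A T S < \<delta> \<Longrightarrow>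
    measure M (sym_diff ((?f ^^ n) ` F) ((rep S ^^ n) ` F)) < e" by simp_all
  have "tower_approx M (rep S) \<B> \<epsilon>" if S: "S \<in> carrier (Aut M)" "r_metric M A T S < \<delta>" for S
  proof -
    let ?s = "rep S"
    note sn = aut_maps_funpow[OF rep_aut[OF S(1)]] and fn = aut_maps_funpow[OF f]
    \<comment> \<open>Deleting from the base what its later images hit makes all images of the rest
      disjoint: images at distance \<open>n - m\<close> are shifts of \<open>F'\<close> and of its
      image under that power.\<close>
    define N where "N = (\<Union>n\<in>{1..<H}. (?s ^^ n) ` F)"
    define F' where "F' = F - N"
    have N: "N \<in> fmeasurable M" unfolding N_def
      by (intro fmeasurable.finite_UN aut_image_fmeasurable(1)[OF sn] F(1)) simp
    have F': "F' \<in> fmeasurable M" unfolding F'_def using F(1) N by (intro fmeasurable_Diff) auto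
    have F'F: "F' \<subseteq> F" and F'N: "F' \<inter> N = {}" by (auto simp: F'_def)
    have FN: "measure M (F \<inter> N) \<le> real H * e"
    proof -
      have "F \<inter> N = (\<Union>n\<in>{1..<H}. F \<inter> (?s ^^ n) ` F)" by (auto simp: N_def)
      also have "measure M \<dots> \<le> (\<Sum>n\<in>{1..<H}. measure M (F \<inter> (?s ^^ n) ` F))"
        using F(1) aut_image_fmeasurable(1)[OF sn F(1)] by (intro measure_UNION_le) auto
      also have "\<dots> \<le> (\<Sum>n\<in>{1..<H}. e)"
      proof (rule sum_mono)
        fix n assume n: "n \<in> {1..<H}"
        have "F \<inter> (?f ^^ n) ` F = {}" using disjoint_family_onD[OF disj, of 0 n] n by simp
        then have "measure M (F \<inter> (?s ^^ n) ` F) \<le> measure M (sym_diff ((?f ^^ n) ` F) ((?s ^^ n) ` F))"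
          using F(1) aut_image_fmeasurable(1)[OF sn F(1)] aut_image_fmeasurable(1)[OF fn F(1)]
          by (intro measure_mono_fmeasurable fmeasurable_sym_diff) auto
        also have "\<dots> < e" using n by (intro \<delta>(2)[OF _ S]) auto
        finally show "measure M (F \<inter> (?s ^^ n) ` F) \<le> e" by simp
      qed
      also have "\<dots> = real (H - 1) * e" by simp
      also have "\<dots> \<le> real H * e" using e by (intro mult_right_mono) auto
      finally show ?thesis .
    qed
    have dis: "disjoint_family_on (\<lambda>n. (?s ^^ n) ` F') {..<H}"
    proof -
      have *: "(?s ^^ m) ` F' \<inter> (?s ^^ n) ` F' = {}" if "m < n" "n < H" for m n
      proof -
        have "n - m \<in> {1..<H}" using that by auto
        then have "(?s ^^ (n - m)) ` F \<subseteq> N" unfolding N_def by (rule UN_upper)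
        then have "F' \<inter> (?s ^^ (n - m)) ` F' = {}"
          using image_mono[OF F'F, of "?s ^^ (n - m)"] F'N by blast
        moreover have "(?s ^^ n) ` F' = (?s ^^ m) ` (?s ^^ (n - m)) ` F'"
          using that by (simp add: image_comp funpow_add[symmetric])
        moreover have "(?s ^^ m) ` (F' \<inter> (?s ^^ (n - m)) ` F') = (?s ^^ m) ` F' \<inter> (?s ^^ m) ` (?s ^^ (n - m)) ` F'"
          by (intro aut_image_set_ops(1)[OF sn] fmeasurable_subset_space F' aut_image_fmeasurable(1)[OF sn])
        ultimately show ?thesis by simp
      qed
      show ?thesis unfolding disjoint_family_on_def
      proof (intro ballI impI)
        fix m n assume "m \<in> {..<H}" "n \<in> {..<H}" "m \<noteq> n"
        then consider "m < n" "n < H" | "n < m" "m < H" by fastforce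
        then show "(?s ^^ m) ` F' \<inter> (?s ^^ n) ` F' = {}" using *[of m n] *[of n m] by cases (simp, simp add: Int_commute)
      qed
    qed
    have lev: "measure M (sym_diff ((?f ^^ n) ` F) ((?s ^^ n) ` F')) \<le> (real H + 1) * e" if n: "n < H" for n
    proof -
      have "measure M (sym_diff ((?f ^^ n) ` F) ((?s ^^ n) ` F')) \<le> measure M (sym_diff ((?f ^^ n) ` F) ((?s ^^ n) ` F))
        + measure M (sym_diff ((?s ^^ n) ` F) ((?s ^^ n) ` F'))"
        by (rule measure_sym_diff_triangle) (intro aut_image_fmeasurable(1)[OF sn] aut_image_fmeasurable(1)[OF fn] F F')+
      also have "sym_diff ((?s ^^ n) ` F) ((?s ^^ n) ` F') = (?s ^^ n) ` (sym_diff F F')"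
        by (rule aut_image_set_ops(3)[symmetric, OF sn]) (intro fmeasurable_subset_space F F')+
      also have "measure M \<dots> = measure M (sym_diff F F')"
        by (rule aut_image_fmeasurable(2)[OF sn]) (intro fmeasurable_sym_diff F F')
      also have "sym_diff F F' = F \<inter> N" by (auto simp: F'_def)
      finally show ?thesis using FN \<delta>(2)[OF n S] by (simp add: algebra_simps)
    qed
    have "\<exists>Q\<subseteq>{..<H}. measure M (sym_diff B (\<Union>n\<in>Q. (?s ^^ n) ` F')) < \<epsilon>" if B: "B \<in> \<B>" for B
    proof -
      have fQ: "finite (Q B)" using Q(1)[OF B] finite_subset by blast
      let ?U = "\<Union>n\<in>Q B. (?f ^^ n) ` F" and ?V = "\<Union>n\<in>Q B. (?s ^^ n) ` F'"
      have lf: "sym_diff ((?f ^^ n) ` F) ((?s ^^ n) ` F') \<in> fmeasurable M" for n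
        by (intro fmeasurable_sym_diff aut_image_fmeasurable(1)[OF sn] aut_image_fmeasurable(1)[OF fn] F F')
      have Uf: "?U \<in> fmeasurable M" "?V \<in> fmeasurable M"
        by (intro fmeasurable.finite_UN fQ aut_image_fmeasurable(1)[OF sn] aut_image_fmeasurable(1)[OF fn] F F')+
      have "measure M (sym_diff ?U ?V) \<le> measure M (\<Union>n\<in>Q B. sym_diff ((?f ^^ n) ` F) ((?s ^^ n) ` F'))"
        by (rule measure_mono_fmeasurable[OF _ fmeasurableD[OF fmeasurable_sym_diff[OF Uf]] fmeasurable.finite_UN[OF fQ lf]]) blast
      also have "\<dots> \<le> (\<Sum>n\<in>Q B. measure M (sym_diff ((?f ^^ n) ` F) ((?s ^^ n) ` F')))"
        by (rule measure_UNION_le[OF fQ fmeasurableD[OF lf]])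
      also have "\<dots> \<le> (\<Sum>n\<in>Q B. (real H + 1) * e)" using Q(1)[OF B] by (intro sum_mono lev) auto
      also have "\<dots> \<le> (real H + 1) * ((real H + 1) * e)"
      proof -
        have "card (Q B) \<le> H" using card_mono[OF _ Q(1)[OF B]] by simp
        then show ?thesis using e by (simp add: mult_right_mono)
      qed
      also have "\<dots> = (real H + 1)\<^sup>2 * e" by (simp only: power2_eq_square mult.assoc)
      also have "\<dots> = gap / 2"
      proof -
        have "(real H + 1)\<^sup>2 \<noteq> 0" by simp
        then show ?thesis unfolding e_def by simp
      qed
      finally have UV: "measure M (sym_diff ?U ?V) \<le> gap / 2" .
      have "measure M (sym_diff B ?V) \<le> measure M (sym_diff B ?U) + measure M (sym_diff ?U ?V)"
        using B sub Uf by (intro measure_sym_diff_triangle) auto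
      then have "measure M (sym_diff B ?V) < \<epsilon>" using gap_le[OF B] UV gap by linarith
      then show ?thesis using Q(1)[OF B] by blast
    qed
    moreover have "measure M F' < \<epsilon>"
      using measure_mono_fmeasurable[OF F'F fmeasurableD[OF F'] F(1)] F(2) by linarith
    ultimately show ?thesis unfolding tower_approx_def using F' dis by blast
  qed
  then show ?thesis using \<delta>(1) by blast
qed

text \<open>Reduces the tower condition to countably many instances: for large \<open>m\<close> the
  sets \<open>A i\<close> with \<open>i \<le> m\<close> come close to those of \<open>\<B>\<close>,
  and the precision is below \<open>\<epsilon> / 2\<close>.\<close>

lemma tower_approx_dense_family:
  assumes d: "dense_family M A" and tow: "\<And>m. tower_approx M f (A ` {1..m}) (1 / Suc m)"
    and f: "f \<in> aut_maps M" and fin: "finite \<B>" and sub: "\<B> \<subseteq> fmeasurable M" and e: "0 < \<epsilon>"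
  shows "tower_approx M f \<B> \<epsilon>"
proof -
  have "\<exists>i\<ge>1. measure M (sym_diff (A i) B) < \<epsilon> / 2" if "B \<in> \<B>" for B
    using d sub that e unfolding dense_family_def by (meson half_gt_zero subsetD)
  then obtain i where i: "\<And>B. B \<in> \<B> \<Longrightarrow> 1 \<le> i B" "\<And>B. B \<in> \<B> \<Longrightarrow> measure M (sym_diff (A (i B)) B) < \<epsilon> / 2"
    by metis
  obtain n where n: "1 / real (Suc n) < \<epsilon> / 2" using nat_approx_posE[of "\<epsilon> / 2"] e by auto
  define m where "m = Max (insert n (i ` \<B>))"
  have m: "n \<le> m" "\<And>B. B \<in> \<B> \<Longrightarrow> i B \<le> m" unfolding m_def using fin by auto
  have "1 / real (Suc m) \<le> 1 / real (Suc n)" using m(1) by (simp add: frac_le)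
  then have m2: "1 / real (Suc m) < \<epsilon> / 2" using n by linarith
  obtain F H where F: "F \<in> fmeasurable M" "measure M F < 1 / Suc m"
    and disj: "disjoint_family_on (\<lambda>n. (f ^^ n) ` F) {..<H}"
    and ap: "\<And>B. B \<in> A ` {1..m} \<Longrightarrow> \<exists>Q\<subseteq>{..<H}. measure M (sym_diff B (\<Union>n\<in>Q. (f ^^ n) ` F)) < 1 / Suc m"
    using tow[of m] unfolding tower_approx_def by blast
  have "\<exists>Q\<subseteq>{..<H}. measure M (sym_diff B (\<Union>n\<in>Q. (f ^^ n) ` F)) < \<epsilon>" if B: "B \<in> \<B>" for B
  proof -
    obtain Q where Q: "Q \<subseteq> {..<H}" "measure M (sym_diff (A (i B)) (\<Union>n\<in>Q. (f ^^ n) ` F)) < 1 / Suc m"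
      using ap[of "A (i B)"] i(1)[OF B] m(2)[OF B] by auto
    have fQ: "finite Q" using Q(1) finite_subset by blast
    have "measure M (sym_diff B (\<Union>n\<in>Q. (f ^^ n) ` F)) \<le> measure M (sym_diff B (A (i B))) + measure M (sym_diff (A (i B)) (\<Union>n\<in>Q. (f ^^ n) ` F))"
    proof (rule measure_sym_diff_triangle)
      show "B \<in> fmeasurable M" using B sub by blast
      show "A (i B) \<in> fmeasurable M" using d i(1)[OF B] by (auto simp: dense_family_def)
      show "(\<Union>n\<in>Q. (f ^^ n) ` F) \<in> fmeasurable M"
        by (intro fmeasurable.finite_UN fQ aut_image_fmeasurable(1)[OF aut_maps_funpow[OF f]] F)
    qed
    also have "measure M (sym_diff B (A (i B))) < \<epsilon> / 2" using i(2)[OF B] by (simp add: sym_diff_commute[of B])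
    finally have "measure M (sym_diff B (\<Union>n\<in>Q. (f ^^ n) ` F)) < \<epsilon>" using Q(2) m2 by linarith
    then show ?thesis using Q(1) by blast
  qed
  moreover have "measure M F < \<epsilon>" using F(2) m2 e by linarith
  ultimately show ?thesis unfolding tower_approx_def using F(1) disj by blast
qed

section \<open>Approximation by mixing maps of rank one\<close>

lemma piso_funpow: "piso M M P P f \<Longrightarrow> piso M M P P (f ^^ n)"
proof (induction n)
  case 0
  then show ?case using pisoD(1)[OF 0] by (auto simp: piso_def bij_betw_def)
next
  case (Suc n)
  have "piso M M P P (f \<circ> f ^^ n)" by (rule piso_comp[OF Suc.IH[OF Suc.prems] Suc.prems])
  then show ?case by (simp add: comp_def)
qed

lemma null_Diff_trans:
  assumes "A - B \<in> null_sets M" "B - C \<in> null_sets M" "A \<in> sets M" "C \<in> sets M"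
  shows "A - C \<in> null_sets M"
  by (rule null_sets_subset[OF null_sets.Un[OF assms(1,2)]]) (use assms(3,4) in auto)

lemma piso_null_vimage:
  assumes "piso M N P Q f" "E \<in> null_sets N" "E \<subseteq> Q"
  shows "f -` E \<inter> P \<in> null_sets M"
  using pisoD(8)[OF assms(1) null_setsD2[OF assms(2)] assms(3)]
    piso_emeasure_vimage[OF assms(1) null_setsD2[OF assms(2)] assms(3)] null_setsD1[OF assms(2)] by (intro null_setsI) auto

text \<open>Both sides have the half-line as normal form, and pulling back the common part
  \<open>J\<close> of the two images matches them. This later joins the complements of a partial
  identification.\<close>

lemma piso_infinite:
  assumes iso: "isomorphic_mod0 M (lebesgue :: real measure)"
    and P: "P \<in> sets M" "emeasure M P = \<infinity>"
    and Q: "Q \<in> sets lebesgue" "Q \<subseteq> {0::real..}" "emeasure lebesgue Q = \<infinity>"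
  shows "\<exists>P' Q' f. P' \<subseteq> P \<and> P - P' \<in> null_sets M \<and> Q' \<subseteq> Q \<and> Q - Q' \<in> null_sets lebesgue \<and> piso M lebesgue P' Q' f"
proof -
  have I: "{x::real. 0 \<le> x \<and> ennreal x < \<infinity>} = {0..}" by auto
  obtain P1 g1 and I1 :: "real set" where 1: "P1 \<subseteq> P" "P - P1 \<in> null_sets M" "I1 \<subseteq> {0..}" "{0..} - I1 \<in> null_sets lebesgue" "piso M lebesgue P1 I1 g1"
    using piso_standard[OF iso P(1)] unfolding P(2) I by blast
  obtain Q2 g2 and I2 :: "real set" where 2: "Q2 \<subseteq> Q" "Q - Q2 \<in> null_sets lebesgue" "I2 \<subseteq> {0..}" "{0..} - I2 \<in> null_sets lebesgue" "piso lebesgue lebesgue Q2 I2 g2"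
    using piso_initial_segment[OF Q(1,2)] unfolding Q(3) I by blast
  define J where "J = I1 \<inter> I2"
  have J: "J \<in> sets lebesgue" "J \<subseteq> I1" "J \<subseteq> I2" using pisoD(2)[OF 1(5)] pisoD(2)[OF 2(5)] by (auto simp: J_def)
  have J1: "I1 - J \<in> null_sets lebesgue" by (rule null_sets_completion_subset[OF _ 2(4)]) (use 1(3) in \<open>auto simp: J_def\<close>)
  have J2: "I2 - J \<in> null_sets lebesgue" by (rule null_sets_completion_subset[OF _ 1(4)]) (use 2(3) in \<open>auto simp: J_def\<close>)
  define P' Q' where "P' = g1 -` J \<inter> P1" and "Q' = g2 -` J \<inter> Q2"
  have p: "piso M lebesgue P' J g1" unfolding P'_def by (rule piso_vimage[OF 1(5) J(1,2)])
  have q: "piso lebesgue lebesgue Q' J g2" unfolding Q'_def by (rule piso_vimage[OF 2(5) J(1,3)])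
  have "P1 - P' = g1 -` (I1 - J) \<inter> P1" using pisoD(5)[OF 1(5)] by (auto simp: P'_def)
  then have "P1 - P' \<in> null_sets M" using piso_null_vimage[OF 1(5) J1] by auto
  then have "P - P' \<in> null_sets M" by (rule null_Diff_trans[OF 1(2)]) (use P pisoD(1)[OF p] in auto)
  moreover have "Q2 - Q' = g2 -` (I2 - J) \<inter> Q2" using pisoD(5)[OF 2(5)] by (auto simp: Q'_def)
  then have "Q2 - Q' \<in> null_sets lebesgue" using piso_null_vimage[OF 2(5) J2] by auto
  then have "Q - Q' \<in> null_sets lebesgue" by (rule null_Diff_trans[OF 2(2)]) (use Q pisoD(1)[OF q] in auto)
  moreover have "P' \<subseteq> P" "Q' \<subseteq> Q" using 1(1) 2(1) by (auto simp: P'_def Q'_def)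
  ultimately show ?thesis using piso_comp[OF p piso_inv[OF q]] by blast
qed

text \<open>Replaces images under powers by sets of starting points, where two maps can be compared
  pointwise.\<close>

lemma measure_funpow_Int:
  assumes f: "f \<in> aut_maps M" and A: "A \<in> fmeasurable M" and B: "B \<in> fmeasurable M"
  shows "{x\<in>A. (f ^^ n) x \<in> B} \<in> fmeasurable M"
    "measure M ((f ^^ n) ` A \<inter> B) = measure M {x\<in>A. (f ^^ n) x \<in> B}"
proof -
  note fn = aut_maps_funpow[OF f, of n]
  have "{x\<in>A. (f ^^ n) x \<in> B} = A \<inter> ((f ^^ n) -` B \<inter> space M)"
    using fmeasurable_subset_space[OF A] by auto
  then have "{x\<in>A. (f ^^ n) x \<in> B} \<in> sets M"
    using A measurable_sets[OF aut_mapsD(2)[OF fn], of B] B by auto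
  then show fm: "{x\<in>A. (f ^^ n) x \<in> B} \<in> fmeasurable M" by (rule fmeasurableI2[OF A, rotated]) auto
  have "(f ^^ n) ` A \<inter> B = (f ^^ n) ` {x\<in>A. (f ^^ n) x \<in> B}" by auto
  then show "measure M ((f ^^ n) ` A \<inter> B) = measure M {x\<in>A. (f ^^ n) x \<in> B}"
    using aut_image_fmeasurable(2)[OF fn fm] by simp
qed

text \<open>The full two-sided orbit of a null set is null and invariant. After its removal, exact
  statements propagate along orbits.\<close>

lemma piso_invariant_core:
  assumes f: "piso M M P P f" and B: "B \<in> null_sets M" "B \<subseteq> P"
  shows "\<exists>G. G \<in> sets M \<and> G \<subseteq> P - B \<and> P - G \<in> null_sets M \<and> f ` G = G"
proof -
  define g where "g = inv_into P f"
  have g: "piso M M P P g" unfolding g_def by (rule piso_inv[OF f])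
  have fg: "f (g x) = x" and gf: "g (f x) = x" and fP: "f x \<in> P" and gP: "g x \<in> P" if "x \<in> P" for x
    using that pisoD(4,5)[OF f] pisoD(5)[OF g] by (auto simp: g_def f_inv_into_f inv_into_f_f)
  note fn = piso_funpow[OF f] and gn = piso_funpow[OF g]
  define Z where "Z = (\<Union>n. (f ^^ n) ` B \<union> (g ^^ n) ` B)"
  have Z_iff: "x \<in> Z \<longleftrightarrow> (\<exists>n. \<exists>b\<in>B. x = (f ^^ n) b \<or> x = (g ^^ n) b)" for x by (auto simp: Z_def)
  have Z: "Z \<in> null_sets M" unfolding Z_def
    by (intro null_sets_UN null_sets.Un piso_null[OF fn B] piso_null[OF gn B])
  have BZ: "B \<subseteq> Z" using Z_iff by (metis funpow_0 subsetI)
  have fZ: "f x \<in> Z" and gZ: "g x \<in> Z" if x: "x \<in> Z" for x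
  proof -
    obtain n b where b: "b \<in> B" and n: "x = (f ^^ n) b \<or> x = (g ^^ n) b" using x Z_iff by blast
    have P: "(f ^^ m) b \<in> P" "(g ^^ m) b \<in> P" for m
      using b B(2) pisoD(5)[OF fn, of m] pisoD(5)[OF gn, of m] by blast+
    have "f x = (f ^^ Suc n) b \<or> (\<exists>m. f x = (g ^^ m) b) \<or> f x = (f ^^ Suc 0) b"
      using n fg[OF P(2)] by (cases n) auto
    then show "f x \<in> Z" using b Z_iff by blast
    have "g x = (g ^^ Suc n) b \<or> (\<exists>m. g x = (f ^^ m) b) \<or> g x = (g ^^ Suc 0) b"
      using n gf[OF P(1)] by (cases n) auto
    then show "g x \<in> Z" using b Z_iff by blast
  qed
  have "f ` (P - Z) = P - Z"
  proof
    show "f ` (P - Z) \<subseteq> P - Z" using fP gf gZ by force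
    show "P - Z \<subseteq> f ` (P - Z)"
    proof
      fix y assume y: "y \<in> P - Z"
      then have "f (g y) = y" "g y \<in> P" using fg gP by auto
      moreover from this have "g y \<notin> Z" using fZ[of "g y"] y by auto
      ultimately show "y \<in> f ` (P - Z)" by (metis DiffI image_eqI)
    qed
  qed
  moreover have "P - (P - Z) \<in> null_sets M"
    by (rule null_sets_subset[OF Z]) (use Z pisoD(1)[OF f] in auto)
  moreover have "P - Z \<in> sets M" using Z pisoD(1)[OF f] by auto
  ultimately show ?thesis using BZ by (intro exI[of _ "P - Z"]) auto
qed

section \<open>Transport of the model to the given space\<close>

context rank_one_model
begin

text \<open>\<open>S\<close> need not preserve \<open>Q\<close>, which is only almost all of the
  half-line, but it preserves an invariant core \<open>Q'\<close>. The conjugate of \<open>S\<close>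
  acts on the preimage \<open>D\<close> of \<open>Q'\<close>, and the identity on the null
  complement completes it to a bijection of the space.\<close>

lemma S_pullback:
  fixes M :: "'a measure"
  assumes \<phi>: "piso M lebesgue P Q \<phi>" and P: "space M - P \<in> null_sets M"
    and Q: "Q \<subseteq> {0..}" "{0..} - Q \<in> null_sets lebesgue"
  shows "\<exists>R D. R \<in> aut_maps M \<and> D \<in> sets M \<and> D \<subseteq> P \<and> space M - D \<in> null_sets M \<and> R ` D = D \<and>
    (\<forall>x\<in>D. \<phi> (R x) = S (\<phi> x))"
proof -
  have "{0..} - Q \<subseteq> {0..}" by blast
  from piso_invariant_core[OF S_piso Q(2) this] obtain Q' where
    Q's: "Q' \<in> sets lebesgue" and Q'0: "Q' \<subseteq> {0..} - ({0..} - Q)" and Q'n: "{0..} - Q' \<in> null_sets lebesgue"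
    and SQ': "S ` Q' = Q'" by blast
  have Q'Q: "Q' \<subseteq> Q" and Q'p: "Q' \<subseteq> {0..}" using Q'0 by auto
  have QQ': "Q - Q' \<in> null_sets lebesgue" by (rule null_sets_completion_subset[OF _ Q'n]) (use Q(1) in auto)
  define D where "D = \<phi> -` Q' \<inter> P"
  have \<phi>D: "piso M lebesgue D Q' \<phi>" unfolding D_def by (rule piso_vimage[OF \<phi> Q's Q'Q])
  have Ds: "D \<in> sets M" "D \<subseteq> space M" using pisoD(1)[OF \<phi>D] sets.sets_into_space by auto
  have "P - D = \<phi> -` (Q - Q') \<inter> P" using pisoD(5)[OF \<phi>] by (auto simp: D_def)
  then have "P - D \<in> null_sets M" using piso_null_vimage[OF \<phi> QQ'] by auto
  then have Dn: "space M - D \<in> null_sets M" by (rule null_Diff_trans[OF P]) (use Ds in auto)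
  have SQ: "piso lebesgue lebesgue Q' Q' S" using piso_subset[OF S_piso Q's Q'p] SQ' by simp
  define R0 where "R0 = inv_into D \<phi> \<circ> (S \<circ> \<phi>)"
  have R0: "piso M M D D R0" unfolding R0_def by (rule piso_comp[OF piso_comp[OF \<phi>D SQ] piso_inv[OF \<phi>D]])
  define R where "R x = (if x \<in> D then R0 x else x)" for x
  have RD: "piso M M D D R" by (rule piso_cong[OF R0]) (simp add: R_def)
  have RC: "piso M M (space M - D) (space M - D) R"
    by (rule piso_cong[of _ _ _ _ id]) (use Ds in \<open>auto simp: R_def piso_def\<close>)
  have "piso M M (D \<union> (space M - D)) (R ` (D \<union> (space M - D))) R"
  proof (rule piso_Un)
    have "R ` D \<inter> R ` (space M - D) = {}" using pisoD(5)[OF RD] pisoD(5)[OF RC] by auto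
    then have "R ` (D - (space M - D)) \<inter> R ` (space M - D - D) = {}" by blast
    then show "inj_on R (D \<union> (space M - D))"
      by (intro inj_on_Un[THEN iffD2] conjI pisoD(4)[OF RD] pisoD(4)[OF RC])
  qed (use RD RC pisoD(5)[OF RD] pisoD(5)[OF RC] in auto)
  moreover have "D \<union> (space M - D) = space M" using Ds by auto
  moreover have "R ` (D \<union> (space M - D)) = space M" unfolding image_Un pisoD(5)[OF RD] pisoD(5)[OF RC] using Ds by blast
  ultimately have "R \<in> aut_maps M" by (simp add: aut_maps_iff_piso)
  moreover have "\<phi> (R x) = S (\<phi> x)" if x: "x \<in> D" for x
  proof -
    have "\<phi> x \<in> Q'" using x by (simp add: D_def)
    then have "S (\<phi> x) \<in> \<phi> ` D" using SQ' pisoD(5)[OF \<phi>D] by blast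
    then have "\<phi> (inv_into D \<phi> (S (\<phi> x))) = S (\<phi> x)" by (rule f_inv_into_f)
    then show ?thesis using x by (simp add: R_def R0_def)
  qed
  ultimately show ?thesis using Ds Dn pisoD(5)[OF RD] D_def by blast
qed

lemma S_factor_funpow:
  assumes "R ` D = D" "\<And>x. x \<in> D \<Longrightarrow> \<phi> (R x) = S (\<phi> x)" "x \<in> D"
  shows "(R ^^ n) x \<in> D \<and> \<phi> ((R ^^ n) x) = (S ^^ n) (\<phi> x)"
  using assms by (induction n) auto

text \<open>Covering sets and towers of the model survive pulling back along \<open>\<phi>\<close>,
  which is injective and measure-preserving, and discarding the null set outside
  \<open>D\<close>.\<close>

lemma S_factor_properties:
  fixes M :: "'a measure"
  assumes \<phi>: "piso M lebesgue P Q \<phi>" and Q: "Q \<subseteq> {0..}"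
    and R: "R \<in> aut_maps M" and D: "D \<in> sets M" "D \<subseteq> P" "space M - D \<in> null_sets M" "R ` D = D"
    and eq: "\<And>x. x \<in> D \<Longrightarrow> \<phi> (R x) = S (\<phi> x)"
  shows "mixing_map M R"
    "\<And>\<B> \<epsilon>. finite \<B> \<Longrightarrow> \<B> \<subseteq> fmeasurable M \<Longrightarrow> 0 < \<epsilon> \<Longrightarrow> tower_approx M R \<B> \<epsilon>"
proof -
  have it: "(R ^^ n) x \<in> D \<and> \<phi> ((R ^^ n) x) = (S ^^ n) (\<phi> x)" if "x \<in> D" for x n
    by (rule S_factor_funpow[where R=R and D=D and \<phi>=\<phi>]) (use D(4) eq that in auto)
  \<comment> \<open>The exceptional null set is included, so that inclusions need to be checked on
    \<open>D\<close> only.\<close>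
  define pre where "pre Z = (\<phi> -` (Z \<inter> Q) \<inter> P) \<union> (space M - D)" for Z
  have pre: "pre Z \<in> fmeasurable M" "measure M (pre Z) \<le> measure lebesgue Z" if Z: "Z \<in> lmeasurable" for Z
  proof -
    have ZQ: "Z \<inter> Q \<in> sets lebesgue" "Z \<inter> Q \<subseteq> Q" using Z pisoD(2)[OF \<phi>] by auto
    have ZQf: "Z \<inter> Q \<in> lmeasurable" by (rule fmeasurableI2[OF Z]) (use ZQ in auto)
    have "emeasure M (\<phi> -` (Z \<inter> Q) \<inter> P) = emeasure lebesgue (Z \<inter> Q)" by (rule piso_emeasure_vimage[OF \<phi> ZQ])
    moreover have s: "\<phi> -` (Z \<inter> Q) \<inter> P \<in> sets M" by (rule pisoD(8)[OF \<phi> ZQ])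
    ultimately have "emeasure M (pre Z) = emeasure lebesgue (Z \<inter> Q)"
      using emeasure_Un_null_set[OF s D(3)] by (simp add: pre_def)
    moreover have "pre Z \<in> sets M" using s D by (auto simp: pre_def)
    ultimately show "pre Z \<in> fmeasurable M" "measure M (pre Z) \<le> measure lebesgue Z"
      using ZQf ZQ(1) Z measure_mono_fmeasurable[of "Z \<inter> Q" Z lebesgue] by (auto simp: fmeasurable_def measure_def)
  qed
  have im: "\<phi> ` (A \<inter> D) \<in> lmeasurable \<and> \<phi> ` (A \<inter> D) \<subseteq> {0..}" if A: "A \<in> fmeasurable M" for A
  proof -
    have s: "A \<inter> D \<in> sets M" "A \<inter> D \<subseteq> P" using A D by auto
    have "emeasure M (A \<inter> D) < \<infinity>"
      using emeasure_mono[of "A \<inter> D" A M] A by (auto simp: fmeasurable_def intro: le_less_trans)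
    then have "emeasure lebesgue (\<phi> ` (A \<inter> D)) < \<infinity>" using pisoD(7)[OF \<phi> s] by simp
    moreover have "\<phi> ` (A \<inter> D) \<subseteq> {0..}" using s pisoD(5)[OF \<phi>] Q by blast
    ultimately show ?thesis using pisoD(6)[OF \<phi> s] by (auto intro: fmeasurableI)
  qed
  have inj: "x = y" if "x \<in> D" "y \<in> D" "\<phi> x = \<phi> y" for x y
    using pisoD(4)[OF \<phi>] that D(2) by (auto simp: inj_on_def subset_iff)
  show "mixing_map M R" unfolding mixing_map_def
  proof (intro ballI LIMSEQ_I)
    fix A B and \<epsilon> :: real assume A: "A \<in> fmeasurable M" and B: "B \<in> fmeasurable M" and \<epsilon>: "0 < \<epsilon>"
    obtain N where N: "\<And>n. N \<le> n \<Longrightarrow> \<exists>Z\<in>lmeasurable. measure lebesgue Z < \<epsilon> \<and>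
        {x\<in>\<phi> ` (A \<inter> D). (S ^^ n) x \<in> \<phi> ` (B \<inter> D)} \<subseteq> Z"
      using S_mixing[of "\<phi> ` (A \<inter> D)" "\<phi> ` (B \<inter> D)" \<epsilon>] im[OF A] im[OF B] \<epsilon> by blast
    have "norm (measure M ((R ^^ n) ` A \<inter> B) - 0) < \<epsilon>" if n: "N \<le> n" for n
    proof -
      obtain Z where Z: "Z \<in> lmeasurable" "measure lebesgue Z < \<epsilon>"
        "{x\<in>\<phi> ` (A \<inter> D). (S ^^ n) x \<in> \<phi> ` (B \<inter> D)} \<subseteq> Z" using N[OF n] by blast
      have "{x\<in>A. (R ^^ n) x \<in> B} \<subseteq> pre Z"
      proof
        fix x assume x: "x \<in> {x\<in>A. (R ^^ n) x \<in> B}"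
        show "x \<in> pre Z"
        proof (cases "x \<in> D")
          case True
          have r: "(R ^^ n) x \<in> D" "\<phi> ((R ^^ n) x) = (S ^^ n) (\<phi> x)" using it[OF True] by auto
          have "\<phi> x \<in> \<phi> ` (A \<inter> D)" using x True by blast
          moreover have "(S ^^ n) (\<phi> x) \<in> \<phi> ` (B \<inter> D)" unfolding r(2)[symmetric] using x r(1) by blast
          ultimately have "\<phi> x \<in> Z" using Z(3) by blast
          then show ?thesis using True D(2) pisoD(5)[OF \<phi>] by (auto simp: pre_def)
        next
          case False
          then show ?thesis using x fmeasurable_subset_space[OF A] by (auto simp: pre_def)
        qed
      qed
      then have "measure M {x\<in>A. (R ^^ n) x \<in> B} \<le> measure M (pre Z)"
        using measure_funpow_Int(1)[OF R A B] pre(1)[OF Z(1)] by (intro measure_mono_fmeasurable) auto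
      then show ?thesis using pre(2)[OF Z(1)] Z(2) measure_funpow_Int(2)[OF R A B, of n] by simp
    qed
    then show "\<exists>no. \<forall>n\<ge>no. norm (measure M ((R ^^ n) ` A \<inter> B) - 0) < \<epsilon>" by blast
  qed
  fix \<B> and \<epsilon> :: real assume fin: "finite \<B>" and sub: "\<B> \<subseteq> fmeasurable M" and \<epsilon>: "0 < \<epsilon>"
  define C where "C = (\<lambda>B. \<phi> ` (B \<inter> D)) ` \<B>"
  have finC: "finite C" using fin by (simp add: C_def)
  have "B \<in> lmeasurable \<and> B \<subseteq> {0..}" if "B \<in> C" for B using that im sub by (auto simp: C_def)
  then have "\<exists>F H. F \<in> lmeasurable \<and> F \<subseteq> {0..} \<and> measure lebesgue F < \<epsilon> \<and>
    disjoint_family_on (\<lambda>n. (S ^^ n) ` F) {..<H} \<and>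
    (\<forall>B\<in>C. \<exists>Q\<subseteq>{..<H}. measure lebesgue (sym_diff B (\<Union>n\<in>Q. (S ^^ n) ` F)) < \<epsilon>)"
    by (rule S_tower[OF finC _ \<epsilon>])
  then obtain F1 H where F1: "F1 \<in> lmeasurable" "F1 \<subseteq> {0..}" "measure lebesgue F1 < \<epsilon>"
      "disjoint_family_on (\<lambda>n. (S ^^ n) ` F1) {..<H}"
    and ap: "\<forall>B\<in>C. \<exists>Q\<subseteq>{..<H}. measure lebesgue (sym_diff B (\<Union>n\<in>Q. (S ^^ n) ` F1)) < \<epsilon>"
    by (elim exE conjE) (rule that)
  define F where "F = {x\<in>D. \<phi> x \<in> F1}"
  have "F1 \<inter> Q \<in> sets lebesgue" using F1(1) pisoD(2)[OF \<phi>] by auto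
  then have "\<phi> -` (F1 \<inter> Q) \<inter> P \<in> sets M" by (rule pisoD(8)[OF \<phi>]) auto
  moreover have "F = (\<phi> -` (F1 \<inter> Q) \<inter> P) \<inter> D" using D(2) pisoD(5)[OF \<phi>] by (auto simp: F_def)
  ultimately have Fs: "F \<in> sets M" using D(1) by auto
  have Fpre: "F \<subseteq> pre F1" using D(2) pisoD(5)[OF \<phi>] by (auto simp: F_def pre_def)
  have Ff: "F \<in> fmeasurable M" by (rule fmeasurableI2[OF pre(1)[OF F1(1)] Fpre Fs])
  have "measure M F \<le> measure M (pre F1)" using Fpre Fs pre(1)[OF F1(1)] by (intro measure_mono_fmeasurable)
  then have "measure M F < \<epsilon>" using pre(2)[OF F1(1)] F1(3) by linarith
  moreover have "disjoint_family_on (\<lambda>n. (R ^^ n) ` F) {..<H}"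
    unfolding disjoint_family_on_def
  proof (intro ballI impI)
    fix m n assume mn: "m \<in> {..<H}" "n \<in> {..<H}" "m \<noteq> n"
    have "\<phi> ` (R ^^ k) ` F \<subseteq> (S ^^ k) ` F1" for k
    proof safe
      fix x assume x: "x \<in> F"
      then have "\<phi> ((R ^^ k) x) = (S ^^ k) (\<phi> x)" using it[of x k] by (simp add: F_def)
      then show "\<phi> ((R ^^ k) x) \<in> (S ^^ k) ` F1" using x by (simp add: F_def)
    qed
    moreover have "(S ^^ m) ` F1 \<inter> (S ^^ n) ` F1 = {}" using disjoint_family_onD[OF F1(4) mn] .
    ultimately show "(R ^^ m) ` F \<inter> (R ^^ n) ` F = {}" by blast
  qed
  moreover have "\<exists>Q\<subseteq>{..<H}. measure M (sym_diff B (\<Union>n\<in>Q. (R ^^ n) ` F)) < \<epsilon>" if B: "B \<in> \<B>" for B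
  proof -
    have Bf: "B \<in> fmeasurable M" using B sub by blast
    let ?B = "\<phi> ` (B \<inter> D)"
    obtain K where K: "K \<subseteq> {..<H}" "measure lebesgue (sym_diff ?B (\<Union>n\<in>K. (S ^^ n) ` F1)) < \<epsilon>"
      using bspec[OF ap, of ?B] B by (auto simp: C_def)
    have fK: "finite K" using K(1) finite_subset by blast
    let ?U = "\<Union>n\<in>K. (R ^^ n) ` F" and ?V = "\<Union>n\<in>K. (S ^^ n) ` F1"
    have Uf: "?U \<in> fmeasurable M"
      by (intro fmeasurable.finite_UN fK aut_image_fmeasurable(1)[OF aut_maps_funpow[OF R]] Ff)
    have Vf: "?V \<in> lmeasurable"
    proof (rule fmeasurable.finite_UN[OF fK])
      fix n
      have "(S ^^ n) ` F1 \<in> sets lebesgue" "emeasure lebesgue ((S ^^ n) ` F1) = emeasure lebesgue F1"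
        using pisoD(6,7)[OF piso_funpow[OF S_piso] _ F1(2)] F1(1) by auto
      then show "(S ^^ n) ` F1 \<in> lmeasurable" using F1(1) by (auto simp: fmeasurable_def)
    qed
    have sf: "sym_diff ?B ?V \<in> lmeasurable" using im[OF Bf] Vf by (intro fmeasurable_sym_diff) auto
    have "sym_diff B ?U \<subseteq> pre (sym_diff ?B ?V)"
    proof
      fix x assume x: "x \<in> sym_diff B ?U"
      have xs: "x \<in> space M" using x fmeasurable_subset_space[OF Bf] fmeasurable_subset_space[OF Uf] by blast
      show "x \<in> pre (sym_diff ?B ?V)"
      proof (cases "x \<in> D")
        case True
        have 1: "\<phi> x \<in> ?B \<longleftrightarrow> x \<in> B" using inj True by blast
        have 2: "\<phi> x \<in> ?V \<longleftrightarrow> x \<in> ?U"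
        proof
          assume "x \<in> ?U"
          then obtain n a where n: "n \<in> K" "a \<in> F" "x = (R ^^ n) a" by blast
          then have "\<phi> x = (S ^^ n) (\<phi> a)" using it[of a n] by (simp add: F_def)
          then show "\<phi> x \<in> ?V" using n by (auto simp: F_def)
        next
          assume "\<phi> x \<in> ?V"
          then obtain n y where n: "n \<in> K" "y \<in> F1" "\<phi> x = (S ^^ n) y" by blast
          have "(R ^^ n) ` D = D" using D(4) by (induction n) (simp_all only: funpow.simps image_comp[symmetric] image_id id_apply)
          then obtain a where a: "a \<in> D" "x = (R ^^ n) a" using True by blast
          have "(S ^^ n) (\<phi> a) = (S ^^ n) y" using it[OF a(1), of n] a(2) n(3) by simp
          moreover have "\<phi> a \<in> {0..}" "y \<in> {0..}" using a D(2) pisoD(5)[OF \<phi>] Q n(2) F1(2) by blast+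
          ultimately have "\<phi> a = y" using pisoD(4)[OF piso_funpow[OF S_piso, of n]] by (meson inj_onD)
          then have "a \<in> F" using a n by (simp add: F_def)
          then show "x \<in> ?U" using a(2) n(1) by blast
        qed
        have "\<phi> x \<in> sym_diff ?B ?V" using x 1 2 by blast
        moreover have "x \<in> P" "\<phi> x \<in> Q" using True D(2) pisoD(5)[OF \<phi>] by auto
        ultimately show ?thesis unfolding pre_def by blast
      qed (use xs in \<open>simp add: pre_def\<close>)
    qed
    then have "measure M (sym_diff B ?U) \<le> measure M (pre (sym_diff ?B ?V))"
      using fmeasurableD[OF fmeasurable_sym_diff[OF Bf Uf]] pre(1)[OF sf] by (intro measure_mono_fmeasurable)
    then show ?thesis using K pre(2)[OF sf] by (intro exI[of _ K]) linarith
  qed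
  ultimately show "tower_approx M R \<B> \<epsilon>" unfolding tower_approx_def using Ff by blast
qed

end

section \<open>Columns of a mixing map and the approximating map\<close>

text \<open>A point whose whole backward orbit stays in \<open>V\<close> lies in \<open>V\<close>
  and in every forward image of \<open>V\<close>, so mixing makes such points null. Continuity from
  above then gives an escape time that is uniform up to measure \<open>\<delta>\<close>.\<close>

lemma column_escape:
  assumes f: "f \<in> aut_maps M" and mix: "mixing_map M f" and V: "V \<in> fmeasurable M" and \<delta>: "0 < \<delta>"
  defines "g \<equiv> inv_into (space M) f"
  defines "D \<equiv> \<lambda>K. {x\<in>space M. \<forall>t\<le>K. (g ^^ t) x \<in> V}"
  shows "\<And>K. D K \<in> fmeasurable M" "\<exists>K. measure M (D K) < \<delta>"
proof -
  have g: "g \<in> aut_maps M" unfolding g_def by (rule aut_maps_inv[OF f])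
  note gn = aut_maps_funpow[OF g]
  show Df: "D K \<in> fmeasurable M" for K
  proof -
    have "D K = (\<Inter>t\<in>{..K}. (g ^^ t) -` V \<inter> space M)" unfolding D_def by auto
    moreover have "(\<Inter>t\<in>{..K}. (g ^^ t) -` V \<inter> space M) \<in> sets M"
      using measurable_sets[OF aut_mapsD(2)[OF gn]] V by (intro sets.finite_INT) auto
    ultimately have "D K \<in> sets M" by simp
    moreover have "D K \<subseteq> V"
    proof
      fix x assume "x \<in> D K"
      then have "(g ^^ 0) x \<in> V" unfolding D_def by blast
      then show "x \<in> V" by simp
    qed
    ultimately show ?thesis using fmeasurableI2[OF V] by blast
  qed
  define D' where "D' = (\<Inter>K. D K)"
  have D's: "D' \<in> sets M" unfolding D'_def using Df by auto
  have D'V: "(g ^^ n) x \<in> V" if "x \<in> D'" for x n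
  proof -
    have "x \<in> D n" using that by (simp add: D'_def)
    then show ?thesis unfolding D_def by blast
  qed
  have D'f: "D' \<in> fmeasurable M" by (rule fmeasurableI2[OF V _ D's]) (use D'V[of _ 0] in auto)
  have lim: "(\<lambda>K. measure M (D K)) \<longlonglongrightarrow> measure M D'"
    unfolding D'_def
  proof (rule Lim_measure_decseq)
    show "decseq D" unfolding decseq_def D_def by auto
    show "emeasure M (D i) \<noteq> \<infinity>" for i using fmeasurableD2[OF Df[of i]] by simp
  qed (use Df in auto)
  have "measure M D' \<le> measure M ((f ^^ n) ` V \<inter> V)" for n
  proof -
    have fg: "(f ^^ n) ((g ^^ n) x) = x" if "x \<in> space M" for x
      using that
    proof (induction n arbitrary: x)
      case (Suc n)
      have gx: "g x \<in> space M" using g Suc.prems aut_mapsD(1)[OF g] by (auto simp: bij_betw_def)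
      have "f (g x) = x" unfolding g_def by (rule f_inv_into_f) (use aut_mapsD(1)[OF f] Suc.prems in \<open>auto simp: bij_betw_def\<close>)
      moreover have "(f ^^ Suc n) ((g ^^ Suc n) x) = f ((f ^^ n) ((g ^^ n) (g x)))"
        by (simp only: funpow.simps(2) comp_apply) (simp only: funpow_swap1)
      ultimately show ?case using Suc.IH[OF gx] by simp
    qed simp
    have "D' \<subseteq> (f ^^ n) ` V \<inter> V"
    proof
      fix x assume x: "x \<in> D'"
      then have "x \<in> space M" using sets.sets_into_space[OF D's] by blast
      then show "x \<in> (f ^^ n) ` V \<inter> V" using fg[of x] D'V[OF x, of n] D'V[OF x, of 0] by (metis IntI funpow_0 image_eqI)
    qed
    then show ?thesis
      using D's aut_image_fmeasurable(1)[OF aut_maps_funpow[OF f] V] V by (intro measure_mono_fmeasurable) auto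
  qed
  moreover have "(\<lambda>n. measure M ((f ^^ n) ` V \<inter> V)) \<longlonglongrightarrow> 0" using mix V by (simp add: mixing_map_def)
  ultimately have "measure M D' \<le> 0" by (intro LIMSEQ_le_const) auto
  then have "measure M D' = 0" using measure_nonneg[of M D'] by linarith
  then have "\<forall>\<^sub>F K in sequentially. measure M (D K) < \<delta>" using order_tendstoD(2)[OF lim] \<delta> by simp
  then show "\<exists>K. measure M (D K) < \<delta>" by (auto simp: eventually_sequentially)
qed

lemma aut_vimage_fmeasurable:
  assumes "v \<in> aut_maps M" "A \<in> fmeasurable M"
  shows "v -` A \<inter> space M \<in> fmeasurable M" "measure M (v -` A \<inter> space M) = measure M A"
proof -
  have v: "piso M M (space M) (space M) v" using assms(1) by (simp add: aut_maps_iff_piso)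
  have A: "A \<in> sets M" "A \<subseteq> space M" using assms(2) fmeasurable_subset_space by auto
  show "v -` A \<inter> space M \<in> fmeasurable M" "measure M (v -` A \<inter> space M) = measure M A"
    using pisoD(8)[OF v A] piso_emeasure_vimage[OF v A] assms(2) by (auto simp: fmeasurable_def measure_def)
qed

lemma emeasure_Diff_infinite:
  assumes "A \<in> sets M" "B \<in> fmeasurable M" "B \<subseteq> A" "emeasure M A = \<infinity>"
  shows "emeasure M (A - B) = \<infinity>"
  using emeasure_Diff[of M B A] assms fmeasurableD2[OF assms(2)] by auto

text \<open>Follow \<open>f\<close> on a large set \<open>V\<close> of finite measure. Since \<open>f\<close> is mixing, almost every orbit leaves
  \<open>V\<close> in both directions, so \<open>V\<close> splits into columns of orbit segments. Placing all the bases of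
  these columns inside the base interval of a model with a large first spacing and carrying the
  model map back gives \<open>R\<close>, which follows \<open>f\<close> along the columns and returns rarely otherwise.\<close>

lemma approximate_by_rank_one:
  fixes M :: "'a measure"
  assumes iso: "isomorphic_mod0 M (lebesgue :: real measure)" and f: "f \<in> aut_maps M" and mix: "mixing_map M f"
    and E: "E \<in> fmeasurable M" and \<delta>: "0 < \<delta>"
  shows "\<exists>R\<in>aut_maps M. mixing_map M R \<and>
    (\<forall>\<B> \<epsilon>. finite \<B> \<longrightarrow> \<B> \<subseteq> fmeasurable M \<longrightarrow> 0 < \<epsilon> \<longrightarrow> tower_approx M R \<B> \<epsilon>) \<and>
    (\<exists>Z\<in>fmeasurable M. measure M Z < \<delta> \<and>
       (\<forall>x\<in>E - Z. R x = f x \<and> inv_into (space M) R x = inv_into (space M) f x)) \<and>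
    (\<forall>n. \<exists>Z\<in>fmeasurable M. measure M Z < \<delta> \<and>
       (\<forall>x\<in>E - Z. (R ^^ n) x \<in> E \<or> (f ^^ n) x \<in> E \<longrightarrow> (R ^^ n) x = (f ^^ n) x))"
proof -
  define g where "g = inv_into (space M) f"
  have g: "g \<in> aut_maps M" unfolding g_def by (rule aut_maps_inv[OF f])
  have fsp: "f x \<in> space M" and gsp: "g x \<in> space M" if "x \<in> space M" for x
    using aut_mapsD(1)[OF f] aut_mapsD(1)[OF g] that by (auto simp: bij_betw_def)
  have fg: "f (g x) = x" if "x \<in> space M" for x
    unfolding g_def by (rule f_inv_into_f) (use aut_mapsD(1)[OF f] that in \<open>auto simp: bij_betw_def\<close>)
  have gf: "g (f x) = x" if "x \<in> space M" for x
    unfolding g_def by (rule inv_into_f_f) (use aut_mapsD(1)[OF f] that in \<open>auto simp: bij_betw_def\<close>)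
  have gS: "(g ^^ Suc n) x = (g ^^ n) (g x)" for n x by (simp only: funpow_Suc_right comp_apply)
  have gnf: "(g ^^ Suc n) (f x) = (g ^^ n) x" if "x \<in> space M" for n x by (simp only: gS gf[OF that])
  have fngn: "(f ^^ n) ((g ^^ n) x) = x" if "x \<in> space M" for n x
    using that
  proof (induction n arbitrary: x)
    case (Suc n)
    have "(f ^^ Suc n) ((g ^^ Suc n) x) = (f ^^ Suc n) ((g ^^ n) (g x))" by (simp only: gS)
    then have "(f ^^ Suc n) ((g ^^ Suc n) x) = f ((f ^^ n) ((g ^^ n) (g x)))" by simp
    then show ?case using Suc.IH[OF gsp[OF Suc.prems]] fg[OF Suc.prems] by simp
  qed simp
  have "(\<lambda>n. measure M ((f ^^ n) ` E \<inter> E)) \<longlonglongrightarrow> 0" using mix E by (simp add: mixing_map_def)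
  then have "\<forall>\<^sub>F n in sequentially. measure M ((f ^^ n) ` E \<inter> E) < \<delta> / 4" using \<delta> by (intro order_tendstoD(2)) auto
  then obtain N0 where N0: "\<And>n. N0 \<le> n \<Longrightarrow> measure M ((f ^^ n) ` E \<inter> E) < \<delta> / 4" by (auto simp: eventually_sequentially)
  \<comment> \<open>Powers up to \<open>N\<close> are copied outside a small set; from
    \<open>N0\<close> on, the overlaps of \<open>E\<close> under \<open>f\<close> are below
    \<open>\<delta> / 4\<close>. The successor makes \<open>N\<close> positive, so that one step
    from \<open>E\<close> in either direction stays in \<open>V\<close>.\<close>
  define N where "N = Suc N0"
  define V where "V = (\<Union>n\<in>{..N}. (f ^^ n) ` E \<union> (g ^^ n) ` E)"
  have V: "V \<in> fmeasurable M" unfolding V_def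
    by (intro fmeasurable.finite_UN fmeasurable.Un aut_image_fmeasurable(1)[OF aut_maps_funpow[OF f] E]
        aut_image_fmeasurable(1)[OF aut_maps_funpow[OF g] E]) simp
  have Esp: "x \<in> space M" if "x \<in> E" for x using fmeasurable_subset_space[OF E] that by blast
  have EV: "(f ^^ n) x \<in> V" "(g ^^ n) x \<in> V" if "x \<in> E" "n \<le> N" for x n
    unfolding V_def using that by auto
  define D where "D K = {x\<in>space M. \<forall>t\<le>K. (g ^^ t) x \<in> V}" for K
  note ce = column_escape[OF f mix V, folded g_def, folded D_def]
  have Df: "D K \<in> fmeasurable M" for K using ce(1)[of 1] by simp
  obtain K where K: "measure M (D K) < \<delta> / 8" using ce(2)[of "\<delta> / 8"] \<delta> by auto
  \<comment> \<open>Floor \<open>s\<close> of the columns: the backward orbit leaves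
    \<open>V\<close> for the first time after \<open>s + 1\<close> steps. \<open>L 0\<close> is the
    common base.\<close>
  define L where "L s = D s - D (Suc s)" for s
  have Lf: "L s \<in> fmeasurable M" for s unfolding L_def using Df by (intro fmeasurable_Diff) auto
  have L_iff: "x \<in> L s \<longleftrightarrow> x \<in> space M \<and> (\<forall>t\<le>s. (g ^^ t) x \<in> V) \<and> (g ^^ Suc s) x \<notin> V" for x s
    unfolding L_def D_def by (auto simp: le_Suc_eq)
  have Lsp: "x \<in> space M" if "x \<in> L s" for x s using that L_iff by blast
  have L_ex: "\<exists>s<K. x \<in> L s" if x: "x \<in> V" "x \<notin> D K" for x
  proof -
    have xs: "x \<in> space M" using fmeasurable_subset_space[OF V] x(1) by blast
    then obtain t0 where t0: "t0 \<le> K" "(g ^^ t0) x \<notin> V" using x(2) unfolding D_def by blast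
    define t where "t = (LEAST t. (g ^^ t) x \<notin> V)"
    have t: "(g ^^ t) x \<notin> V" unfolding t_def by (rule LeastI[of _ t0]) (rule t0(2))
    have tK: "t \<le> K" using Least_le[of "\<lambda>t. (g ^^ t) x \<notin> V" t0] t0 by (simp add: t_def)
    have lt: "(g ^^ u) x \<in> V" if "u < t" for u using not_less_Least[of u "\<lambda>t. (g ^^ t) x \<notin> V"] that by (simp add: t_def)
    have "t \<noteq> 0"
    proof
      assume "t = 0"
      then show False using t x(1) by simp
    qed
    then obtain s where s: "t = Suc s" by (cases t) auto
    have "x \<in> L s" unfolding L_iff using xs t lt s by auto
    then show ?thesis using s tK by (intro exI[of _ s]) auto
  qed
  have L_unique: "s = t" if "x \<in> L s" "x \<in> L t" for x s t
  proof (rule ccontr)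
    assume "s \<noteq> t"
    then have "Suc s \<le> t \<or> Suc t \<le> s" by linarith
    then show False using that unfolding L_iff by blast
  qed
  have L_f: "f x \<in> L (Suc s)" if "x \<in> L s" "f x \<in> V" for x s
  proof -
    have xs: "x \<in> space M" using that L_iff by blast
    have "(g ^^ t) (f x) \<in> V" if "t \<le> Suc s" for t
    proof (cases t)
      case 0 then show ?thesis using \<open>f x \<in> V\<close> by simp
    next
      case (Suc u)
      then have "(g ^^ u) x \<in> V" using \<open>x \<in> L s\<close> that L_iff by auto
      then show ?thesis unfolding Suc gnf[OF xs] .
    qed
    moreover have "(g ^^ Suc (Suc s)) (f x) \<notin> V" unfolding gnf[OF xs] using that L_iff by blast
    ultimately show ?thesis unfolding L_iff using fsp[OF xs] by blast
  qed
  have L_g: "g x \<in> L s" if "x \<in> L (Suc s)" for x s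
  proof -
    have xs: "x \<in> space M" using that L_iff by blast
    have "(g ^^ t) (g x) \<in> V" if "t \<le> s" for t
    proof -
      have "(g ^^ Suc t) x \<in> V" using \<open>x \<in> L (Suc s)\<close> that unfolding L_iff by (meson Suc_le_mono)
      then show ?thesis unfolding gS .
    qed
    moreover have "(g ^^ Suc s) (g x) \<notin> V"
    proof -
      have "(g ^^ Suc (Suc s)) x \<notin> V" using that unfolding L_iff by blast
      then show ?thesis unfolding gS[of "Suc s"] .
    qed
    ultimately show ?thesis unfolding L_iff using gsp[OF xs] by blast
  qed
  have L_base: "(g ^^ s) x \<in> L 0" if "x \<in> L s" for x s
    using that
  proof (induction s arbitrary: x)
    case (Suc s)
    have "(g ^^ s) (g x) \<in> L 0" by (rule Suc.IH[OF L_g[OF Suc.prems]])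
    then show ?case unfolding gS .
  qed simp
  \<comment> \<open>Points of \<open>E\<close> outside a small set lie on floors below
    \<open>K\<close>, and \<open>N\<close> further steps keep them below \<open>H\<close>.\<close>
  define H where "H = Suc (K + N)"
  define w0 where "w0 = measure M (L 0) + 1"
  have w0: "0 < w0" using measure_nonneg[of M "L 0"] by (simp add: w0_def add_nonneg_pos)
  \<comment> \<open>There are \<open>K * K\<close> combinations of a starting and a final floor,
    each with a return set of measure at most \<open>w0 / q\<close>. The other requirement,
    \<open>H \<le> q\<close>, keeps the images of different floors apart.\<close>
  obtain q0 :: nat where q0: "4 * (real K)\<^sup>2 * w0 / \<delta> < real q0" using reals_Archimedean2 by blast
  define q where "q = max H q0"
  have qs: "1 \<le> q" "H \<le> q" by (auto simp: q_def H_def)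
  have q4: "(real K)\<^sup>2 * (w0 / real q) < \<delta> / 4"
  proof -
    have "4 * (real K)\<^sup>2 * w0 / \<delta> < real q" using q0 by (simp add: q_def)
    then show ?thesis using \<delta> qs(1) by (simp add: field_simps)
  qed
  interpret rank_one_model q w0 by unfold_locales (use qs w0 in auto)
  obtain B' C' \<phi>0 where B': "B' \<subseteq> L 0" "L 0 - B' \<in> null_sets M"
    and C': "C' \<subseteq> {x. 0 \<le> x \<and> ennreal x < emeasure M (L 0)}" and \<phi>0: "piso M lebesgue B' C' \<phi>0"
    using piso_standard[OF iso fmeasurableD[OF Lf[of 0]]] by blast
  have C'w: "C' \<subseteq> {0..<w0}"
  proof
    fix x assume x: "x \<in> C'"
    have "emeasure M (L 0) = ennreal (measure M (L 0))" using Lf[of 0] by (simp add: emeasure_eq_measure2)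
    then have "0 \<le> x" "ennreal x < ennreal (measure M (L 0))" using x C' by auto
    then have "x < measure M (L 0)" by (simp add: ennreal_less_iff)
    then show "x \<in> {0..<w0}" using \<open>0 \<le> x\<close> by (simp add: w0_def)
  qed
  have gp: "piso M M (space M) (space M) (g ^^ s)" for s using aut_maps_funpow[OF g] by (simp add: aut_maps_iff_piso)
  define L' where "L' s = L s \<inter> ((g ^^ s) -` B' \<inter> space M)" for s
  have B's: "B' \<in> sets M" "B' \<subseteq> space M" using pisoD(1)[OF \<phi>0] sets.sets_into_space by auto
  have L's: "L' s \<in> sets M" for s unfolding L'_def using Lf[of s] pisoD(8)[OF gp B's] by auto
  have L'L: "L' s \<subseteq> L s" for s by (auto simp: L'_def)
  have LL': "L s - L' s \<in> null_sets M" for s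
  proof (rule null_sets_subset)
    have "L 0 - B' \<subseteq> space M" using fmeasurable_subset_space[OF Lf] by blast
    then show "(g ^^ s) -` (L 0 - B') \<inter> space M \<in> null_sets M" by (rule piso_null_vimage[OF gp B'(2)])
    show "L s - L' s \<subseteq> (g ^^ s) -` (L 0 - B') \<inter> space M" using L_base Lsp by (auto simp: L'_def)
    show "L s - L' s \<in> sets M" using Lf[of s] L's[of s] by auto
  qed
  define lev where "lev x = (THE s. x \<in> L s)" for x
  have lev: "lev x = s" if "x \<in> L s" for x s unfolding lev_def by (rule the_equality) (use that L_unique in auto)
  \<comment> \<open>The base goes into \<open>{0..<w0}\<close>, and floor \<open>s\<close> is placed
    above it by \<open>S ^^ s\<close>. A step of \<open>f\<close> within a column thereby becomes a
    step of \<open>S\<close>.\<close>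
  define \<psi> where "\<psi> x = (S ^^ lev x) (\<phi>0 ((g ^^ lev x) x))" for x
  have \<psi>: "\<psi> x = (S ^^ s) (\<phi>0 ((g ^^ s) x))" if "x \<in> L s" for x s using lev[OF that] by (simp add: \<psi>_def)
  have base: "(g ^^ s) x \<in> B'" "\<phi>0 ((g ^^ s) x) \<in> C'" "\<phi>0 ((g ^^ s) x) \<in> {0..<w0}" if "x \<in> L' s" for x s
  proof -
    show 1: "(g ^^ s) x \<in> B'" using that by (simp add: L'_def)
    then show "\<phi>0 ((g ^^ s) x) \<in> C'" using pisoD(5)[OF \<phi>0] by blast
    then show "\<phi>0 ((g ^^ s) x) \<in> {0..<w0}" using C'w by blast
  qed
  have pL: "piso M lebesgue (L' s) (\<psi> ` L' s) \<psi>" for s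
  proof -
    have "piso M M ((g ^^ s) -` B' \<inter> space M) B' (g ^^ s)" by (rule piso_vimage[OF gp B's])
    then have 1: "piso M lebesgue ((g ^^ s) -` B' \<inter> space M) C' (\<phi>0 \<circ> g ^^ s)" by (rule piso_comp[OF _ \<phi>0])
    have C0: "C' \<subseteq> {0..}" using C'w by auto
    have "piso lebesgue lebesgue C' ((S ^^ s) ` C') (S ^^ s)"
      by (rule piso_subset[OF piso_funpow[OF S_piso] pisoD(2)[OF \<phi>0] C0])
    then have "piso M lebesgue ((g ^^ s) -` B' \<inter> space M) ((S ^^ s) ` C') ((S ^^ s) \<circ> (\<phi>0 \<circ> g ^^ s))" by (rule piso_comp[OF 1])
    then have "piso M lebesgue (L' s) (((S ^^ s) \<circ> (\<phi>0 \<circ> g ^^ s)) ` L' s) ((S ^^ s) \<circ> (\<phi>0 \<circ> g ^^ s))"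
      by (rule piso_subset[OF _ L's]) (auto simp: L'_def)
    moreover have e: "((S ^^ s) \<circ> (\<phi>0 \<circ> g ^^ s)) x = \<psi> x" if "x \<in> L' s" for x using \<psi>[OF subsetD[OF L'L that]] by simp
    moreover have "((S ^^ s) \<circ> (\<phi>0 \<circ> g ^^ s)) ` L' s = \<psi> ` L' s" by (rule image_cong[OF refl e])
    ultimately show ?thesis using piso_cong by metis
  qed
  have Sinj: "y = z" if "(S ^^ n) y = (S ^^ n) z" "y \<in> {0..}" "z \<in> {0..}" for n y z
    using pisoD(4)[OF piso_funpow[OF S_piso, of n]] that by (meson inj_onD)
  \<comment> \<open>A common point of two floors would give a point of the base interval that
    returns to it within \<open>q\<close> steps.\<close>
  have collide: "False" if c: "(S ^^ s) y = (S ^^ t) z" "y \<in> {0..<w0}" "z \<in> {0..<w0}" "s < t" "t \<le> s + q" for s t y z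
  proof -
    have "(S ^^ (s + (t - s))) z = (S ^^ s) ((S ^^ (t - s)) z)" by (simp only: funpow_add comp_apply)
    moreover have "s + (t - s) = t" using c(4) by simp
    ultimately have "(S ^^ t) z = (S ^^ s) ((S ^^ (t - s)) z)" by (simp only:)
    then have c1: "(S ^^ s) y = (S ^^ s) ((S ^^ (t - s)) z)" using c(1) by (simp only:)
    have nn: "y \<in> {0..}" "z \<in> {0..}" using c(2,3) by auto
    have "(S ^^ (t - s)) z \<in> {0..}"
      using pisoD(5)[OF piso_funpow[OF S_piso, of "t - s"]] nn(2) by blast
    note y = Sinj[OF c1 nn(1) this]
    have "1 \<le> t - s" "t - s \<le> q" using c(4,5) by linarith+
    then show False using S_no_return[of "t - s" z] c(2,3) unfolding y by blast
  qed
  define Lt where "Lt s = (if s < H then L' s else {})" for s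
  define V' where "V' = (\<Union>s. Lt s)"
  have V'_iff: "x \<in> V' \<longleftrightarrow> (\<exists>s<H. x \<in> L' s)" for x by (auto simp: V'_def Lt_def)
  have \<psi>_inj: "inj_on \<psi> V'"
  proof (rule inj_onI)
    fix x y assume x: "x \<in> V'" and y: "y \<in> V'" and eq: "\<psi> x = \<psi> y"
    obtain s where s: "s < H" "x \<in> L' s" using x V'_iff by blast
    obtain t where t: "t < H" "y \<in> L' t" using y V'_iff by blast
    have sx: "(S ^^ s) (\<phi>0 ((g ^^ s) x)) = (S ^^ t) (\<phi>0 ((g ^^ t) y))"
      using eq \<psi>[OF subsetD[OF L'L s(2)]] \<psi>[OF subsetD[OF L'L t(2)]] by simp
    have "\<not> s < t" using collide[OF sx base(3)[OF s(2)] base(3)[OF t(2)]] t(1) qs(2) by auto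
    moreover have "\<not> t < s" using collide[OF sx[symmetric] base(3)[OF t(2)] base(3)[OF s(2)]] s(1) qs(2) by auto
    ultimately have st: "s = t" by simp
    have "\<phi>0 ((g ^^ s) x) = \<phi>0 ((g ^^ s) y)"
      by (rule Sinj[of s]) (use sx st base(3)[OF s(2)] base(3)[OF t(2)] in auto)
    then have "(g ^^ s) x = (g ^^ s) y"
      using pisoD(4)[OF \<phi>0] base(1)[OF s(2)] base(1)[OF t(2)] st by (meson inj_onD)
    then show "x = y" using fngn[of x s] fngn[of y s] Lsp subsetD[OF L'L s(2)] subsetD[OF L'L t(2)] by metis
  qed
  have "piso M lebesgue (Lt s) (\<psi> ` Lt s) \<psi>" for s using pL[of s] by (simp add: Lt_def piso_empty)
  then have p\<psi>: "piso M lebesgue V' (\<psi> ` V') \<psi>"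
    unfolding V'_def by (rule piso_countable_UN) (rule \<psi>_inj[unfolded V'_def])
  have V'V: "V' \<subseteq> V"
  proof
    fix x assume "x \<in> V'"
    then obtain s where "x \<in> L s" using V'_iff L'L by blast
    then have "(g ^^ 0) x \<in> V" unfolding L_iff by blast
    then show "x \<in> V" by simp
  qed
  have V'f: "V' \<in> fmeasurable M" by (rule fmeasurableI2[OF V V'V pisoD(1)[OF p\<psi>]])
  define W where "W = \<psi> ` V'"
  have Ws: "W \<in> sets lebesgue" unfolding W_def by (rule pisoD(2)[OF p\<psi>])
  have Wf: "W \<in> lmeasurable" using Ws piso_emeasure[OF p\<psi>] V'f by (auto simp: fmeasurable_def W_def)
  have W0: "W \<subseteq> {0..}"
  proof
    fix y assume "y \<in> W"
    then obtain x s where x: "x \<in> L' s" "y = \<psi> x" unfolding W_def using V'_iff by blast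
    then have "y = (S ^^ s) (\<phi>0 ((g ^^ s) x))" using \<psi> L'L by blast
    moreover have "\<phi>0 ((g ^^ s) x) \<in> {0..}" using base(3)[OF x(1)] by simp
    ultimately show "y \<in> {0..}" using pisoD(5)[OF piso_funpow[OF S_piso, of s]] by blast
  qed
  \<comment> \<open>Outside the columns the identification is arbitrary. It exists because both
    complements have infinite measure.\<close>
  have P: "space M - V' \<in> sets M" "emeasure M (space M - V') = \<infinity>"
    using V'f emeasure_Diff_infinite[OF sets.top V'f fmeasurable_subset_space[OF V'f] emeasure_space_isomorphic_mod0[OF iso]] by auto
  have half: "emeasure lebesgue {0::real..} = \<infinity>"
    using piso_emeasure[of lebesgue lebesgue "UNIV :: real set" "{0::real..}"] piso_real_nonneg by auto
  have Q: "{0..} - W \<in> sets lebesgue" "{0..} - W \<subseteq> {0..}" "emeasure lebesgue ({0..} - W) = \<infinity>"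
    using Ws emeasure_Diff_infinite[OF _ Wf W0 half] by auto
  obtain P3 Q3 \<psi>1 where 3: "P3 \<subseteq> space M - V'" "space M - V' - P3 \<in> null_sets M" "Q3 \<subseteq> {0..} - W"
    "{0..} - W - Q3 \<in> null_sets lebesgue" "piso M lebesgue P3 Q3 \<psi>1"
    using piso_infinite[OF iso P Q] by blast
  define \<phi> where "\<phi> x = (if x \<in> V' then \<psi> x else \<psi>1 x)" for x
  have p1: "piso M lebesgue V' W \<phi>" using piso_cong[OF p\<psi>, of \<phi>] by (simp add: \<phi>_def W_def)
  have p2: "piso M lebesgue P3 Q3 \<phi>" by (rule piso_cong[OF 3(5)]) (use 3(1) in \<open>auto simp: \<phi>_def\<close>)
  have im1: "\<phi> ` V' = W" and im2: "\<phi> ` P3 = Q3" using pisoD(5)[OF p1] pisoD(5)[OF p2] by auto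
  have p\<phi>: "piso M lebesgue (V' \<union> P3) (W \<union> Q3) \<phi>"
  proof -
    have "\<phi> ` (V' - P3) \<inter> \<phi> ` (P3 - V') = {}" using im1 im2 3(3) by blast
    then have "inj_on \<phi> (V' \<union> P3)" by (intro inj_on_Un[THEN iffD2] conjI pisoD(4)[OF p1] pisoD(4)[OF p2])
    then have "piso M lebesgue (V' \<union> P3) (\<phi> ` (V' \<union> P3)) \<phi>" by (intro piso_Un) (use p1 p2 im1 im2 in auto)
    then show ?thesis by (simp only: image_Un im1 im2)
  qed
  have n1: "space M - (V' \<union> P3) \<in> null_sets M" using 3(2) by (simp only: Diff_eq Compl_Un Int_assoc)
  have n2: "W \<union> Q3 \<subseteq> {0..}" using W0 3(3) by blast
  have n3: "{0..} - (W \<union> Q3) \<in> null_sets lebesgue" using 3(4) by (simp only: Diff_eq Compl_Un Int_assoc)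
  obtain R G0 where R: "R \<in> aut_maps M" and G0: "G0 \<in> sets M" "G0 \<subseteq> V' \<union> P3" "space M - G0 \<in> null_sets M" "R ` G0 = G0"
    and R\<phi>: "\<And>x. x \<in> G0 \<Longrightarrow> \<phi> (R x) = S (\<phi> x)"
    using S_pullback[OF p\<phi> n1 n2 n3] by (elim exE conjE) (rule that, auto)
  note Rprops = S_factor_properties[OF p\<phi> n2 R G0 R\<phi>]
  have Rn: "(R ^^ n) x \<in> G0" "\<phi> ((R ^^ n) x) = (S ^^ n) (\<phi> x)" if "x \<in> G0" for x n
    using S_factor_funpow[where R=R and D=G0 and \<phi>=\<phi>, OF G0(4) R\<phi> that] by auto
  have \<phi>_inj: "x = y" if "\<phi> x = \<phi> y" "x \<in> G0" "y \<in> G0" for x y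
    using pisoD(4)[OF p\<phi>] that G0(2) by (meson inj_onD subsetD)
  \<comment> \<open>All exceptional points of the construction. The \<open>f\<close>-invariant set
    \<open>G\<close> in its complement allows the comparison of \<open>R\<close> with
    \<open>f\<close> to run along orbits.\<close>
  define B0 where "B0 = (space M - G0) \<union> (\<Union>s\<in>{..<H}. L s - L' s)"
  have B0: "B0 \<in> null_sets M" unfolding B0_def by (intro null_sets.Un G0(3) null_sets.finite_UN finite_lessThan LL') 
  have B0s: "B0 \<subseteq> space M" using B0 sets.sets_into_space by blast
  obtain G where Gs: "G \<subseteq> space M - B0" "space M - G \<in> null_sets M" and fG: "f ` G = G"
    using piso_invariant_core[OF f[unfolded aut_maps_iff_piso] B0 B0s] by blast
  have Gsp: "x \<in> space M" and GB: "x \<notin> B0" if "x \<in> G" for x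
    using subsetD[OF Gs(1) that] by simp_all
  have Gf: "f x \<in> G" if "x \<in> G" for x
    using imageI[OF that, of f] unfolding fG .
  have Gg: "g x \<in> G" if "x \<in> G" for x
  proof -
    have "x \<in> f ` G" using that unfolding fG .
    then obtain z where z: "z \<in> G" "x = f z" by (elim imageE) simp
    then show ?thesis using gf[OF Gsp[OF z(1)]] by simp
  qed
  define N1 where "N1 = space M - G"
  have N1: "N1 \<in> null_sets M" using Gs(2) by (simp add: N1_def)
  have GG0: "x \<in> G0" if "x \<in> G" for x using GB[OF that] Gsp[OF that] by (auto simp: B0_def)
  have GL: "x \<in> L' s" if "x \<in> G" "x \<in> L s" "s < H" for x s using GB[OF that(1)] that by (auto simp: B0_def)
  have \<phi>L: "\<phi> x = (S ^^ s) (\<phi>0 ((g ^^ s) x))" if "x \<in> L' s" "s < H" for x s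
    using \<psi>[OF subsetD[OF L'L that(1)]] V'_iff that by (auto simp: \<phi>_def)
  \<comment> \<open>Within a column \<open>f\<close> raises the floor by one. Under
    \<open>\<phi>\<close> this is an application of \<open>S\<close>, as is \<open>R\<close>, so
    injectivity of \<open>\<phi>\<close> identifies the two.\<close>
  have step: "R x = f x" if x: "x \<in> G" "x \<in> L s" "Suc s < H" "f x \<in> V" for x s
  proof (rule \<phi>_inj)
    have xs: "x \<in> space M" by (rule Gsp[OF x(1)])
    have fx: "f x \<in> L' (Suc s)" by (rule GL[OF Gf[OF x(1)] L_f[OF x(2,4)] x(3)])
    have xL: "x \<in> L' s" using GL[OF x(1,2)] x(3) by simp
    have "\<phi> (f x) = (S ^^ Suc s) (\<phi>0 ((g ^^ Suc s) (f x)))" by (rule \<phi>L[OF fx x(3)])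
    also have "\<dots> = S ((S ^^ s) (\<phi>0 ((g ^^ s) x)))" by (subst gnf[OF xs]) simp
    also have "\<dots> = S (\<phi> x)" using \<phi>L[OF xL] x(3) by simp
    finally show "\<phi> (R x) = \<phi> (f x)" using R\<phi>[OF GG0[OF x(1)]] by simp
    show "R x \<in> G0" using G0(4) GG0[OF x(1)] by blast
    show "f x \<in> G0" by (rule GG0[OF Gf[OF x(1)]])
  qed
  have iter: "(R ^^ n) x = (f ^^ n) x \<and> (f ^^ n) x \<in> L (s + n) \<and> (f ^^ n) x \<in> G"
    if x: "x \<in> G" "x \<in> L s" "s + n < H" "\<And>i. i \<le> n \<Longrightarrow> (f ^^ i) x \<in> V" for n x s
    using x(3,4)
  proof (induction n)
    case 0 then show ?case using x by simp
  next
    case (Suc n)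
    then have IH: "(R ^^ n) x = (f ^^ n) x" "(f ^^ n) x \<in> L (s + n)" "(f ^^ n) x \<in> G" by auto
    have v: "f ((f ^^ n) x) \<in> V" using Suc.prems(2)[of "Suc n"] by simp
    have "R ((f ^^ n) x) = f ((f ^^ n) x)" using Suc.prems(1) by (intro step[OF IH(3,2) _ v]) simp
    then show ?case using IH L_f[OF IH(2) v] Gf[OF IH(3)] by simp
  qed
  define Z0 where "Z0 = D K \<union> N1"
  have N1f: "N1 \<in> fmeasurable M" "measure M N1 = 0" using N1 by (auto simp: measure_def null_sets_def fmeasurable_def)
  have Z0: "Z0 \<in> fmeasurable M" "measure M Z0 < \<delta> / 8"
    using Df[of K] N1f(1) measure_Un_le[of "D K" M N1] N1f(2) K by (auto simp: Z0_def)
  have good: "\<exists>s<K. x \<in> L s \<and> x \<in> L' s \<and> x \<in> G" if x: "x \<in> E" "x \<notin> Z0" for x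
  proof -
    have "(f ^^ 0) x \<in> V" using EV(1)[OF x(1)] by blast
    then obtain s where s: "s < K" "x \<in> L s" using L_ex[of x] x(2) by (auto simp: Z0_def)
    have "x \<in> G" using x Esp by (simp add: N1_def Z0_def)
    then show ?thesis using s GL[of x s] by (auto simp: H_def)
  qed
  have small: "(R ^^ n) x = (f ^^ n) x" if x: "x \<in> E" "x \<notin> Z0" "n \<le> N" for x n
  proof -
    obtain s where s: "s < K" "x \<in> L s" "x \<in> G" using good[OF x(1,2)] by blast
    have "(f ^^ i) x \<in> V" if "i \<le> n" for i using EV(1)[OF x(1)] that x(3) by auto
    then show ?thesis using iter[OF s(3,2), of n] s(1) x(3) by (auto simp: H_def)
  qed
  have first: "R x = f x \<and> inv_into (space M) R x = g x" if x: "x \<in> E" "x \<notin> Z0" for x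
  proof
    show "R x = f x" using small[OF x, of 1] by (simp add: N_def)
    obtain s where s: "s < K" "x \<in> L s" "x \<in> G" using good[OF x] by blast
    \<comment> \<open>The predecessor of a point of \<open>E\<close> is in \<open>V\<close>, so the
      point is not on the bottom floor, and the inverses can be compared one floor below.\<close>
    have "s \<noteq> 0"
    proof
      assume "s = 0"
      then have "(g ^^ Suc 0) x \<notin> V" using s(2) unfolding L_iff by blast
      then show False using EV(2)[OF x(1), of "Suc 0"] by (simp add: N_def)
    qed
    then obtain u where u: "s = Suc u" by (cases s) auto
    have gx: "g x \<in> L u" using L_g s(2) u by blast
    have xs: "x \<in> space M" by (rule Esp[OF x(1)])
    have "(f ^^ 0) x \<in> V" using EV(1)[OF x(1)] by blast
    then have "f (g x) \<in> V" using fg[OF xs] by simp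
    then have "R (g x) = f (g x)" using step[OF Gg[OF s(3)] gx] s(1) u by (auto simp: H_def)
    then have "R (g x) = x" using fg[OF xs] by simp
    then show "inv_into (space M) R x = g x"
      using aut_mapsD(1)[OF R] gsp[OF xs] by (intro inv_into_f_eq) (auto simp: bij_betw_def)
  qed
  have "\<exists>Z\<in>lmeasurable. measure lebesgue Z \<le> w0 / real q \<and> {x\<in>{0..<w0}. (S ^^ Suc k) x \<in> {0..<w0}} \<subseteq> Z" for k
    by (rule S_return) simp
  then obtain Y where Y: "\<And>k. Y k \<in> lmeasurable" "\<And>k. measure lebesgue (Y k) \<le> w0 / real q"
    "\<And>k. {x\<in>{0..<w0}. (S ^^ Suc k) x \<in> {0..<w0}} \<subseteq> Y k" by metis
  \<comment> \<open>Points whose base point, \<open>s\<close> steps back, lies in the set covering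
    the returns of the model after \<open>k + 1\<close> steps.\<close>
  define X where "X s k = ((g ^^ s) -` (\<phi>0 -` (Y k \<inter> C') \<inter> B') \<inter> space M)" for s k
  have Xf: "X s k \<in> fmeasurable M" "measure M (X s k) \<le> w0 / real q" for s k
  proof -
    have YC: "Y k \<inter> C' \<in> sets lebesgue" "Y k \<inter> C' \<subseteq> C'" using Y(1)[of k] pisoD(2)[OF \<phi>0] by auto
    have YCf: "Y k \<inter> C' \<in> lmeasurable" by (rule fmeasurableI2[OF Y(1) _ YC(1)]) auto
    have "emeasure M (\<phi>0 -` (Y k \<inter> C') \<inter> B') = emeasure lebesgue (Y k \<inter> C')" by (rule piso_emeasure_vimage[OF \<phi>0 YC])
    moreover have "\<phi>0 -` (Y k \<inter> C') \<inter> B' \<in> sets M" by (rule pisoD(8)[OF \<phi>0 YC])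
    ultimately have A: "\<phi>0 -` (Y k \<inter> C') \<inter> B' \<in> fmeasurable M"
      "measure M (\<phi>0 -` (Y k \<inter> C') \<inter> B') = measure lebesgue (Y k \<inter> C')"
      using YCf by (auto simp: fmeasurable_def measure_def)
    show "X s k \<in> fmeasurable M" unfolding X_def by (rule aut_vimage_fmeasurable(1)[OF aut_maps_funpow[OF g] A(1)])
    have "measure M (X s k) = measure lebesgue (Y k \<inter> C')"
      unfolding X_def using aut_vimage_fmeasurable(2)[OF aut_maps_funpow[OF g] A(1)] A(2) by simp
    also have "\<dots> \<le> measure lebesgue (Y k)" using YC Y(1) by (intro measure_mono_fmeasurable) auto
    finally show "measure M (X s k) \<le> w0 / real q" using Y(2)[of k] by linarith
  qed
  have all_n: "\<exists>Z\<in>fmeasurable M. measure M Z < \<delta> \<and>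
    (\<forall>x\<in>E - Z. (R ^^ n) x \<in> E \<or> (f ^^ n) x \<in> E \<longrightarrow> (R ^^ n) x = (f ^^ n) x)" for n
  proof (cases "n \<le> N")
    case True
    then show ?thesis using small Z0 \<delta> by (intro bexI[of _ Z0]) auto
  next
    case False
    \<comment> \<open>\<open>Z1\<close> collects the points that \<open>R ^^ n\<close> sends into
      \<open>Z0\<close>, \<open>Z2\<close> the returns of \<open>f\<close> to \<open>E\<close>, and
      \<open>Z3\<close> the returns of the model. With \<open>Z0\<close>, the bounds
      \<open>\<delta> / 8\<close> twice and \<open>\<delta> / 4\<close> twice stay below
      \<open>\<delta>\<close>.\<close>
    define Z1 where "Z1 = (R ^^ n) -` Z0 \<inter> space M"
    define Z2 where "Z2 = {x\<in>E. (f ^^ n) x \<in> E}"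
    define Z3 where "Z3 = (\<Union>(s, t)\<in>{..<K} \<times> {..<K}. X s (n + s - t - 1))"
    have Z1: "Z1 \<in> fmeasurable M" "measure M Z1 < \<delta> / 8"
      unfolding Z1_def using aut_vimage_fmeasurable[OF aut_maps_funpow[OF R] Z0(1)] Z0(2) by auto
    have Z2: "Z2 \<in> fmeasurable M" "measure M Z2 < \<delta> / 4"
      unfolding Z2_def using measure_funpow_Int[OF f E E, of n] N0[of n] False by (auto simp: N_def)
    have Z3f: "Z3 \<in> fmeasurable M" unfolding Z3_def using Xf(1) by (intro fmeasurable.finite_UN) auto
    have "measure M Z3 \<le> (\<Sum>i\<in>{..<K} \<times> {..<K}. measure M (case i of (s, t) \<Rightarrow> X s (n + s - t - 1)))"
      unfolding Z3_def using Xf(1) by (intro measure_UNION_le) auto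
    also have "\<dots> \<le> (\<Sum>i\<in>{..<K} \<times> {..<K}. w0 / real q)" using Xf(2) by (intro sum_mono) auto
    also have "\<dots> = (real K)\<^sup>2 * (w0 / real q)" by (simp add: power2_eq_square)
    finally have Z3: "measure M Z3 < \<delta> / 4" using q4 by linarith
    let ?Z = "(Z0 \<union> Z1) \<union> (Z2 \<union> Z3)"
    have f1: "Z0 \<union> Z1 \<in> fmeasurable M" and f2: "Z2 \<union> Z3 \<in> fmeasurable M"
      by (rule fmeasurable.Un[OF Z0(1) Z1(1)], rule fmeasurable.Un[OF Z2(1) Z3f])
    have Zf: "?Z \<in> fmeasurable M" by (rule fmeasurable.Un[OF f1 f2])
    have "measure M ?Z \<le> measure M (Z0 \<union> Z1) + measure M (Z2 \<union> Z3)" using f1 f2 by (intro measure_Un_le) auto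
    also have "measure M (Z0 \<union> Z1) \<le> measure M Z0 + measure M Z1" using Z0 Z1 by (intro measure_Un_le) auto
    also have "measure M (Z2 \<union> Z3) \<le> measure M Z2 + measure M Z3" using Z2 Z3f by (intro measure_Un_le) auto
    finally have Zm: "measure M ?Z < \<delta>" using Z0(2) Z1(2) Z2(2) Z3 \<delta> by linarith
    have "(R ^^ n) x = (f ^^ n) x" if x: "x \<in> E - ?Z" and ret: "(R ^^ n) x \<in> E \<or> (f ^^ n) x \<in> E" for x
    proof -
      have xE: "x \<in> E" "x \<notin> Z0" "x \<notin> Z1" "x \<notin> Z2" "x \<notin> Z3" using x by auto
      have xs: "x \<in> space M" by (rule Esp[OF xE(1)])
      define y where "y = (R ^^ n) x"
      have yE: "y \<in> E" using ret xE(1,4) by (auto simp: Z2_def y_def)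
      have yZ: "y \<notin> Z0" using xE(3) xs by (simp add: Z1_def y_def)
      obtain s where s: "s < K" "x \<in> L s" "x \<in> L' s" "x \<in> G" using good[OF xE(1,2)] by blast
      obtain t where t: "t < K" "y \<in> L t" "y \<in> L' t" "y \<in> G" using good[OF yE yZ] by blast
      define a b where "a = \<phi>0 ((g ^^ s) x)" and "b = \<phi>0 ((g ^^ t) y)"
      have ab: "a \<in> {0..<w0}" "b \<in> {0..<w0}" using base(3)[OF s(3)] base(3)[OF t(3)] by (auto simp: a_def b_def)
      have "\<phi> y = (S ^^ n) (\<phi> x)" unfolding y_def by (rule Rn(2)[OF GG0[OF s(4)]])
      moreover have "\<phi> x = (S ^^ s) a" "\<phi> y = (S ^^ t) b"
        using \<phi>L[OF s(3)] \<phi>L[OF t(3)] s(1) t(1) by (auto simp: a_def b_def H_def)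
      ultimately have eq: "(S ^^ (n + s)) a = (S ^^ t) b" by (simp add: funpow_add)
      \<comment> \<open>If \<open>n + s < t\<close>, two floors collide, which is impossible.
        Equality gives \<open>x\<close> and \<open>y\<close> the same base point, so
        \<open>y\<close> is the image of \<open>x\<close> under \<open>f ^^ n\<close>. If
        \<open>t < n + s\<close>, the base point of \<open>x\<close> returns in the model, which
        \<open>Z3\<close> excludes.\<close>
      consider "n + s < t" | "n + s = t" | "t < n + s" by linarith
      then show ?thesis
      proof cases
        case 1
        then show ?thesis using collide[OF eq ab(1,2)] t(1) qs(2) by (auto simp: H_def)
      next
        case 2
        then have "a = b" using Sinj[of t a b] eq ab by auto
        then have gg: "(g ^^ s) x = (g ^^ t) y"
          using pisoD(4)[OF \<phi>0] base(1)[OF s(3)] base(1)[OF t(3)] unfolding a_def b_def by (meson inj_onD)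
        have "y = (f ^^ t) ((g ^^ t) y)" using fngn[OF Esp[OF yE], of t] by simp
        also have "\<dots> = (f ^^ (n + s)) ((g ^^ s) x)" using gg 2 by simp
        also have "\<dots> = (f ^^ n) ((f ^^ s) ((g ^^ s) x))" by (simp only: funpow_add comp_apply)
        also have "\<dots> = (f ^^ n) x" using fngn[OF xs] by simp
        finally show ?thesis by (simp add: y_def)
      next
        case 3
        define k where "k = n + s - t - 1"
        have k: "n + s = t + Suc k" using 3 by (simp add: k_def)
        have "(S ^^ Suc k) a = b"
        proof (rule Sinj[of t])
          show "(S ^^ t) ((S ^^ Suc k) a) = (S ^^ t) b" using eq unfolding k by (simp only: funpow_add comp_apply)
          show "(S ^^ Suc k) a \<in> {0..}" using pisoD(5)[OF piso_funpow[OF S_piso, of "Suc k"]] ab(1) by auto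
        qed (use ab in auto)
        then have "a \<in> {x\<in>{0..<w0}. (S ^^ Suc k) x \<in> {0..<w0}}" using ab by blast
        then have "a \<in> Y k" using Y(3) by blast
        then have "x \<in> X s k" unfolding X_def using xs base(1,2)[OF s(3)] by (simp add: a_def)
        then have "x \<in> Z3" unfolding Z3_def k_def using s(1) t(1) by blast
        then show ?thesis using xE(5) by blast
      qed
    qed
    then show ?thesis using Zf Zm by (intro bexI[of _ ?Z]) auto
  qed
  have "\<exists>Z\<in>fmeasurable M. measure M Z < \<delta> \<and>
       (\<forall>x\<in>E - Z. R x = f x \<and> inv_into (space M) R x = inv_into (space M) f x)"
    using first Z0 \<delta> unfolding g_def by (intro bexI[of _ Z0]) auto
  then show ?thesis using R Rprops all_n by (intro bexI[of _ R] conjI allI impI)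
qed

section \<open>Smallness of the metric from finitely many conditions\<close>

text \<open>A finite set \<open>J\<close> carries all but \<open>\<epsilon> / 3\<close> of the
  majorant \<open>b\<close>. Both \<open>J\<close> and \<open>\<delta>\<close> depend on
  \<open>b\<close> and \<open>\<epsilon>\<close> only, which gives uniformity over all
  \<open>t\<close>.\<close>

lemma infsum_small:
  fixes b :: "'i \<Rightarrow> real"
  assumes b: "b summable_on I" "\<And>i. i \<in> I \<Longrightarrow> 0 \<le> b i" and \<epsilon>: "0 < \<epsilon>"
  shows "\<exists>J \<delta>. finite J \<and> J \<subseteq> I \<and> 0 < \<delta> \<and>
    (\<forall>t. (\<forall>i\<in>I. 0 \<le> t i \<and> t i \<le> b i) \<longrightarrow> (\<forall>i\<in>J. t i \<le> \<delta>) \<longrightarrow> infsum t I < \<epsilon>)"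
proof -
  have "(sum b \<longlongrightarrow> infsum b I) (finite_subsets_at_top I)"
    using b(1) by (simp add: has_sum_def[symmetric] has_sum_infsum)
  then have "\<forall>\<^sub>F F in finite_subsets_at_top I. infsum b I - \<epsilon> / 3 < sum b F"
    by (rule order_tendstoD(1)) (use \<epsilon> in simp)
  then obtain J where J: "finite J" "J \<subseteq> I" "infsum b I - \<epsilon> / 3 < sum b J"
    unfolding eventually_finite_subsets_at_top by blast
  \<comment> \<open>The summand 1 in the denominator covers empty \<open>J\<close>.\<close>
  define \<delta> where "\<delta> = \<epsilon> / (3 * (real (card J) + 1))"
  have \<delta>: "0 < \<delta>" using \<epsilon> by (simp add: \<delta>_def)
  have "infsum t I < \<epsilon>" if t: "\<forall>i\<in>I. 0 \<le> t i \<and> t i \<le> b i" and tJ: "\<forall>i\<in>J. t i \<le> \<delta>" for t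
  proof -
    have st: "t summable_on I" by (rule summable_on_comparison_test[OF b(1)]) (use t in auto)
    have sD: "t summable_on (I - J)" "b summable_on (I - J)"
      by (rule summable_on_subset_banach[OF st], simp, rule summable_on_subset_banach[OF b(1)], simp)
    have split: "infsum u I = infsum u (I - J) + sum u J" if "u summable_on (I - J)" for u :: "'i \<Rightarrow> real"
    proof -
      have "infsum u ((I - J) \<union> J) = infsum u (I - J) + infsum u J"
        by (rule infsum_Un_disjoint[OF that]) (use J(1) in auto)
      moreover have "(I - J) \<union> J = I" using J(2) by blast
      ultimately show ?thesis using J(1) by simp
    qed
    have "infsum t (I - J) \<le> infsum b (I - J)" by (rule infsum_mono[OF sD]) (use t in auto)
    also have "\<dots> < \<epsilon> / 3" using split[OF sD(2)] J(3) by linarith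
    finally have 1: "infsum t (I - J) < \<epsilon> / 3" .
    have "sum t J \<le> (\<Sum>i\<in>J. \<delta>)" using tJ by (intro sum_mono) auto
    also have "\<dots> = real (card J) * \<delta>" by simp
    also have "\<dots> \<le> (real (card J) + 1) * \<delta>" using \<delta> by (intro mult_right_mono) auto
    also have "\<dots> = \<epsilon> / 3"
    proof -
      have "real (card J) + 1 \<noteq> 0" using of_nat_0_le_iff[of "card J", where 'a=real] by linarith
      then show ?thesis unfolding \<delta>_def by (simp add: field_simps)
    qed
    finally show ?thesis using split[OF sD(1)] 1 \<epsilon> by linarith
  qed
  then show ?thesis using J \<delta> by blast
qed

text \<open>The majorant of the series for \<open>d_w\<close> does not depend on the exponent, so
  finitely many pairs of sets control the supremum over all powers.\<close>

lemma r_metric_small: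
  assumes d: "dense_family M A" and \<epsilon>: "0 < \<epsilon>"
  shows "\<exists>I \<delta>. finite I \<and> I \<subseteq> {1..} \<and> 0 < \<delta> \<and> (\<forall>S\<in>carrier (Aut M). \<forall>T\<in>carrier (Aut M).
     (\<forall>i\<in>I. measure M (sym_diff (act S (A i)) (act T (A i))) \<le> \<delta> \<and>
        measure M (sym_diff (act (inv\<^bsub>Aut M\<^esub> S) (A i)) (act (inv\<^bsub>Aut M\<^esub> T) (A i))) \<le> \<delta>) \<longrightarrow>
     (\<forall>n::nat. \<forall>i\<in>I. \<forall>j\<in>I. \<bar>measure M (act (S [^]\<^bsub>Aut M\<^esub> n) (A i) \<inter> A j)
        - measure M (act (T [^]\<^bsub>Aut M\<^esub> n) (A i) \<inter> A j)\<bar> \<le> \<delta>) \<longrightarrow> r_metric M A S T < \<epsilon>)"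
proof -
  interpret group "Aut M" by (rule group_Aut)
  have Af: "A i \<in> fmeasurable M" if "i \<in> {1..}" for i using d that by (auto simp: dense_family_def)
  define b1 where "b1 i = 4 * ((1/2) ^ i * measure M (A i))" for i
  define b2 where "b2 = (\<lambda>(i, j). (1/2) ^ (i + j) * measure M (A j))"
  have s1: "b1 summable_on {1..}" unfolding b1_def using d by (intro summable_on_cmult_right) (auto simp: dense_family_def)
  have s2: "b2 summable_on {1..} \<times> {1..}" unfolding b2_def by (rule d_w_bound_summable[OF d])
  have "\<exists>J \<delta>. finite J \<and> J \<subseteq> {1..} \<and> 0 < \<delta> \<and> (\<forall>t. (\<forall>i\<in>{1..}. 0 \<le> t i \<and> t i \<le> b1 i) \<longrightarrow>
      (\<forall>i\<in>J. t i \<le> \<delta>) \<longrightarrow> infsum t {1..} < \<epsilon> / 2)"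
    by (rule infsum_small[OF s1]) (use \<epsilon> in \<open>auto simp: b1_def\<close>)
  then obtain J1 \<delta>1 where 1: "finite J1" "J1 \<subseteq> {1..}" "0 < \<delta>1"
    and t1: "\<forall>t. (\<forall>i\<in>{1..}. 0 \<le> t i \<and> t i \<le> b1 i) \<longrightarrow> (\<forall>i\<in>J1. t i \<le> \<delta>1) \<longrightarrow> infsum t {1..} < \<epsilon> / 2"
    by (elim exE conjE) (rule that)
  \<comment> \<open>A quarter is requested: \<open>rho\<close> takes \<open>\<epsilon> / 2\<close>,
    and the supremum turns the strict bound into a weak one.\<close>
  have "\<exists>J \<delta>. finite J \<and> J \<subseteq> {1..} \<times> {1..} \<and> 0 < \<delta> \<and> (\<forall>t. (\<forall>i\<in>{1..} \<times> {1..}. 0 \<le> t i \<and> t i \<le> b2 i) \<longrightarrow>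
      (\<forall>i\<in>J. t i \<le> \<delta>) \<longrightarrow> infsum t ({1..} \<times> {1..}) < \<epsilon> / 4)"
    by (rule infsum_small[OF s2]) (use \<epsilon> in \<open>auto simp: b2_def\<close>)
  then obtain J2 \<delta>2 where 2: "finite J2" "J2 \<subseteq> {1..} \<times> {1..}" "0 < \<delta>2"
    and t2: "\<forall>t. (\<forall>i\<in>{1..} \<times> {1..}. 0 \<le> t i \<and> t i \<le> b2 i) \<longrightarrow> (\<forall>i\<in>J2. t i \<le> \<delta>2) \<longrightarrow>
      infsum t ({1..} \<times> {1..}) < \<epsilon> / 4"
    by (elim exE conjE) (rule that)
  define I where "I = J1 \<union> fst ` J2 \<union> snd ` J2"
  \<comment> \<open>Each summand of \<open>rho\<close> contains two measures, hence half of
    \<open>\<delta>1\<close>.\<close>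
  define \<delta> where "\<delta> = min (\<delta>1 / 2) \<delta>2"
  have I: "finite I" "I \<subseteq> {1..}" using 1 2 by (auto simp: I_def)
  have \<delta>: "0 < \<delta>" using 1 2 by (simp add: \<delta>_def)
  have half: "(1/2::real) ^ k * x \<le> y" if "0 \<le> x" "x \<le> y" for k :: nat and x y :: real
  proof -
    have "(1/2::real) ^ k * x \<le> 1 * x" using that by (intro mult_right_mono power_le_one) auto
    then show ?thesis using that by simp
  qed
  have "r_metric M A S T < \<epsilon>" if S: "S \<in> carrier (Aut M)" and T: "T \<in> carrier (Aut M)"
    and c1: "\<forall>i\<in>I. measure M (sym_diff (act S (A i)) (act T (A i))) \<le> \<delta> \<and>
        measure M (sym_diff (act (inv\<^bsub>Aut M\<^esub> S) (A i)) (act (inv\<^bsub>Aut M\<^esub> T) (A i))) \<le> \<delta>"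
    and c2: "\<forall>n::nat. \<forall>i\<in>I. \<forall>j\<in>I. \<bar>measure M (act (S [^]\<^bsub>Aut M\<^esub> n) (A i) \<inter> A j)
        - measure M (act (T [^]\<^bsub>Aut M\<^esub> n) (A i) \<inter> A j)\<bar> \<le> \<delta>" for S T
  proof -
    have le2: "measure M (sym_diff (act U (A i)) (act U' (A i))) \<le> 2 * measure M (A i)"
      if "U \<in> carrier (Aut M)" "U' \<in> carrier (Aut M)" "i \<in> {1..}" for U U' i
      using measure_sym_diff_le[OF act_fmeasurable(1)[OF that(1) Af[OF that(3)]] act_fmeasurable(1)[OF that(2) Af[OF that(3)]]]
        act_fmeasurable(2)[OF that(1) Af[OF that(3)]] act_fmeasurable(2)[OF that(2) Af[OF that(3)]] by simp
    have "rho M A S T < \<epsilon> / 2" unfolding rho_def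
    proof (rule t1[THEN spec, THEN mp, THEN mp]; intro ballI conjI)
      fix i :: nat assume i: "i \<in> {1..}"
      show "0 \<le> (1/2) ^ i * (measure M (sym_diff (act S (A i)) (act T (A i))) +
         measure M (sym_diff (act (inv\<^bsub>Aut M\<^esub> S) (A i)) (act (inv\<^bsub>Aut M\<^esub> T) (A i))))" by simp
      have "(1/2) ^ i * (measure M (sym_diff (act S (A i)) (act T (A i))) +
         measure M (sym_diff (act (inv\<^bsub>Aut M\<^esub> S) (A i)) (act (inv\<^bsub>Aut M\<^esub> T) (A i)))) \<le> (1/2) ^ i * (4 * measure M (A i))"
        using le2[OF S T i] le2[OF inv_closed[OF S] inv_closed[OF T] i] by (intro mult_left_mono) auto
      then show "(1/2) ^ i * (measure M (sym_diff (act S (A i)) (act T (A i))) +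
         measure M (sym_diff (act (inv\<^bsub>Aut M\<^esub> S) (A i)) (act (inv\<^bsub>Aut M\<^esub> T) (A i)))) \<le> b1 i" by (simp add: b1_def)
    next
      fix i assume "i \<in> J1"
      then have "measure M (sym_diff (act S (A i)) (act T (A i))) \<le> \<delta>"
        "measure M (sym_diff (act (inv\<^bsub>Aut M\<^esub> S) (A i)) (act (inv\<^bsub>Aut M\<^esub> T) (A i))) \<le> \<delta>" using c1 by (auto simp: I_def)
      then have "measure M (sym_diff (act S (A i)) (act T (A i))) +
         measure M (sym_diff (act (inv\<^bsub>Aut M\<^esub> S) (A i)) (act (inv\<^bsub>Aut M\<^esub> T) (A i))) \<le> \<delta>1" by (simp add: \<delta>_def)
      then show "(1/2) ^ i * (measure M (sym_diff (act S (A i)) (act T (A i))) +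
         measure M (sym_diff (act (inv\<^bsub>Aut M\<^esub> S) (A i)) (act (inv\<^bsub>Aut M\<^esub> T) (A i)))) \<le> \<delta>1" by (intro half) auto
    qed
    moreover have "d_w M A (S [^]\<^bsub>Aut M\<^esub> n) (T [^]\<^bsub>Aut M\<^esub> n) \<le> \<epsilon> / 4" for n :: nat
    proof -
      let ?t = "\<lambda>i j. \<bar>measure M (act (S [^]\<^bsub>Aut M\<^esub> n) (A i) \<inter> A j) - measure M (act (T [^]\<^bsub>Aut M\<^esub> n) (A i) \<inter> A j)\<bar>"
      have "d_w M A (S [^]\<^bsub>Aut M\<^esub> n) (T [^]\<^bsub>Aut M\<^esub> n) < \<epsilon> / 4" unfolding d_w_def
      proof (rule t2[THEN spec, THEN mp, THEN mp]; intro ballI conjI)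
        fix x :: "nat \<times> nat" assume "x \<in> {1..} \<times> {1..}"
        then obtain i j where x: "x = (i, j)" "i \<in> {1..}" "j \<in> {1..}" by auto
        show "0 \<le> (case x of (i, j) \<Rightarrow> (1/2) ^ (i + j) * ?t i j)" by (simp add: x)
        have b: "measure M (act U (A i) \<inter> A j) \<le> measure M (A j)" if "U \<in> carrier (Aut M)" for U
          using act_fmeasurable(1)[OF that Af[OF x(2)]] Af[OF x(3)] by (intro measure_mono_fmeasurable) auto
        have "?t i j \<le> measure M (A j)"
          using b[OF nat_pow_closed[OF S, of n]] b[OF nat_pow_closed[OF T, of n]]
            measure_nonneg[of M "act (S [^]\<^bsub>Aut M\<^esub> n) (A i) \<inter> A j"] measure_nonneg[of M "act (T [^]\<^bsub>Aut M\<^esub> n) (A i) \<inter> A j"]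
          by linarith
        then show "(case x of (i, j) \<Rightarrow> (1/2) ^ (i + j) * ?t i j) \<le> b2 x"
          unfolding x b2_def prod.case by (intro mult_left_mono) auto
      next
        fix x assume xJ: "x \<in> J2"
        obtain i j where x: "x = (i, j)" by (cases x)
        have "fst x \<in> I" "snd x \<in> I" unfolding I_def using xJ by blast+
        then have "i \<in> I" "j \<in> I" by (simp_all add: x)
        then have "?t i j \<le> \<delta>" by (intro c2[THEN spec, THEN bspec, THEN bspec])
        then have "?t i j \<le> \<delta>2" by (simp add: \<delta>_def)
        then show "(case x of (i, j) \<Rightarrow> (1/2) ^ (i + j) * ?t i j) \<le> \<delta>2" unfolding x prod.case by (intro half) auto
      qed
      then show ?thesis by simp
    qed
    then have "(SUP n\<in>{0::nat<..}. d_w M A (S [^]\<^bsub>Aut M\<^esub> n) (T [^]\<^bsub>Aut M\<^esub> n)) \<le> \<epsilon> / 4"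
      by (intro cSUP_least) auto
    ultimately show ?thesis unfolding r_metric_def using \<epsilon> by linarith
  qed
  then show ?thesis by (intro exI[of _ I] exI[of _ \<delta>] conjI I \<delta> ballI impI)
qed

lemma measure_sym_diff_image_le:
  assumes v: "v \<in> aut_maps M" "v' \<in> aut_maps M" and A: "A \<in> fmeasurable M" and Z: "Z \<in> fmeasurable M"
    and eq: "\<And>x. x \<in> A - Z \<Longrightarrow> v x = v' x"
  shows "measure M (sym_diff (v ` A) (v' ` A)) \<le> 2 * measure M Z"
proof -
  note i = aut_image_fmeasurable[OF v(1)] and i' = aut_image_fmeasurable[OF v(2)]
  have "sym_diff (v ` A) (v' ` A) \<subseteq> v ` Z \<union> v' ` Z"
  proof
    fix y assume "y \<in> sym_diff (v ` A) (v' ` A)"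
    then consider x where "x \<in> A" "y = v x" "y \<notin> v' ` A" | x where "x \<in> A" "y = v' x" "y \<notin> v ` A" by blast
    then show "y \<in> v ` Z \<union> v' ` Z"
    proof cases
      case 1
      then have "v x \<noteq> v' x" by blast
      then show ?thesis using 1 eq by blast
    next
      case 2
      then have "v x \<noteq> v' x" by (metis image_eqI)
      then show ?thesis using 2 eq by blast
    qed
  qed
  then have "measure M (sym_diff (v ` A) (v' ` A)) \<le> measure M (v ` Z \<union> v' ` Z)"
    using fmeasurableD[OF fmeasurable_sym_diff[OF i(1)[OF A] i'(1)[OF A]]] i(1)[OF Z] i'(1)[OF Z]
    by (intro measure_mono_fmeasurable) auto
  also have "\<dots> \<le> measure M (v ` Z) + measure M (v' ` Z)" using i(1)[OF Z] i'(1)[OF Z] by (intro measure_Un_le) auto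
  finally show ?thesis using i(2)[OF Z] i'(2)[OF Z] by simp
qed

text \<open>The tower is built for one representative, while the condition refers to the one
  selected by \<open>rep\<close>. Once the null set where some iterates differ is removed from the
  base, both maps have the same levels.\<close>

lemma tower_approx_AE_cong:
  assumes f: "f \<in> aut_maps M" and h: "h \<in> aut_maps M" and ae: "AE x in M. f x = h x"
    and sub: "\<B> \<subseteq> fmeasurable M" and tow: "tower_approx M f \<B> \<epsilon>"
  shows "tower_approx M h \<B> \<epsilon>"
proof -
  note fn = aut_maps_funpow[OF f]
  have "AE x in M. (f ^^ n) x = (h ^^ n) x" for n
  proof (induction n)
    case (Suc n)
    have "AE x in M. f ((f ^^ n) x) = h ((f ^^ n) x)" by (rule AE_aut[OF fn ae])
    then show ?case using Suc by eventually_elim simp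
  qed simp
  then have "AE x in M. \<forall>n. (f ^^ n) x = (h ^^ n) x" by (simp add: AE_all_countable)
  then obtain N where N: "N \<in> null_sets M" "{x\<in>space M. \<not> (\<forall>n. (f ^^ n) x = (h ^^ n) x)} \<subseteq> N"
    by (auto elim!: AE_E simp: null_sets_def)
  obtain F H where F: "F \<in> fmeasurable M" "measure M F < \<epsilon>"
    and disj: "disjoint_family_on (\<lambda>n. (f ^^ n) ` F) {..<H}"
    and ap: "\<And>B. B \<in> \<B> \<Longrightarrow> \<exists>Q\<subseteq>{..<H}. measure M (sym_diff B (\<Union>n\<in>Q. (f ^^ n) ` F)) < \<epsilon>"
    using tow unfolding tower_approx_def by blast
  define F' where "F' = F - N"
  have F'F: "F' \<subseteq> F" by (auto simp: F'_def)
  have F': "F' \<in> fmeasurable M" unfolding F'_def using F(1) N(1) by (intro fmeasurable_Diff) auto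
  have eq: "(h ^^ n) ` F' = (f ^^ n) ` F'" for n
  proof (rule image_cong[OF refl])
    fix x assume "x \<in> F'"
    then have "x \<in> space M" "x \<notin> N" using fmeasurable_subset_space[OF F(1)] by (auto simp: F'_def)
    then have "\<forall>n. (f ^^ n) x = (h ^^ n) x" using N(2) by blast
    then show "(h ^^ n) x = (f ^^ n) x" by simp
  qed
  have nn: "F - F' \<in> null_sets M"
    by (rule null_sets_subset[OF N(1)]) (use F(1) F' in \<open>auto simp: F'_def\<close>)
  have "measure M F' \<le> measure M F" using F'F F' F(1) by (intro measure_mono_fmeasurable) auto
  then have "measure M F' < \<epsilon>" using F(2) by linarith
  moreover have "disjoint_family_on (\<lambda>n. (h ^^ n) ` F') {..<H}"
    unfolding disjoint_family_on_def eq
  proof (intro ballI impI)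
    fix m n assume "m \<in> {..<H}" "n \<in> {..<H}" "m \<noteq> n"
    then have "(f ^^ m) ` F \<inter> (f ^^ n) ` F = {}" by (rule disjoint_family_onD[OF disj])
    then show "(f ^^ m) ` F' \<inter> (f ^^ n) ` F' = {}" using F'F by blast
  qed
  moreover have "\<exists>Q\<subseteq>{..<H}. measure M (sym_diff B (\<Union>n\<in>Q. (h ^^ n) ` F')) < \<epsilon>" if B: "B \<in> \<B>" for B
  proof -
    obtain Q where Q: "Q \<subseteq> {..<H}" "measure M (sym_diff B (\<Union>n\<in>Q. (f ^^ n) ` F)) < \<epsilon>" using ap[OF B] by blast
    have fQ: "finite Q" using Q(1) finite_subset by blast
    let ?U = "\<Union>n\<in>Q. (f ^^ n) ` F" and ?V = "\<Union>n\<in>Q. (f ^^ n) ` F'"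
    have fm: "?U \<in> fmeasurable M" "?V \<in> fmeasurable M" "B \<in> fmeasurable M"
      using B sub by (auto intro!: fmeasurable.finite_UN fQ aut_image_fmeasurable(1)[OF fn] F F')
    have n0: "(\<Union>n\<in>Q. (f ^^ n) ` (F - F')) \<in> null_sets M"
    proof (rule null_sets.finite_UN[OF fQ])
      fix n
      have p: "piso M M (space M) (space M) (f ^^ n)" using fn aut_maps_iff_piso by blast
      show "(f ^^ n) ` (F - F') \<in> null_sets M"
        by (rule piso_null[OF p nn]) (use fmeasurable_subset_space[OF F(1)] in blast)
    qed
    have "sym_diff (sym_diff B ?V) (sym_diff B ?U) \<in> null_sets M"
      by (rule null_sets_subset[OF n0])
        (use fmeasurableD[OF fmeasurable_sym_diff[OF fmeasurable_sym_diff[OF fm(3,2)] fmeasurable_sym_diff[OF fm(3,1)]]] F'F in blast)+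
    then have "measure M (sym_diff B ?V) = measure M (sym_diff B ?U)"
      by (rule measure_eq_null_sym_diff[OF fmeasurableD[OF fmeasurable_sym_diff[OF fm(3,2)]] fmeasurableD[OF fmeasurable_sym_diff[OF fm(3,1)]]])
    then show ?thesis using Q unfolding eq by (intro exI[of _ Q]) simp
  qed
  ultimately show ?thesis unfolding tower_approx_def using F' by blast
qed

section \<open>Density of the tower conditions and conclusion\<close>

lemma rank_one_dense:
  assumes iso: "isomorphic_mod0 M (lebesgue :: real measure)" and d: "dense_family M A"
    and T: "T \<in> Mix M" and \<epsilon>: "0 < \<epsilon>"
  shows "\<exists>S\<in>Mix M. r_metric M A T S < \<epsilon> \<and>
    (\<forall>\<B> \<epsilon>. finite \<B> \<longrightarrow> \<B> \<subseteq> fmeasurable M \<longrightarrow> 0 < \<epsilon> \<longrightarrow> tower_approx M (rep S) \<B> \<epsilon>)"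
proof -
  have Tc: "T \<in> carrier (Aut M)" using T by (simp add: Mix_def)
  let ?f = "rep T"
  note f = rep_aut[OF Tc]
  have mix: "mixing_map M ?f" using T mixing_iff[OF Tc] by (simp add: Mix_def)
  obtain I \<delta> where I: "finite I" "I \<subseteq> {1..}" "0 < \<delta>" and small: "\<forall>S\<in>carrier (Aut M). \<forall>T\<in>carrier (Aut M).
     (\<forall>i\<in>I. measure M (sym_diff (act S (A i)) (act T (A i))) \<le> \<delta> \<and>
        measure M (sym_diff (act (inv\<^bsub>Aut M\<^esub> S) (A i)) (act (inv\<^bsub>Aut M\<^esub> T) (A i))) \<le> \<delta>) \<longrightarrow>
     (\<forall>n::nat. \<forall>i\<in>I. \<forall>j\<in>I. \<bar>measure M (act (S [^]\<^bsub>Aut M\<^esub> n) (A i) \<inter> A j)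
        - measure M (act (T [^]\<^bsub>Aut M\<^esub> n) (A i) \<inter> A j)\<bar> \<le> \<delta>) \<longrightarrow> r_metric M A S T < \<epsilon>"
    using r_metric_small[OF d \<epsilon>] by (elim exE conjE) (rule that)
  \<comment> \<open>Only these finitely many sets enter the criterion for closeness, so it is enough
    to follow \<open>f\<close> on their union.\<close>
  define E where "E = (\<Union>i\<in>I. A i)"
  have Af: "A i \<in> fmeasurable M" if "i \<in> I" for i using d I(2) that by (auto simp: dense_family_def)
  have AE: "A i \<subseteq> E" if "i \<in> I" for i using that by (auto simp: E_def)
  have E: "E \<in> fmeasurable M" unfolding E_def using I(1) Af by (intro fmeasurable.finite_UN) auto
  \<comment> \<open>Images under two maps that agree outside \<open>Z\<close> differ by at most
    twice the measure of \<open>Z\<close>.\<close>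
  have \<delta>2: "0 < \<delta> / 2" using I(3) by simp
  obtain R where R1: "R \<in> aut_maps M" and R2: "mixing_map M R \<and>
    (\<forall>\<B> \<epsilon>. finite \<B> \<longrightarrow> \<B> \<subseteq> fmeasurable M \<longrightarrow> 0 < \<epsilon> \<longrightarrow> tower_approx M R \<B> \<epsilon>) \<and>
    (\<exists>Z\<in>fmeasurable M. measure M Z < \<delta> / 2 \<and>
       (\<forall>x\<in>E - Z. R x = ?f x \<and> inv_into (space M) R x = inv_into (space M) ?f x)) \<and>
    (\<forall>n. \<exists>Z\<in>fmeasurable M. measure M Z < \<delta> / 2 \<and>
       (\<forall>x\<in>E - Z. (R ^^ n) x \<in> E \<or> (?f ^^ n) x \<in> E \<longrightarrow> (R ^^ n) x = (?f ^^ n) x))"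
    using approximate_by_rank_one[OF iso f mix E \<delta>2] by (rule bexE)
  note R = R1 conjunct1[OF R2]
  note tow = conjunct1[OF conjunct2[OF R2]]
  note Z1 = conjunct1[OF conjunct2[OF conjunct2[OF R2]]]
  note Zn = conjunct2[OF conjunct2[OF conjunct2[OF R2]]]
  define S where "S = ae_rel M `` {R}"
  have Sc: "S \<in> carrier (Aut M)" unfolding S_def by (rule ae_class_carrier[OF R(1)])
  have ae: "AE x in M. R x = rep S x" using rep_ae_class[OF R(1)] unfolding S_def by eventually_elim simp
  have Sn: "S [^]\<^bsub>Aut M\<^esub> (n::nat) = ae_rel M `` {R ^^ n}" for n unfolding S_def by (rule pow_ae_class[OF R(1)])
  note Rn = aut_maps_funpow[OF R(1)] and fn = aut_maps_funpow[OF f]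
  have "mixing M S" unfolding mixing_def Sn
    using R(2) by (simp add: measure_act_Int[OF Rn] mixing_map_def)
  then have SM: "S \<in> Mix M" using Sc by (simp add: Mix_def)
  have tS: "tower_approx M (rep S) \<B> e" if "finite \<B>" "\<B> \<subseteq> fmeasurable M" "0 < e" for \<B> e
    by (rule tower_approx_AE_cong[OF R(1) rep_aut[OF Sc] ae that(2)]) (use tow that in blast)
  have Si: "inv\<^bsub>Aut M\<^esub> S = ae_rel M `` {inv_into (space M) R}" unfolding S_def by (rule inv_ae_class[OF R(1)])
  have c1: "\<forall>i\<in>I. measure M (sym_diff (act T (A i)) (act S (A i))) \<le> \<delta> \<and>
        measure M (sym_diff (act (inv\<^bsub>Aut M\<^esub> T) (A i)) (act (inv\<^bsub>Aut M\<^esub> S) (A i))) \<le> \<delta>"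
  proof (intro ballI conjI)
    fix i assume i: "i \<in> I"
    obtain Z where Z: "Z \<in> fmeasurable M" "measure M Z < \<delta> / 2"
      "\<And>x. x \<in> E - Z \<Longrightarrow> R x = ?f x \<and> inv_into (space M) R x = inv_into (space M) ?f x" using Z1 by blast
    have "measure M (sym_diff (?f ` A i) (R ` A i)) \<le> 2 * measure M Z"
      by (rule measure_sym_diff_image_le[OF f R(1) Af[OF i] Z(1)]) (use Z(3) AE[OF i] in auto)
    then show "measure M (sym_diff (act T (A i)) (act S (A i))) \<le> \<delta>"
      using measure_act_sym_diff[OF f R(1) Af[OF i]] Z(2) by (simp add: ae_class_rep[OF Tc] S_def)
    note fi = aut_maps_inv[OF f] and Ri = aut_maps_inv[OF R(1)]
    have "measure M (sym_diff (inv_into (space M) ?f ` A i) (inv_into (space M) R ` A i)) \<le> 2 * measure M Z"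
      by (rule measure_sym_diff_image_le[OF fi Ri Af[OF i] Z(1)]) (use Z(3) AE[OF i] in auto)
    then show "measure M (sym_diff (act (inv\<^bsub>Aut M\<^esub> T) (A i)) (act (inv\<^bsub>Aut M\<^esub> S) (A i))) \<le> \<delta>"
      using measure_act_sym_diff[OF fi Ri Af[OF i]] Z(2) by (simp add: inv_rep[OF Tc] Si)
  qed
  have c2: "\<forall>n::nat. \<forall>i\<in>I. \<forall>j\<in>I. \<bar>measure M (act (T [^]\<^bsub>Aut M\<^esub> n) (A i) \<inter> A j)
        - measure M (act (S [^]\<^bsub>Aut M\<^esub> n) (A i) \<inter> A j)\<bar> \<le> \<delta>"
  proof (intro allI ballI)
    fix n :: nat and i j assume i: "i \<in> I" and j: "j \<in> I"
    obtain Z where Z: "Z \<in> fmeasurable M" and Z': "measure M Z < \<delta> / 2 \<and>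
      (\<forall>x\<in>E - Z. (R ^^ n) x \<in> E \<or> (?f ^^ n) x \<in> E \<longrightarrow> (R ^^ n) x = (?f ^^ n) x)"
      using spec[OF Zn, of n] by (rule bexE)
    let ?P = "{x\<in>A i. (?f ^^ n) x \<in> A j}" and ?Q = "{x\<in>A i. (R ^^ n) x \<in> A j}"
    have e1: "measure M (act (T [^]\<^bsub>Aut M\<^esub> n) (A i) \<inter> A j) = measure M ?P"
      unfolding pow_rep[OF Tc] measure_act_Int[OF fn Af[OF i] Af[OF j]] by (rule measure_funpow_Int(2)[OF f Af[OF i] Af[OF j]])
    have e2: "measure M (act (S [^]\<^bsub>Aut M\<^esub> n) (A i) \<inter> A j) = measure M ?Q"
      unfolding Sn measure_act_Int[OF Rn Af[OF i] Af[OF j]] by (rule measure_funpow_Int(2)[OF R(1) Af[OF i] Af[OF j]])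
    have Pf: "?P \<in> fmeasurable M" and Qf: "?Q \<in> fmeasurable M"
      by (rule measure_funpow_Int(1)[OF f Af[OF i] Af[OF j]], rule measure_funpow_Int(1)[OF R(1) Af[OF i] Af[OF j]])
    have eqZ: "(R ^^ n) x = (?f ^^ n) x" if "x \<in> A i" "x \<notin> Z" "(R ^^ n) x \<in> A j \<or> (?f ^^ n) x \<in> A j" for x
      using bspec[OF conjunct2[OF Z'], of x] that AE[OF i] AE[OF j] by blast
    have PQ: "?P \<subseteq> ?Q \<union> Z" "?Q \<subseteq> ?P \<union> Z"
    proof -
      show "?P \<subseteq> ?Q \<union> Z"
      proof
        fix x assume x: "x \<in> ?P"
        show "x \<in> ?Q \<union> Z"
        proof (cases "x \<in> Z")
          case False
          then have "(R ^^ n) x = (?f ^^ n) x" using x by (intro eqZ) auto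
          then show ?thesis using x by simp
        qed simp
      qed
      show "?Q \<subseteq> ?P \<union> Z"
      proof
        fix x assume x: "x \<in> ?Q"
        show "x \<in> ?P \<union> Z"
        proof (cases "x \<in> Z")
          case False
          then have "(R ^^ n) x = (?f ^^ n) x" using x by (intro eqZ) auto
          then show ?thesis using x by simp
        qed simp
      qed
    qed
    have m1: "measure M ?P \<le> measure M (?Q \<union> Z)"
      by (rule measure_mono_fmeasurable[OF PQ(1) fmeasurableD[OF Pf] fmeasurable.Un[OF Qf Z]])
    have m2: "measure M ?Q \<le> measure M (?P \<union> Z)"
      by (rule measure_mono_fmeasurable[OF PQ(2) fmeasurableD[OF Qf] fmeasurable.Un[OF Pf Z]])
    have "measure M (?Q \<union> Z) \<le> measure M ?Q + measure M Z" "measure M (?P \<union> Z) \<le> measure M ?P + measure M Z"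
      by (rule measure_Un_le[OF fmeasurableD[OF Qf] fmeasurableD[OF Z]], rule measure_Un_le[OF fmeasurableD[OF Pf] fmeasurableD[OF Z]])
    then show "\<bar>measure M (act (T [^]\<^bsub>Aut M\<^esub> n) (A i) \<inter> A j) - measure M (act (S [^]\<^bsub>Aut M\<^esub> n) (A i) \<inter> A j)\<bar> \<le> \<delta>"
      unfolding e1 e2 using m1 m2 conjunct1[OF Z'] I(3) by linarith
  qed
  have "r_metric M A T S < \<epsilon>" using bspec[OF bspec[OF small Tc] Sc] c1 c2 by blast
  then show ?thesis using SM tS by blast
qed

theorem mainTheorem3:
  fixes M :: "'a measure" and A :: "nat \<Rightarrow> 'a set"
  assumes "isomorphic_mod0 M (lebesgue :: real measure)"
    and "dense_family M A"
  shows "\<exists>G. gdelta_in (Mix_topology M A) G \<and>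
             Mix_topology M A closure_of G = Mix M \<and>
             (\<forall>T\<in>G. \<forall>U\<in>carrier (Aut M).
                U \<otimes>\<^bsub>Aut M\<^esub> T = T \<otimes>\<^bsub>Aut M\<^esub> U \<longrightarrow> (\<exists>n::int. U = T [^]\<^bsub>Aut M\<^esub> n))"
proof -
  note iso = assms(1) and d = assms(2)
  interpret Metric_space "Mix M" "r_metric M A" by (rule Metric_space_Mix[OF assms])
  have top: "Mix_topology M A = mtopology" by (simp add: Mix_topology_def)
  \<comment> \<open>Each \<open>W m\<close> is open and involves only finitely many sets of the
    fixed dense sequence, so countably many of these conditions express rank one.\<close>
  define W where "W m = {T \<in> Mix M. tower_approx M (rep T) (A ` {1..m}) (1 / real (Suc m))}" for m :: nat
  define G where "G = (\<Inter>m. W m)"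
  have Mc: "T \<in> carrier (Aut M)" if "T \<in> Mix M" for T using that by (simp add: Mix_def)
  have sub: "A ` {1..m} \<subseteq> fmeasurable M" for m using d by (auto simp: dense_family_def)
  have "openin mtopology (W m)" for m
    unfolding openin_mtopology
  proof (intro conjI ballI)
    show "W m \<subseteq> Mix M" by (auto simp: W_def)
    show "\<forall>T. T \<in> W m \<longrightarrow> (\<exists>r>0. mball T r \<subseteq> W m)"
    proof (intro allI impI)
      fix T assume T: "T \<in> W m"
      then have TM: "T \<in> Mix M" and tow: "tower_approx M (rep T) (A ` {1..m}) (1 / real (Suc m))" by (auto simp: W_def)
      obtain \<delta> where "0 < \<delta>" "\<forall>S\<in>carrier (Aut M). r_metric M A T S < \<delta> \<longrightarrow> tower_approx M (rep S) (A ` {1..m}) (1 / real (Suc m))"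
        using tower_approx_open[OF d Mc[OF TM] _ sub tow] by auto
      then show "\<exists>r>0. mball T r \<subseteq> W m" using Mc by (intro exI[of _ \<delta>]) (auto simp: W_def)
    qed
  qed
  then have "gdelta_in mtopology (W m)" for m by (rule open_imp_gdelta_in)
  then have g: "gdelta_in mtopology G" unfolding G_def by (intro gdelta_in_Inter) auto
  have tow: "tower_approx M (rep T) \<B> \<epsilon>" if "T \<in> G" "finite \<B>" "\<B> \<subseteq> fmeasurable M" "0 < \<epsilon>" for T \<B> \<epsilon>
  proof (rule tower_approx_dense_family[OF d _ _ that(2,3,4)])
    show "tower_approx M (rep T) (A ` {1..m}) (1 / real (Suc m))" for m using that(1) by (auto simp: G_def W_def)
    have "T \<in> Mix M" using that(1) by (auto simp: G_def W_def)
    then show "rep T \<in> aut_maps M" by (intro rep_aut Mc)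
  qed
  have GM: "G \<subseteq> Mix M" by (auto simp: G_def W_def)
  have "mtopology closure_of G = Mix M"
  proof
    show "mtopology closure_of G \<subseteq> Mix M" using closure_of_subset_topspace[of mtopology G] by simp
    show "Mix M \<subseteq> mtopology closure_of G"
      unfolding metric_closure_of
    proof (intro subsetI CollectI conjI allI impI)
      fix T :: "('a \<Rightarrow> 'a) set" and \<epsilon> :: real assume T: "T \<in> Mix M" and \<epsilon>: "0 < \<epsilon>"
      obtain S where S: "S \<in> Mix M" "r_metric M A T S < \<epsilon>"
        and tS: "\<And>\<B> \<epsilon>. finite \<B> \<Longrightarrow> \<B> \<subseteq> fmeasurable M \<Longrightarrow> 0 < \<epsilon> \<Longrightarrow> tower_approx M (rep S) \<B> \<epsilon>"
        using rank_one_dense[OF iso d T \<epsilon>] by blast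
      have "S \<in> G" unfolding G_def W_def using S(1) tS[OF _ sub] by simp
      then show "\<exists>y\<in>G. y \<in> mball T \<epsilon>" using T S by auto
    qed
  qed
  moreover have "\<exists>n::int. U = T [^]\<^bsub>Aut M\<^esub> n"
    if T: "T \<in> G" and U: "U \<in> carrier (Aut M)" "U \<otimes>\<^bsub>Aut M\<^esub> T = T \<otimes>\<^bsub>Aut M\<^esub> U" for T U
  proof -
    have TM: "T \<in> Mix M" using T GM by blast
    have "mixing_map M (rep T)" using TM mixing_iff[OF Mc[OF TM]] by (simp add: Mix_def)
    then show ?thesis using centralizer_powers[OF iso Mc[OF TM] _ tow[OF T] U] by blast
  qed
  ultimately show ?thesis using g unfolding top by blast
qed

end
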